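(* Assume $\lambda>\mathrm{cf}(\lambda)=\theta$, $(\forall\alpha<\lambda)(|\alpha|^{<\kappa}<\lambda)$, and $\lambda>\kappa=\mathrm{cf}(\kappa)>\aleph_0$. 1) The following conditions are equivalent: (A) there are $\mathbf B$ and $a_\zeta$ ($\zeta<\theta$) such that (a) $\mathbf B$ is a $\kappa$-c.c. Boolean algebra; (b) $a_\zeta\in\mathbf B\setminus\{0\}$ for $\zeta<\theta$; (c) if $\langle w_\zeta:\zeta<\theta\rangle$ is a sequence of pairwise disjoint finite subsets of $\theta$, then for some finite $u\subseteq\theta$ we have $\bigcap_{\zeta\in u}\bigcup_{\xi\in w_\zeta}a_\xi=0$. (B) there is a $\kappa$-c.c. Boolean algebra $\mathbf B$ of cardinality $\lambda$ with no independent subset of cardinality $\lambda$. 2) The following conditions are equivalent: (A)$'$ there are $\mathbf B$ and $a_\zeta$ ($\zeta<\theta$) such that (a) $\mathbf B$ is a $\kappa$-c.c. Boolean algebra; (b) $a_\zeta\in\mathbf B\setminus\{0\}$ for $\zeta<\theta$; (c) for any $X\in[\theta]^\theta$, for some finite $w\subseteq X$ we have $\bigcap_{\zeta\in w}a_\zeta=0$. (B)$'$ there is a $\kappa$-c.c. Boolean algebra $\mathbf B$ of cardinality $\ge\lambda$ which does not have $\lambda$ as a free caliber.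
   Context: A Boolean algebra is $\kappa$-c.c. if it has no $\kappa$ pairwise disjoint nonzero elements. A subset $Y$ of a Boolean algebra is independent if $\bigcap_{y\in u}y\cap\bigcap_{y\in v}(-y)\ne0$ for all disjoint finite $u,v\subseteq Y$. $\lambda$ is a free caliber of $\mathbf B$ if every $X\subseteq\mathbf B$ with $|X|=\lambda$ has an independent subset of cardinality $\lambda$. $[\theta]^\theta$ is the set of subsets of $\theta$ of cardinality $\theta$; $|\alpha|^{<\kappa}=\sup_{\tau<\kappa}|\alpha|^\tau$. *)

theory Defs
  imports "HOL-Algebra.Lattice" "HOL-Library.Disjoint_Sets"
begin

unbundle cardinal_syntax

section \<open>Cardinals\<close>

text \<open>
  Cardinals are the relations satisfying \<^const>\<open>Card_order\<close>; an ordinal below a cardinal \<open>l\<close> is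
  given by an element \<open>x \<in> Field l\<close>, its underlying set being the initial segment \<open>underS l x\<close>.
\<close>

text \<open>The cofinality of a well-order: the least cardinality of a cofinal subset.\<close>

definition cf :: "'a rel \<Rightarrow> 'a rel" where
  "cf r = |SOME K. K \<subseteq> Field r \<and> cofinal K r \<and>
             (\<forall>K'. K' \<subseteq> Field r \<and> cofinal K' r \<longrightarrow> |K| \<le>o |K'| )|"

text \<open>
  The supremum of a set of cardinals that are all represented on the same type. It is again
  represented on that type, and it is unique up to \<open>=o\<close>.
\<close>

definition card_Sup :: "'a rel set \<Rightarrow> 'a rel" where
  "card_Sup R = (SOME s. Card_order s \<and> (\<forall>r\<in>R. r \<le>o s) \<and>
                   (\<forall>s' :: 'a rel. Card_order s' \<and> (\<forall>r\<in>R. r \<le>o s') \<longrightarrow> s \<le>o s'))"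

text \<open>
  The weak power: the supremum of \<open>m ^c t\<close> over all cardinals \<open>t <o k\<close>. Every such \<open>t\<close> is
  represented on the type of \<open>k\<close>.
\<close>

definition weak_cexp :: "'a rel \<Rightarrow> 'b rel \<Rightarrow> ('b \<Rightarrow> 'a) rel" where
  "weak_cexp m k = card_Sup {m ^c t | t :: 'b rel. Card_order t \<and> t <o k}"

lemma cf_least:
  assumes "Cinfinite r"
  shows "\<exists>K. K \<subseteq> Field r \<and> cofinal K r \<and> cf r = |K|"
    and "K' \<subseteq> Field r \<Longrightarrow> cofinal K' r \<Longrightarrow> cf r \<le>o |K'|"
proof -
  let ?P = "\<lambda>K. K \<subseteq> Field r \<and> cofinal K r"
  have "cofinal (Field r) r"
    unfolding cofinal_def using assms infinite_Card_order_limit[of r]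
    by (auto simp: cinfinite_def Field_def)
  then have "|Field r| \<in> {|K| |K. ?P K}" by auto
  from wfE_min[OF wf_ordLess this] obtain z
    where z: "z \<in> {|K| |K. ?P K}" "\<And>y. y <o z \<Longrightarrow> y \<notin> {|K| |K. ?P K}" by blast
  then obtain K where K: "?P K" "z = |K|" by auto
  have "|K| \<le>o |K'|" if "?P K'" for K'
  proof -
    have "|K'| \<in> {|K| |K. ?P K}" using that by blast
    then have "\<not> |K'| <o |K|" using z(2)[of "|K'|"] unfolding K(2) by blast
    then show ?thesis using not_ordLess_iff_ordLeq[OF card_of_Well_order card_of_Well_order] by blast
  qed
  with K(1) have "\<exists>K. K \<subseteq> Field r \<and> cofinal K r \<and>
             (\<forall>K'. K' \<subseteq> Field r \<and> cofinal K' r \<longrightarrow> |K| \<le>o |K'| )" by blast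
  from someI_ex[OF this]
  show "\<exists>K. K \<subseteq> Field r \<and> cofinal K r \<and> cf r = |K|"
    and "K' \<subseteq> Field r \<Longrightarrow> cofinal K' r \<Longrightarrow> cf r \<le>o |K'|"
    unfolding cf_def by blast+
qed

lemma card_Sup_least:
  fixes R :: "'a rel set" and s' :: "'b rel"
  assumes "\<forall>r\<in>R. Card_order r"
  shows "Card_order (card_Sup R)"
    and "r \<in> R \<Longrightarrow> r \<le>o card_Sup R"
    and "Card_order s' \<Longrightarrow> \<forall>r\<in>R. r \<le>o s' \<Longrightarrow> card_Sup R \<le>o s'"
proof -
  let ?S = "{s :: 'a rel. Card_order s \<and> (\<forall>r\<in>R. r \<le>o s)}"
  have "r \<le>o |UNIV :: 'a set|" if "r \<in> R" for r
  proof -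
    have "|Field r| =o r" using assms that by (intro card_of_Field_ordIso) simp
    from ordIso_symmetric[OF this] show ?thesis
      by (rule ordIso_ordLeq_trans[OF _ card_of_mono1[OF subset_UNIV]])
  qed
  then have "|UNIV :: 'a set| \<in> ?S" by (simp add: card_of_Card_order)
  from wfE_min[OF wf_ordLess this] obtain s
    where s: "s \<in> ?S" "\<And>y. y <o s \<Longrightarrow> y \<notin> ?S" by blast
  have "s \<le>o s'" if "s' \<in> ?S" for s' :: "'a rel"
  proof -
    have "\<not> s' <o s" using s(2)[of s'] that by blast
    moreover have "Well_order s" "Well_order s'"
      using s(1) that card_order_on_well_order_on by auto
    ultimately show ?thesis using not_ordLess_iff_ordLeq[of s s'] by blast
  qed
  with s(1) have "\<exists>s :: 'a rel. Card_order s \<and> (\<forall>r\<in>R. r \<le>o s) \<and>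
      (\<forall>s' :: 'a rel. Card_order s' \<and> (\<forall>r\<in>R. r \<le>o s') \<longrightarrow> s \<le>o s')" by blast
  from someI_ex[OF this, folded card_Sup_def]
  have c: "Card_order (card_Sup R)" and u: "\<forall>r\<in>R. r \<le>o card_Sup R"
    and l: "\<And>s' :: 'a rel. Card_order s' \<Longrightarrow> \<forall>r\<in>R. r \<le>o s' \<Longrightarrow> card_Sup R \<le>o s'"
    by blast+
  show "Card_order (card_Sup R)" by (fact c)
  show "r \<in> R \<Longrightarrow> r \<le>o card_Sup R" using u by blast
  assume s': "Card_order s'" "\<forall>r\<in>R. r \<le>o s'"
  show "card_Sup R \<le>o s'"
  proof (rule ccontr)
    assume "\<not> card_Sup R \<le>o s'"
    then have less: "s' <o card_Sup R"
      using not_ordLeq_iff_ordLess[of s' "card_Sup R"]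
        card_order_on_well_order_on[OF c] card_order_on_well_order_on[OF s'(1)] by simp
    have F: "|Field s'| =o s'" by (rule card_of_Field_ordIso[OF s'(1)])
    have "|Field s'| \<le>o card_Sup R"
      by (rule ordIso_ordLeq_trans[OF F ordLess_imp_ordLeq[OF less]])
    then obtain B where "|Field s'| =o |B :: 'a set|"
      using internalize_card_of_ordLeq[THEN iffD1] by blast
    then have B: "s' =o |B|" by (rule ordIso_transitive[OF ordIso_symmetric[OF F]])
    have "\<forall>r\<in>R. r \<le>o |B|"
      by (intro ballI ordLeq_ordIso_trans[OF _ B]) (rule s'(2)[rule_format])
    then have "card_Sup R \<le>o |B|" by (rule l[OF card_of_Card_order])
    then have "card_Sup R \<le>o s'" by (rule ordLeq_ordIso_trans[OF _ ordIso_symmetric[OF B]])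
    then show False using \<open>\<not> card_Sup R \<le>o s'\<close> by contradiction
  qed
qed

section \<open>Boolean algebras\<close>

text \<open>
  The theorem quantifies existentially over Boolean algebras, which the type class
  \<^class>\<open>boolean_algebra\<close> does not allow; hence Boolean algebras with an explicit carrier.
  They live on arbitrary types with at least \<open>l\<close> elements; such types have room for every algebra
  the theorem asks for, and universally quantifying over them stands in for the class of all algebras.
  Finite meets and joins are those of \<^theory>\<open>HOL-Algebra.Lattice\<close>; over the empty set
  they are the greatest and the least element. The one-element algebra is allowed.
\<close>

locale boolean_lattice = bounded_lattice L for L (structure) +
  assumes meet_join_distrib:
    "\<lbrakk>x \<in> carrier L; y \<in> carrier L; z \<in> carrier L\<rbrakk>
      \<Longrightarrow> x \<sqinter> (y \<squnion> z) = (x \<sqinter> y) \<squnion> (x \<sqinter> z)"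
    and complement_exists:
    "x \<in> carrier L \<Longrightarrow> \<exists>y\<in>carrier L. x \<sqinter> y = \<bottom> \<and> x \<squnion> y = \<top>"

definition complement :: "('a, 'm) gorder_scheme \<Rightarrow> 'a \<Rightarrow> 'a" where
  "complement B x =
     (THE y. y \<in> carrier B \<and> x \<sqinter>\<^bsub>B\<^esub> y = \<bottom>\<^bsub>B\<^esub> \<and> x \<squnion>\<^bsub>B\<^esub> y = \<top>\<^bsub>B\<^esub>)"

definition chain_condition :: "'k rel \<Rightarrow> ('a, 'm) gorder_scheme \<Rightarrow> bool" where
  "chain_condition k B \<longleftrightarrow>
     \<not> (\<exists>D. D \<subseteq> carrier B - {\<bottom>\<^bsub>B\<^esub>} \<and> |D| =o k \<and>
            (\<forall>x\<in>D. \<forall>y\<in>D. x \<noteq> y \<longrightarrow> x \<sqinter>\<^bsub>B\<^esub> y = \<bottom>\<^bsub>B\<^esub>))"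

definition independent :: "('a, 'm) gorder_scheme \<Rightarrow> 'a set \<Rightarrow> bool" where
  "independent B Y \<longleftrightarrow>
     (\<forall>u v. finite u \<and> finite v \<and> u \<subseteq> Y \<and> v \<subseteq> Y \<and> u \<inter> v = {} \<longrightarrow>
        (IINF\<^bsub>B\<^esub> y:u. y) \<sqinter>\<^bsub>B\<^esub> (IINF\<^bsub>B\<^esub> y:v. complement B y) \<noteq> \<bottom>\<^bsub>B\<^esub>)"

definition free_caliber :: "'l rel \<Rightarrow> ('a, 'm) gorder_scheme \<Rightarrow> bool" where
  "free_caliber l B \<longleftrightarrow>
     (\<forall>X. X \<subseteq> carrier B \<and> |X| =o l \<longrightarrow> (\<exists>Y. Y \<subseteq> X \<and> independent B Y \<and> |Y| =o l))"

end

theory Submission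
  imports Defs "HOL-Algebra.Free_Abelian_Groups"
begin

text \<open>
  Write \<open>\<lambda>\<close> for \<open>l\<close>. Both equivalences pass through a purely combinatorial third condition: the
  existence of a simplicial complex \<open>S\<close> on \<open>\<theta>\<close> that has no \<open>\<kappa>\<close> pairwise incompatible faces (faces whose
  unions are not faces) and that satisfies the clause (c) of the respective part, read as a statement about
  faces (\<open>scattered\<close> and \<open>no_large_centred\<close>). Elements \<open>a \<zeta>\<close> of a \<open>\<kappa>\<close>-c.c. algebra have such a complex as
  their nerve, the family of finite sets over which they have a nonzero meet. Conversely a complex gives
  back an algebra, consisting of the sets of faces in which membership depends on finitely many vertices.
  Finite faces are enough as points, and a Delta-system argument (\<open>chain_condition_supported\<close>) shows
  that this algebra inherits the chain condition from the complex.

  From complexes to algebras of cardinality \<open>\<lambda>\<close>: each vertex \<open>\<zeta>\<close> is blown up to fewer than \<open>\<lambda>\<close>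
  copies, \<open>\<lambda>\<close> copies in total, and a finite set of copies is a face when its projection to \<open>\<theta>\<close> is one. If
  \<open>\<lambda>\<close> many elements were independent, then a pigeonhole argument on their traces over fewer than \<open>\<theta>\<close> many
  levels would produce \<open>\<theta>\<close> many pairs of them with differences that live over pairwise disjoint finite sets
  of levels; independence makes finitely many such differences meet, against scatteredness
  (\<open>no_independent_supported\<close>). For the second part the generators alone form the set
  without a large independent subset.

  From algebras to complexes: the key fact is \<open>splitting_element\<close>. Among more than
  \<open>\<tau> = \<mu>^{<\<kappa>}\<close> elements of a \<open>\<kappa>\<close>-c.c. field of sets there is room over some nonempty \<open>x\<close>: for any
  \<open>\<tau>\<close> nonempty sets \<open>y \<subseteq> x\<close> one of the given elements cuts all of them. Taking \<open>\<tau>\<close> cofinal in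
  \<open>\<lambda>\<close> gives \<open>\<theta>\<close> many such \<open>x \<zeta>\<close>. If their nerve violated the condition wanted, then a recursion of length
  \<open>\<lambda>\<close> (\<open>independent_family\<close>), which at each step cuts all nonempty Boolean combinations obtained
  so far below a suitable join of the \<open>x \<zeta>\<close>, would construct an independent set of cardinality \<open>\<lambda>\<close>.

  Algebras are replaced by fields of sets through Stone's theorem, so that all of this
  happens with plain sets.
\<close>

section \<open>Small subsets and cofinalities\<close>

lemma maximal_pairwise:
  assumes "symp R"
  shows "\<exists>E\<subseteq>T. pairwise R E \<and> (\<forall>t\<in>T - E. \<exists>e\<in>E. \<not> R t e)"
proof -
  let ?A = "{E. E \<subseteq> T \<and> pairwise R E}"
  have "\<exists>E\<in>?A. \<forall>X\<in>?A. E \<subseteq> X \<longrightarrow> X = E"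
  proof (rule subset_Zorn')
    fix C assume C: "subset.chain ?A C"
    have "pairwise R (\<Union>C)"
      unfolding pairwise_def
    proof (intro ballI impI)
      fix x y assume "x \<in> \<Union>C" "y \<in> \<Union>C" "x \<noteq> y"
      then obtain X Y where "X \<in> C" "Y \<in> C" "x \<in> X" "y \<in> Y" by blast
      moreover from this C have "X \<subseteq> Y \<or> Y \<subseteq> X" unfolding subset_chain_def by blast
      ultimately obtain Z where "Z \<in> C" "x \<in> Z" "y \<in> Z" by blast
      then show "R x y" using C \<open>x \<noteq> y\<close> by (auto simp: subset.chain_def pairwise_def)
    qed
    then show "\<Union>C \<in> ?A" using C by (auto simp: subset.chain_def)
  qed
  then obtain E where "E \<in> ?A" and "\<forall>X\<in>?A. E \<subseteq> X \<longrightarrow> X = E" ..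
  then have E: "E \<subseteq> T" "pairwise R E"
    and max: "X \<subseteq> T \<Longrightarrow> pairwise R X \<Longrightarrow> E \<subseteq> X \<Longrightarrow> X = E" for X by simp_all
  have "\<exists>e\<in>E. \<not> R t e" if t: "t \<in> T - E" for t
  proof (rule ccontr)
    assume "\<not> ?thesis"
    then have "pairwise R (insert t E)"
      using E(2) sympD[OF assms] unfolding pairwise_insert by blast
    then show False using max[of "insert t E"] E(1) t by blast
  qed
  then show ?thesis using E by blast
qed

lemma Card_order_linear:
  assumes "Card_order r"
  shows "trans r" "antisym r" "a \<in> Field r \<Longrightarrow> (a, a) \<in> r"
    "a \<in> Field r \<Longrightarrow> b \<in> Field r \<Longrightarrow> (a, b) \<in> r \<or> (b, a) \<in> r" "wf (r - Id)"
proof -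
  have wo: "Well_order r" using assms by (rule card_order_on_well_order_on)
  then have "wo_rel r" by (simp add: wo_rel_def)
  from wo_rel.TRANS[OF this] wo_rel.ANTISYM[OF this] wo_rel.REFL[OF this] wo_rel.TOTALS[OF this] wo
  show "trans r" "antisym r" "a \<in> Field r \<Longrightarrow> (a, a) \<in> r"
    "a \<in> Field r \<Longrightarrow> b \<in> Field r \<Longrightarrow> (a, b) \<in> r \<or> (b, a) \<in> r" "wf (r - Id)"
    by (auto simp: refl_on_def well_order_on_def)
qed

lemma underS_card_mono: "Card_order r \<Longrightarrow> (a, b) \<in> r \<Longrightarrow> |underS r a| \<le>o |underS r b|"
  using Card_order_linear(1,2)[of r] by (intro card_of_mono1) (auto simp: underS_def dest: transD antisymD)

lemma regularCard_if_cf: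
  assumes "Cinfinite r" "cf r =o r"
  shows "regularCard r"
  unfolding regularCard_def
proof (intro allI impI, elim conjE)
  fix K assume K: "K \<subseteq> Field r" "cofinal K r"
  have "r \<le>o |K|"
    by (rule ordIso_ordLeq_trans[OF ordIso_symmetric[OF assms(2)] cf_least(2)[OF assms(1) K]])
  moreover have "|K| \<le>o r"
    by (rule ordLeq_ordIso_trans[OF card_of_mono1[OF K(1)] card_of_Field_ordIso]) (use assms in blast)
  ultimately show "|K| =o r" by (simp add: ordIso_iff_ordLeq)
qed

text \<open>
  The family usually written \<open>[A]^{<k}\<close>; its cardinality plays the role of the power \<open>|A|^{<k}\<close>.
\<close>

definition Pow_less :: "'k rel \<Rightarrow> 'a set \<Rightarrow> 'a set set" where
  "Pow_less k A = {P. P \<subseteq> A \<and> |P| <o k}"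

lemma Pow_less_mono: "|A| \<le>o |B| \<Longrightarrow> |Pow_less k A| \<le>o |Pow_less k B|"
proof -
  assume "|A| \<le>o |B|"
  then obtain f where f: "inj_on f A" "f ` A \<subseteq> B" by (auto simp: card_of_ordLeq[symmetric])
  show ?thesis
  proof (rule card_of_ordLeqI)
    show "inj_on (image f) (Pow_less k A)"
      by (rule inj_on_subset[OF inj_on_image_Pow[OF f(1)]]) (auto simp: Pow_less_def)
    show "f ` P \<in> Pow_less k B" if "P \<in> Pow_less k A" for P
      using that f(2) ordLeq_ordLess_trans[OF card_of_image] by (fastforce simp: Pow_less_def)
  qed
qed

locale regular_uncountable =
  fixes k :: "'k rel"
  assumes card: "Card_order k" and regular: "regularCard k" and uncountable: "natLeq <o k"
begin

lemma Cinf: "Cinfinite k"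
  using card natLeq_Cinfinite cinfinite_mono[OF ordLess_imp_ordLeq[OF uncountable]] by blast

lemma finite_less: "finite A \<Longrightarrow> |A| <o k"
  by (rule ordLess_transitive[OF _ uncountable]) (simp add: finite_iff_ordLess_natLeq[symmetric])

lemma UNION_less: "|I| <o k \<Longrightarrow> (\<And>i. i \<in> I \<Longrightarrow> |A i| <o k) \<Longrightarrow> |\<Union>i\<in>I. A i| <o k"
  using card_of_UNION_ordLess_infinite_Field_regularCard[OF regular Cinf] by blast

lemma image_less: "|A| <o k \<Longrightarrow> |f ` A| <o k"
  using ordLeq_ordLess_trans[OF card_of_image] by blast

lemma mono_less: "|B| <o k \<Longrightarrow> A \<subseteq> B \<Longrightarrow> |A| <o k"
  using ordLeq_ordLess_trans[OF card_of_mono1] by blast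

lemma not_less_iff: "\<not> |A| <o k \<longleftrightarrow> k \<le>o |A|"
  using not_ordLess_iff_ordLeq[OF card_order_on_well_order_on[OF card] card_of_Well_order] by blast

lemma obtain_subset:
  assumes "\<not> |A| <o k"
  obtains B where "B \<subseteq> A" "|B| =o k"
proof -
  have "|Field k| \<le>o |A|"
    using assms card_of_Field_ordIso[OF card] by (simp add: not_less_iff ordIso_ordLeq_trans)
  then obtain f where f: "inj_on f (Field k)" "f ` Field k \<subseteq> A"
    by (auto simp: card_of_ordLeq[symmetric])
  have "|f ` Field k| =o k"
    using f(1) card_of_Field_ordIso[OF card]
    by (meson card_of_ordIsoI inj_on_imp_bij_betw ordIso_symmetric ordIso_transitive)
  then show ?thesis using that f(2) by blast
qed

lemma le_Pow_less: "|A| \<le>o |Pow_less k A|"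
  by (rule card_of_ordLeqI[of "\<lambda>a. {a}"]) (auto simp: Pow_less_def finite_less)

text \<open>
  A family of fewer than \<open>k\<close> sets, indexed by elements of \<open>k\<close>, is coded by a subset of \<open>k \<times> A\<close>, which by
  regularity has fewer than \<open>k\<close> elements. The extra point \<open>None\<close> marks the indices in use, so that an empty
  member of the family is not lost.
\<close>

lemma Pow_less_idem:
  assumes mu: "k \<le>o |A|"
  shows "|Pow_less k (Pow_less k A)| \<le>o |Pow_less k A|"
proof -
  let ?O = "insert None (Some ` A)"
  have kA: "|Field k| \<le>o |A|"
    using mu card_of_Field_ordIso[OF card] ordIso_ordLeq_trans by blast
  have inf: "infinite A"
    using kA Cinf card_of_ordLeq_infinite by (auto simp: cinfinite_def)
  then have Cin: "Cinfinite |A|" by (simp add: cinfinite_def Field_card_of card_of_Card_order)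
  have "|{None} \<union> Some ` A| \<le>o |A|"
    by (rule Un_Cinfinite_bound[OF card_of_singl_ordLeq card_of_image Cin]) (use inf in auto)
  then have "|?O| \<le>o |A|" by simp
  then have "|Field k \<times> ?O| \<le>o |A|"
    using kA inf card_of_Times_ordLeq_infinite_Field[of "|A|" "Field k" ?O]
    by (simp add: Field_card_of card_of_Card_order)
  then have 1: "|Pow_less k (Field k \<times> ?O)| \<le>o |Pow_less k A|" by (rule Pow_less_mono)
  have "Pow_less k (Pow_less k A) \<subseteq>
      (\<lambda>R. {{p. (j, Some p) \<in> R} | j. (j, None) \<in> R}) ` Pow_less k (Field k \<times> ?O)"
  proof
    fix Q assume Q: "Q \<in> Pow_less k (Pow_less k A)"
    then have "|Q| <o k" by (simp add: Pow_less_def)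
    from ordLess_imp_ordLeq[OF ordLess_ordIso_trans[OF this ordIso_symmetric[OF card_of_Field_ordIso[OF card]]]]
    have "|Q| \<le>o |Field k|" .
    then obtain f where f: "inj_on f Q" "f ` Q \<subseteq> Field k" by (auto simp: card_of_ordLeq[symmetric])
    define R where "R = (\<Union>P\<in>Q. {f P} \<times> insert None (Some ` P))"
    have "|{f P} \<times> insert None (Some ` P)| <o k" if "P \<in> Q" for P
    proof -
      have "|P| <o k" using that Q by (auto simp: Pow_less_def)
      have "|{None} \<union> Some ` P| <o k"
        using \<open>|P| <o k\<close> Cinf by (intro Un_Cinfinite_bound_strict image_less) (auto intro: finite_less)
      then have "|(\<lambda>x. (f P, x)) ` ({None} \<union> Some ` P)| <o k" by (rule image_less)
      then show ?thesis by (rule mono_less) auto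
    qed
    then have "|R| <o k" using Q unfolding R_def by (intro UNION_less) (auto simp: Pow_less_def)
    moreover have "R \<subseteq> Field k \<times> ?O" using f(2) Q by (auto simp: R_def Pow_less_def)
    moreover have "{{p. (j, Some p) \<in> R} | j. (j, None) \<in> R} = Q"
    proof -
      have *: "{p. (f P, Some p) \<in> R} = P" if "P \<in> Q" for P
        using that inj_onD[OF f(1) _ that] by (auto simp: R_def)
      have "{{p. (j, Some p) \<in> R} | j. (j, None) \<in> R} = (\<lambda>P. {p. (f P, Some p) \<in> R}) ` Q"
        by (auto simp: R_def)
      also have "\<dots> = Q" using * by simp
      finally show ?thesis .
    qed
    ultimately show "Q \<in> (\<lambda>R. {{p. (j, Some p) \<in> R} | j. (j, None) \<in> R}) ` Pow_less k (Field k \<times> ?O)"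
      unfolding Pow_less_def by blast
  qed
  from ordLeq_transitive[OF surj_imp_ordLeq[OF this] 1] show ?thesis .
qed

lemma Pow_less_bound:
  assumes "k \<le>o |A|" "|X| \<le>o |Pow_less k A|"
  shows "|Pow_less k X| \<le>o |Pow_less k A|"
  by (rule ordLeq_transitive[OF Pow_less_mono[OF assms(2)] Pow_less_idem[OF assms(1)]])

lemma Cinfinite_Pow_less:
  assumes "k \<le>o |A|" shows "Cinfinite |Pow_less k A|"
proof -
  have "k \<le>o |Pow_less k A|" using assms le_Pow_less ordLeq_transitive by blast
  then show ?thesis using Cinf cinfinite_mono card_of_Card_order by blast
qed

text \<open>
  Closing off \<open>k\<close> times suffices: by regularity, fewer than \<open>k\<close> elements of the union of the stages
  lie in a single stage.
\<close>

lemma closed_set_exists: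
  fixes F :: "'x set \<Rightarrow> 'x set"
  assumes A: "k \<le>o |A|" and F: "\<And>C. |C| <o k \<Longrightarrow> |F C| \<le>o |Pow_less k A|"
  shows "\<exists>N. |N| \<le>o |Pow_less k A| \<and> (\<forall>C\<subseteq>N. |C| <o k \<longrightarrow> F C \<subseteq> N)"
proof -
  let ?R = "k - Id"
  have wf: "wf ?R" by (rule Card_order_linear(5)[OF card])
  define G where "G = (\<lambda>(h :: 'k \<Rightarrow> 'x set) i. \<Union>j\<in>underS k i. \<Union>C\<in>Pow_less k (h j). F C)"
  define N where "N = wfrec ?R G"
  have "adm_wf ?R G"
    unfolding adm_wf_def G_def by (auto simp: underS_def)
  from wfrec_fixpoint[OF wf this] have N: "N i = G N i" for i by (simp add: N_def)
  note Cin = Cinfinite_Pow_less[OF A]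
  have card_N: "|N i| \<le>o |Pow_less k A|" for i
  proof (induction i rule: wf_induct_rule[OF wf])
    case (1 i)
    have "|underS k i| \<le>o k"
    proof (cases "i \<in> Field k")
      case True then show ?thesis using card_of_underS[OF card] ordLess_imp_ordLeq by blast
    next
      case False
      then have "underS k i = {}" by (auto simp: underS_def Field_def)
      then show ?thesis by (simp add: Card_order_empty card)
    qed
    also have "k \<le>o |Pow_less k A|" using A le_Pow_less ordLeq_transitive by blast
    finally have u: "|underS k i| \<le>o |Pow_less k A|" .
    have "|\<Union>C\<in>Pow_less k (N j). F C| \<le>o |Pow_less k A|" if "j \<in> underS k i" for j
    proof -
      have "|N j| \<le>o |Pow_less k A|" using that 1 by (auto simp: underS_def)
      from Pow_less_bound[OF A this] show ?thesis
        by (intro UNION_Cinfinite_bound[OF _ _ Cin] ballI F) (simp_all add: Pow_less_def)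
    qed
    then show ?case
      unfolding N[of i] G_def by (intro UNION_Cinfinite_bound[OF u _ Cin]) blast
  qed
  have chain: "relChain k N"
    unfolding relChain_def
  proof (intro allI impI)
    fix i j assume "(i, j) \<in> k"
    then have "underS k i \<subseteq> underS k j"
      using Card_order_linear(1,2)[OF card] by (auto simp: underS_def dest: transD antisymD)
    then show "N i \<subseteq> N j" unfolding N[of i] N[of j] G_def by blast
  qed
  have closed: "F C \<subseteq> (\<Union>i\<in>Field k. N i)" if C: "C \<subseteq> (\<Union>i\<in>Field k. N i)" "|C| <o k" for C
  proof -
    obtain i where i: "i \<in> Field k" "C \<subseteq> N i"
      using regularCard_UNION[OF card regular chain C] by blast
    obtain j where j: "j \<in> Field k" "i \<noteq> j" "(i, j) \<in> k"
      using infinite_Card_order_limit[OF card _ i(1)] Cinf by (auto simp: cinfinite_def)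
    have "F C \<subseteq> N j"
      unfolding N[of j] G_def using i j C(2) by (auto simp: underS_def Pow_less_def)
    then show ?thesis using j(1) by blast
  qed
  have "|\<Union>i\<in>Field k. N i| \<le>o |Pow_less k A|"
  proof (rule UNION_Cinfinite_bound[OF _ _ Cin])
    show "|Field k| \<le>o |Pow_less k A|"
      using card_of_Field_ordIso[OF card] A le_Pow_less[of A]
      by (meson ordIso_ordLeq_trans ordLeq_transitive)
  qed (use card_N in blast)
  then show ?thesis using closed by blast
qed

text \<open>
  A nonempty set of fewer than \<open>k\<close> elements is the range of a function on a proper initial segment of \<open>k\<close>, so
  \<open>[A]^{<k}\<close> is covered by \<open>k\<close> many function spaces, each of them bounded by the weak power.
\<close>

lemma Pow_less_less:
  fixes l :: "'l rel"
  assumes l: "Cinfinite l" "k <o l" and w: "weak_cexp |A| k <o l" and "A \<noteq> {}"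
  shows "|Pow_less k A| <o l"
proof -
  let ?w = "weak_cexp |A| k"
  let ?R = "{|A| ^c t | t :: 'k rel. Card_order t \<and> t <o k}"
  have R: "\<forall>r\<in>?R. Card_order r" by (auto simp: Card_order_cexp)
  have Cw: "Card_order ?w" unfolding weak_cexp_def by (rule card_Sup_least(1)[OF R])
  let ?S = "Field k <+> Field ?w"
  have fk: "|Field k| =o k" and fw: "|Field ?w| =o ?w"
    using card_of_Field_ordIso card Cw by blast+
  have infS: "infinite ?S" using Cinf by (auto simp: cinfinite_def)
  have less: "|?S| <o l"
    using l w fk fw by (intro card_of_Plus_ordLess_infinite_Field)
      (auto simp: cinfinite_def intro: ordIso_ordLess_trans)
  have CS: "Cinfinite |?S|" using infS by (simp add: cinfinite_def Field_card_of card_of_Card_order)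
  have wS: "?w \<le>o |?S|" using card_of_Plus2 fw ordIso_symmetric ordIso_ordLeq_trans by blast
  have F: "|Func (underS k i) A| \<le>o |?S|" if i: "i \<in> Field k" for i
  proof -
    have "|A| ^c |underS k i| \<in> ?R"
      using card_of_underS[OF card i] card_of_Card_order by blast
    then have "|A| ^c |underS k i| \<le>o ?w"
      unfolding weak_cexp_def by (rule card_Sup_least(2)[OF R])
    then have "|Func (underS k i) A| \<le>o ?w" by (simp add: cexp_def Field_card_of)
    then show ?thesis using wS ordLeq_transitive by blast
  qed
  let ?U = "\<Union>i\<in>Field k. (\<lambda>f. f ` underS k i) ` Func (underS k i) A"
  have U: "|?U| \<le>o |?S|"
  proof (rule UNION_Cinfinite_bound[OF card_of_Plus1 _ CS])
    show "\<forall>i\<in>Field k. |(\<lambda>f. f ` underS k i) ` Func (underS k i) A| \<le>o |?S|"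
      using F card_of_image ordLeq_transitive by blast
  qed
  have "Pow_less k A \<subseteq> insert {} ?U"
  proof
    fix P assume P: "P \<in> Pow_less k A"
    show "P \<in> insert {} ?U"
    proof (cases "P = {}")
      case False
      have "|P| <o k" using P by (simp add: Pow_less_def)
      then obtain i where i: "i \<in> Field k" "|P| =o Restr k (underS k i)"
        using ordLess_iff_ordIso_Restr[OF card_order_on_well_order_on[OF card] card_of_Well_order]
        by blast
      have "|P| \<le>o |underS k i|"
        using ordIso_ordLeq_trans[OF card_of_cong[OF i(2)] card_of_mono1[OF Field_Restr_subset]]
        by (simp add: Field_card_of)
      then obtain g where g: "g ` underS k i = P" unfolding card_of_ordLeq2[OF False, symmetric] ..
      let ?f = "\<lambda>a. if a \<in> underS k i then g a else undefined"
      have "g a \<in> A" if "a \<in> underS k i" for a using g P that by (auto simp: Pow_less_def)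
      then have "?f \<in> Func (underS k i) A" by (simp add: Func_def)
      moreover have "?f ` underS k i = P" using g by simp
      ultimately show ?thesis using i(1) by blast
    qed simp
  qed
  moreover have "?S \<noteq> {}" using infS by (metis finite.emptyI)
  then have "|insert {} ?U| \<le>o |?S|"
    using Un_Cinfinite_bound[OF card_of_singl_ordLeq U CS, of "{}"] by simp
  ultimately have "|Pow_less k A| \<le>o |?S|" by (rule ordLeq_transitive[OF card_of_mono1])
  then show ?thesis by (rule ordLeq_ordLess_trans[OF _ less])
qed

end

lemma finite_bounded:
  assumes l: "Cinfinite l" and "finite K" "K \<subseteq> Field l"
  shows "\<exists>s\<in>Field l. \<forall>x\<in>K. (x, s) \<in> l"
  using assms(2,3)
proof (induction K)
  case empty
  then show ?case using l by (auto simp: cinfinite_def dest: infinite_imp_nonempty)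
next
  case (insert x K)
  then obtain s where s: "s \<in> Field l" "\<forall>x\<in>K. (x, s) \<in> l" by auto
  have C: "Card_order l" using l by blast
  have "(x, s) \<in> l \<or> (s, x) \<in> l" using insert.prems s(1) Card_order_linear(4)[OF C] by auto
  then show ?case using s insert.prems Card_order_linear(1,3)[OF C] by (auto dest: transD)
qed

lemma less_cf_bounded:
  assumes l: "Cinfinite l" and K: "K \<subseteq> Field l" "|K| <o cf l"
  shows "\<exists>s\<in>Field l. \<forall>x\<in>K. (x, s) \<in> l"
proof -
  have C: "Card_order l" using l by blast
  have "\<not> cofinal K l" using cf_least(2)[OF l K(1)] K(2) not_ordLess_ordLeq by blast
  then obtain a where "a \<in> Field l" "\<And>b. b \<in> K \<Longrightarrow> a = b \<or> (a, b) \<notin> l"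
    unfolding cofinal_def by blast
  then show ?thesis using Card_order_linear(3,4)[OF C] K(1) by (metis subsetD)
qed

lemma Cinfinite_cf:
  assumes l: "Cinfinite l"
  shows "Cinfinite (cf l)"
proof -
  obtain K where K: "K \<subseteq> Field l" "cofinal K l" "cf l = |K|" using cf_least(1)[OF l] by blast
  have C: "Card_order l" using l by blast
  have "infinite K"
  proof
    assume "finite K"
    then obtain s where s: "s \<in> Field l" "\<forall>x\<in>K. (x, s) \<in> l" using finite_bounded[OF l _ K(1)] by blast
    then obtain b where "b \<in> K" "s \<noteq> b" "(s, b) \<in> l" using K(2) by (auto simp: cofinal_def)
    then show False using s Card_order_linear(2)[OF C] by (auto dest: antisymD)
  qed
  then show ?thesis using K(3) by (simp add: cinfinite_def Field_card_of card_of_Card_order)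
qed

text \<open>
  The members of a cofinal set, enumerated along \<open>t\<close>, are replaced by upper bounds of the initial segments
  of the enumeration, which exist because these segments are shorter than the cofinality. This is what makes
  every \<open>i\<close> bounded by all but few values. The lower bound \<open>s0\<close> keeps all values large.
\<close>

lemma cofinal_enumeration:
  fixes l :: "'l rel" and t :: "'t rel"
  assumes l: "Cinfinite l" and t: "Card_order t" and cf: "cf l =o t" and s0: "s0 \<in> Field l"
  obtains c where "\<And>z. z \<in> Field t \<Longrightarrow> c z \<in> Field l" "\<And>z. z \<in> Field t \<Longrightarrow> (s0, c z) \<in> l"
    "\<And>i. i \<in> Field l \<Longrightarrow> |{z \<in> Field t. (i, c z) \<notin> l}| <o t"
proof -
  have C: "Card_order l" using l by blast
  obtain K where K: "K \<subseteq> Field l" "cofinal K l" "cf l = |K|" using cf_least(1)[OF l] by blast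
  have "|Field t| =o |K|"
    using K(3) cf card_of_Field_ordIso[OF t] by (metis ordIso_symmetric ordIso_transitive)
  then obtain e where e: "bij_betw e (Field t) K" using card_of_ordIso by blast
  have "\<exists>s\<in>Field l. \<forall>x\<in>insert s0 (insert (e z) (e ` underS t z)). (x, s) \<in> l" if z: "z \<in> Field t" for z
  proof -
    have "|e ` underS t z| <o cf l"
      using card_of_underS[OF t z] card_of_image[of e] ordIso_symmetric[OF cf]
      by (meson ordLeq_ordLess_trans ordLess_ordIso_trans)
    moreover have "e ` underS t z \<subseteq> Field l"
      using e K(1) by (auto simp: bij_betw_def underS_def Field_def)
    ultimately obtain s where s: "s \<in> Field l" "\<forall>x\<in>e ` underS t z. (x, s) \<in> l"
      using less_cf_bounded[OF l] by blast
    have "e z \<in> Field l" using e z K(1) by (auto simp: bij_betw_def)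
    then obtain s' where "s' \<in> Field l" "(s0, s') \<in> l" "(e z, s') \<in> l" "(s, s') \<in> l"
      using finite_bounded[OF l, of "{s0, e z, s}"] s0 s(1) by auto
    then show ?thesis using s(2) Card_order_linear(1)[OF C] by (auto dest: transD)
  qed
  then obtain c where c: "\<And>z. z \<in> Field t \<Longrightarrow> c z \<in> Field l"
    "\<And>z. z \<in> Field t \<Longrightarrow> (s0, c z) \<in> l" "\<And>z. z \<in> Field t \<Longrightarrow> (e z, c z) \<in> l"
    "\<And>z x. z \<in> Field t \<Longrightarrow> x \<in> underS t z \<Longrightarrow> (e x, c z) \<in> l"
    by (metis (no_types, lifting) image_eqI insertCI)
  have "|{z \<in> Field t. (i, c z) \<notin> l}| <o t" if i: "i \<in> Field l" for i
  proof -
    obtain b where "b \<in> K" "(i, b) \<in> l" using K(2) i by (auto simp: cofinal_def)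
    then obtain x where x: "x \<in> Field t" "(i, e x) \<in> l" using e by (auto simp: bij_betw_def)
    have "{z \<in> Field t. (i, c z) \<notin> l} \<subseteq> underS t x"
    proof (clarify, rule ccontr)
      fix z assume z: "z \<in> Field t" "(i, c z) \<notin> l" "z \<notin> underS t x"
      then have "x = z \<or> x \<in> underS t z" using Card_order_linear(4)[OF t _ x(1)] by (auto simp: underS_def)
      then have "(e x, c z) \<in> l" using c(3,4) z(1) by blast
      then show False using x(2) z(2) Card_order_linear(1)[OF C] by (blast dest: transD)
    qed
    then show ?thesis
      using card_of_underS[OF t x(1)] card_of_mono1 ordLeq_ordLess_trans by blast
  qed
  then show ?thesis using that c(1,2) by blast
qed

lemma less_imp_le_underS:
  assumes "Card_order l" "Card_order r" "r <o l"
  shows "\<exists>s\<in>Field l. r \<le>o |underS l s|"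
proof -
  obtain s where s: "s \<in> Field l" "r =o Restr l (underS l s)"
    using ordLess_iff_ordIso_Restr[OF card_order_on_well_order_on[OF assms(1)] card_order_on_well_order_on[OF assms(2)]]
      assms(3) by blast
  have "|Field r| \<le>o |underS l s|"
    using card_of_cong[OF s(2)] Field_Restr_subset[of l "underS l s"]
    by (metis card_of_mono1 ordIso_ordLeq_trans)
  then have "r \<le>o |underS l s|"
    using card_of_Field_ordIso[OF assms(2)] ordIso_symmetric ordIso_ordLeq_trans by blast
  then show ?thesis using s(1) by blast
qed

section \<open>Splitting elements in fields of sets with a chain condition\<close>

locale field_of_sets =
  fixes U :: "'p set" and M :: "'p set set"
  assumes sub: "M \<subseteq> Pow U" and top: "U \<in> M"
    and Int: "x \<in> M \<Longrightarrow> y \<in> M \<Longrightarrow> x \<inter> y \<in> M"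
    and Compl: "x \<in> M \<Longrightarrow> U - x \<in> M"
begin

lemma Diff: "x \<in> M \<Longrightarrow> y \<in> M \<Longrightarrow> x - y \<in> M"
proof -
  assume xy: "x \<in> M" "y \<in> M"
  then have "x - y = x \<inter> (U - y)" using sub by blast
  then show ?thesis using xy by (simp add: Int Compl)
qed

lemma Un: "x \<in> M \<Longrightarrow> y \<in> M \<Longrightarrow> x \<union> y \<in> M"
proof -
  assume xy: "x \<in> M" "y \<in> M"
  then have "x \<union> y = U - ((U - x) \<inter> (U - y))" using sub by blast
  then show ?thesis using xy by (simp add: Int Compl)
qed

lemma empty: "{} \<in> M" using Diff[OF top top] by simp

lemma finite_Inter: "finite A \<Longrightarrow> A \<subseteq> M \<Longrightarrow> U \<inter> \<Inter>A \<in> M"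
proof (induction A rule: finite_induct)
  case empty then show ?case by (simp add: top)
next
  case (insert x A)
  then have "x \<inter> (U \<inter> \<Inter>A) \<in> M" by (simp add: Int)
  moreover have "x \<inter> (U \<inter> \<Inter>A) = U \<inter> \<Inter>(insert x A)" by auto
  ultimately show ?case by simp
qed

lemma finite_Union: "finite A \<Longrightarrow> A \<subseteq> M \<Longrightarrow> \<Union>A \<in> M"
  by (induction A rule: finite_induct) (simp_all add: empty Un)

end

definition set_chain_condition :: "'k rel \<Rightarrow> 'p set set \<Rightarrow> bool" where
  "set_chain_condition k M \<longleftrightarrow> \<not> (\<exists>D\<subseteq>M - {{}}. |D| =o k \<and> disjoint D)"

text \<open>
  The family \<open>D\<close> stands for what a recursive construction has produced so far; one new element of \<open>X\<close> has
  to cut all of it below \<open>x\<close>.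
\<close>

definition splits :: "'p set set \<Rightarrow> 'p set set \<Rightarrow> 'p set \<Rightarrow> 's rel \<Rightarrow> bool" where
  "splits M X x s \<longleftrightarrow>
     (\<forall>D\<subseteq>M. |D| \<le>o s \<longrightarrow> (\<exists>b\<in>X. \<forall>y\<in>D. y \<noteq> {} \<and> y \<subseteq> x \<longrightarrow> y \<inter> b \<noteq> {} \<and> y - b \<noteq> {}))"

locale chain_condition_field = field_of_sets U M + regular_uncountable k
  for U :: "'p set" and M and k :: "'k rel" +
  assumes cc: "set_chain_condition k M"
begin

lemma disjoint_less:
  assumes D: "D \<subseteq> M - {{}}" "disjoint D"
  shows "|D| <o k"
proof (rule ccontr)
  assume "\<not> |D| <o k"
  then obtain B where "B \<subseteq> D" "|B| =o k" by (rule obtain_subset)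
  moreover from this have "disjoint B" using D(2) unfolding disjoint_def by blast
  ultimately show False using cc D(1) unfolding set_chain_condition_def by blast
qed

text \<open>
  In the completion this says that a join of elements is already the join of fewer than \<open>k\<close> of them.
\<close>

lemma small_cover:
  assumes f: "f ` G \<subseteq> M"
  shows "\<exists>P\<subseteq>G. |P| <o k \<and> (\<forall>y\<in>M. (\<forall>g\<in>P. y \<inter> f g = {}) \<longrightarrow> (\<forall>g\<in>G. y \<inter> f g = {}))"
proof -
  let ?T = "{z \<in> M - {{}}. \<exists>g\<in>G. z \<subseteq> f g}"
  have "symp (disjnt :: 'p set \<Rightarrow> 'p set \<Rightarrow> bool)" by (auto simp: symp_def disjnt_def)
  from maximal_pairwise[OF this, of ?T] obtain E where E: "E \<subseteq> ?T" "pairwise disjnt E"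
    and max: "\<forall>t\<in>?T - E. \<exists>e\<in>E. \<not> disjnt t e" by blast
  have "\<forall>z\<in>E. \<exists>g. g \<in> G \<and> z \<subseteq> f g" using E(1) by blast
  from bchoice[OF this] obtain h where h: "z \<in> E \<Longrightarrow> h z \<in> G" "z \<in> E \<Longrightarrow> z \<subseteq> f (h z)" for z
    by blast
  have "|E| <o k" using E by (intro disjoint_less) (auto simp: disjoint_def pairwise_def disjnt_def)
  then have "|h ` E| <o k" by (rule image_less)
  moreover have "y \<inter> f g = {}" if y: "y \<in> M" "\<forall>g\<in>h ` E. y \<inter> f g = {}" and g: "g \<in> G" for y g
  proof (rule ccontr)
    assume ne: "y \<inter> f g \<noteq> {}"
    have "y \<inter> f g \<in> ?T" using ne y(1) g f by (auto intro: Int)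
    moreover have dis: "disjnt (y \<inter> f g) e" if "e \<in> E" for e
      using y(2) h(2)[OF that] that by (auto simp: disjnt_def)
    moreover have "y \<inter> f g \<notin> E" using dis ne by (metis disjnt_self_iff_empty)
    ultimately show False using max by blast
  qed
  ultimately show ?thesis using h(1) by (intro exI[of _ "h ` E"]) blast
qed

text \<open>
  The following notions describe the completion of the field without constructing it. For a sign \<open>s\<close> and
  a set \<open>P\<close> of elements let \<open>m\<close> be the meet, in the completion, of the complements of the literals
  \<open>lit s g\<close> with \<open>g \<in> P\<close>. The elements of the field below \<open>m\<close> are those with \<open>misses y s P\<close>, and
  \<open>forces (s, P) b\<close> says that \<open>m\<close> is disjoint from \<open>lit s b\<close>: it decides \<open>b\<close>. A set \<open>t\<close> of such
  pairs acts as a small part of the type of \<open>b\<close>, and \<open>undecided t\<close> is the region left open by it. In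
  \<open>generic X t N\<close> are the elements with the decisions in \<open>t\<close> for which small subsets of \<open>N\<close> decide
  nothing further in that region.
\<close>

definition lit :: "bool \<Rightarrow> 'p set \<Rightarrow> 'p set" where
  "lit s b = (if s then b else U - b)"

definition misses :: "'p set \<Rightarrow> bool \<Rightarrow> 'p set set \<Rightarrow> bool" where
  "misses y s P \<longleftrightarrow> (\<forall>g\<in>P. y \<inter> lit s g = {})"

definition forces :: "bool \<times> 'p set set \<Rightarrow> 'p set \<Rightarrow> bool" where
  "forces p b \<longleftrightarrow> (\<forall>y\<in>M. misses y (fst p) (snd p) \<longrightarrow> y \<inter> lit (fst p) b = {})"

definition undecided :: "(bool \<times> 'p set set) set \<Rightarrow> 'p set \<Rightarrow> bool" where
  "undecided t y \<longleftrightarrow> (\<forall>(s, P)\<in>t. \<forall>z\<in>M. misses z s P \<longrightarrow> y \<inter> z = {})"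

definition newly_decided :: "(bool \<times> 'p set set) set \<Rightarrow> 'p set set \<Rightarrow> 'p set \<Rightarrow> bool" where
  "newly_decided t N b \<longleftrightarrow>
     (\<exists>y\<in>M - {{}}. \<exists>s P. undecided t y \<and> P \<subseteq> N \<and> |P| <o k \<and> misses y s P \<and> forces (s, P) b)"

definition generic :: "'p set set \<Rightarrow> (bool \<times> 'p set set) set \<Rightarrow> 'p set set \<Rightarrow> 'p set set" where
  "generic X t N = {b \<in> X. (\<forall>p\<in>t. forces p b) \<and> \<not> newly_decided t N b}"

lemma lit_M: "b \<in> M \<Longrightarrow> lit s b \<in> M"
  by (simp add: lit_def Compl)

lemma misses_mono: "misses z s P \<Longrightarrow> y \<subseteq> z \<Longrightarrow> misses y s P"
  unfolding misses_def by blast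

text \<open>
  On the region decided by \<open>t\<close> the sets \<open>b\<close> and \<open>b'\<close> agree, both being missed there or both
  containing it.
\<close>

lemma undecided_Diff:
  assumes b: "b \<in> M" "\<forall>p\<in>t. forces p b" and b': "b' \<in> M" "\<forall>p\<in>t. forces p b'"
  shows "undecided t (b - b')"
proof -
  have "(b - b') \<inter> z = {}" if t: "(s, P) \<in> t" and z: "z \<in> M" "misses z s P" for s P z
  proof -
    let ?y = "(b - b') \<inter> z"
    have "?y \<in> M" using b(1) b'(1) z(1) by (simp add: Int Diff)
    moreover have "misses ?y s P" by (rule misses_mono[OF z(2)]) blast
    moreover have "forces (s, P) b" "forces (s, P) b'" using b(2) b'(2) t by blast+
    ultimately have "?y \<inter> lit s b = {}" "?y \<inter> lit s b' = {}" by (simp_all add: forces_def)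
    moreover have "?y \<subseteq> U" using b(1) sub by blast
    ultimately show ?thesis unfolding lit_def by (cases s) auto
  qed
  then show ?thesis unfolding undecided_def by blast
qed

text \<open>
  If a member \<open>y\<close> of \<open>D\<close> below \<open>x\<close> were not cut by a generic \<open>b\<close>, then \<open>y\<close> would miss a literal of \<open>b\<close>.
  By \<open>small_cover\<close> a small set \<open>Q y s\<close> accounts for all literals missed by \<open>y\<close>; once
  it is contained in \<open>N\<close>, it decides \<open>b\<close> on \<open>y\<close>, which genericity excludes.
\<close>

lemma splits_if_generic:
  assumes A: "k \<le>o |A|" and X: "X \<subseteq> M"
    and gen: "\<And>N. N \<subseteq> X \<Longrightarrow> |N| \<le>o |Pow_less k A| \<Longrightarrow> \<not> |generic X t N| \<le>o |Pow_less k A|"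
  shows "\<exists>x\<in>M - {{}}. splits M X x |Pow_less k A|"
proof -
  note Cin = Cinfinite_Pow_less[OF A]
  have "|{} :: 'p set set| \<le>o |Pow_less k A|" by (rule card_of_empty)
  from gen[OF _ this] have nle: "\<not> |generic X t {}| \<le>o |Pow_less k A|" by blast
  have "infinite (Pow_less k A)" using Cin by (simp add: cinfinite_def Field_card_of)
  then have "infinite (generic X t {})"
    using nle ordLess_imp_ordLeq[OF finite_ordLess_infinite2] by blast
  then have "\<not> (\<exists>b. generic X t {} \<subseteq> {b})" using finite_subset by blast
  then obtain b b' where b: "b \<in> generic X t {}" "b' \<in> generic X t {}" "b \<noteq> b'" by blast
  have "\<exists>x\<in>M - {{}}. undecided t x"
  proof (cases "b - b' = {}")
    case True
    then have "b' - b \<in> M - {{}}" "undecided t (b' - b)"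
      using b X by (auto simp: generic_def intro!: Diff undecided_Diff)
    then show ?thesis by blast
  next
    case False
    then have "b - b' \<in> M - {{}}" "undecided t (b - b')"
      using b X by (auto simp: generic_def intro!: Diff undecided_Diff)
    then show ?thesis by blast
  qed
  then obtain x where x: "x \<in> M - {{}}" "undecided t x" by blast
  have "splits M X x |Pow_less k A|"
    unfolding splits_def
  proof (intro allI impI)
    fix D assume D: "D \<subseteq> M" "|D| \<le>o |Pow_less k A|"
    define Good where "Good y s P \<longleftrightarrow> P \<subseteq> {g \<in> X. y \<inter> lit s g = {}} \<and> |P| <o k \<and>
        (\<forall>z\<in>M. (\<forall>g\<in>P. z \<inter> lit s g = {}) \<longrightarrow> (\<forall>g\<in>{g \<in> X. y \<inter> lit s g = {}}. z \<inter> lit s g = {}))"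
      for y s P
    define Q where "Q y s = (SOME P. Good y s P)" for y s
    have "lit s ` {g \<in> X. y \<inter> lit s g = {}} \<subseteq> M" for y s using X lit_M by blast
    from small_cover[OF this] have "\<exists>P. Good y s P" for y s unfolding Good_def by blast
    from someI_ex[OF this] have "Good y s (Q y s)" for y s unfolding Q_def .
    then have Q: "Q y s \<subseteq> {g \<in> X. y \<inter> lit s g = {}}" "|Q y s| <o k"
      "z \<in> M \<Longrightarrow> misses z s (Q y s) \<Longrightarrow> g \<in> X \<Longrightarrow> y \<inter> lit s g = {} \<Longrightarrow> z \<inter> lit s g = {}"
      for y s z g unfolding Good_def misses_def by blast+
    define N where "N = (\<Union>y\<in>D. Q y True \<union> Q y False)"
    have kA: "k \<le>o |Pow_less k A|" by (rule ordLeq_transitive[OF A le_Pow_less])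
    have Q_le: "|Q y s| \<le>o |Pow_less k A|" for y s
      by (rule ordLeq_transitive[OF ordLess_imp_ordLeq[OF Q(2)] kA])
    have "|N| \<le>o |Pow_less k A|"
      unfolding N_def
      by (intro UNION_Cinfinite_bound[OF D(2) _ Cin] ballI Un_Cinfinite_bound[OF _ _ Cin] Q_le)
    moreover have "N \<subseteq> X" using Q(1) unfolding N_def by blast
    ultimately have "\<not> |generic X t N| \<le>o |Pow_less k A|" by (intro gen)
    then have "generic X t N \<noteq> {}" using card_of_empty[of "Pow_less k A"] by (intro notI) simp
    then obtain b where b: "b \<in> generic X t N" by blast
    then have bX: "b \<in> X" by (simp add: generic_def)
    have "y \<inter> lit s b \<noteq> {}" if y: "y \<in> D" "y \<noteq> {}" "y \<subseteq> x" for y s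
    proof
      assume e: "y \<inter> lit s b = {}"
      have "forces (s, Q y s) b" using Q(3)[OF _ _ bX e] by (auto simp: forces_def)
      moreover have "misses y s (Q y s)" using Q(1) by (auto simp: misses_def)
      moreover have "undecided t y" using x(2) y(3) unfolding undecided_def by blast
      moreover have "Q y s \<subseteq> Q y True \<union> Q y False" by (cases s) auto
      then have "Q y s \<subseteq> N" unfolding N_def by (rule order_trans) (rule UN_upper[OF y(1)])
      moreover have "y \<in> M - {{}}" using y D(1) by blast
      ultimately have "newly_decided t N b"
        unfolding newly_decided_def by (intro bexI[of _ y] exI[of _ s] exI[of _ "Q y s"]) (simp_all add: Q(2))
      then show False using b by (simp add: generic_def)
    qed
    note ne = this
    have "y \<inter> b \<noteq> {} \<and> y - b \<noteq> {}" if y: "y \<in> D" "y \<noteq> {}" "y \<subseteq> x" for y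
      using ne[OF y, of True] ne[OF y, of False] by (auto simp: lit_def)
    then show "\<exists>b\<in>X. \<forall>y\<in>D. y \<noteq> {} \<and> y \<subseteq> x \<longrightarrow> y \<inter> b \<noteq> {} \<and> y - b \<noteq> {}" using bX by blast
  qed
  then show ?thesis using x(1) by blast
qed

text \<open>
  Otherwise close a small set \<open>N'\<close> off under \<open>t \<mapsto> N t \<union> generic X t (N t)\<close>. An element \<open>b\<close> of \<open>X\<close> outside \<open>N'\<close>
  is never generic, so any fewer than \<open>k\<close> decisions over \<open>N'\<close> about it leave a nonempty set on which it can be
  decided anew. A maximal disjoint family of sets on which \<open>b\<close> is decided over \<open>N'\<close> has fewer
  than \<open>k\<close> members, and its decisions provide the contradiction.
\<close>

lemma generic_exists:
  assumes A: "k \<le>o |A|" and X: "X \<subseteq> M" and large: "\<not> |X| \<le>o |Pow_less k A|"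
  shows "\<exists>t. \<forall>N\<subseteq>X. |N| \<le>o |Pow_less k A| \<longrightarrow> \<not> |generic X t N| \<le>o |Pow_less k A|"
proof (rule ccontr)
  assume "\<not> ?thesis"
  then have ex: "\<exists>N. N \<subseteq> X \<and> |N| \<le>o |Pow_less k A| \<and> |generic X t N| \<le>o |Pow_less k A|" for t
    by blast
  define N where "N t = (SOME N. N \<subseteq> X \<and> |N| \<le>o |Pow_less k A| \<and> |generic X t N| \<le>o |Pow_less k A| )"
    for t
  have N: "|N t| \<le>o |Pow_less k A|" "|generic X t (N t)| \<le>o |Pow_less k A|" for t
    using someI_ex[OF ex[of t], folded N_def] by simp_all
  note Cin = Cinfinite_Pow_less[OF A]
  define F where
    "F C = (\<Union>t\<in>Pow_less k ((UNIV :: bool set) \<times> Pow_less k C). N t \<union> generic X t (N t))" for C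
  have "|F C| \<le>o |Pow_less k A|" if C: "|C| <o k" for C
  proof -
    have "|C| \<le>o |Pow_less k A|"
      by (rule ordLeq_transitive[OF ordLess_imp_ordLeq[OF C] ordLeq_transitive[OF A le_Pow_less]])
    then have 1: "|Pow_less k C| \<le>o |Pow_less k A|" by (rule Pow_less_bound[OF A])
    have inf: "infinite (Pow_less k A)" using Cin by (simp add: cinfinite_def Field_card_of)
    have "|UNIV :: bool set| \<le>o |Pow_less k A|"
      using ordLess_imp_ordLeq[OF finite_ordLess_infinite2[OF finite_UNIV inf]] .
    then have "|(UNIV :: bool set) \<times> Pow_less k C| \<le>o |Pow_less k A|"
      using 1 inf by (intro card_of_Times_ordLeq_infinite_Field) (simp_all add: Field_card_of card_of_Card_order)
    from Pow_less_bound[OF A this] show ?thesis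
      unfolding F_def by (intro UNION_Cinfinite_bound[OF _ _ Cin] ballI Un_Cinfinite_bound[OF _ _ Cin] N)
  qed
  note F_le = this
  from closed_set_exists[of A F, OF A F_le] obtain N' where N': "|N'| \<le>o |Pow_less k A|"
    and closed: "\<And>C. C \<subseteq> N' \<Longrightarrow> |C| <o k \<Longrightarrow> F C \<subseteq> N'" by blast
  have "\<not> X \<subseteq> N'" using large ordLeq_transitive[OF card_of_mono1 N', of X] by blast
  then obtain b where b: "b \<in> X" "b \<notin> N'" by blast
  let ?T = "{(y, s, P). y \<in> M - {{}} \<and> P \<subseteq> N' \<and> |P| <o k \<and> misses y s P \<and> forces (s, P) b}"
  let ?R = "\<lambda>u v :: 'p set \<times> bool \<times> 'p set set. disjnt (fst u) (fst v)"
  have "symp ?R" by (auto simp: symp_def disjnt_def)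
  from maximal_pairwise[OF this, of ?T] obtain E where E: "E \<subseteq> ?T" "pairwise ?R E"
    and max: "\<forall>u\<in>?T - E. \<exists>e\<in>E. \<not> ?R u e" by blast
  have "inj_on fst E"
    unfolding inj_on_def
  proof (intro ballI impI, rule ccontr)
    fix u v assume "u \<in> E" "v \<in> E" "fst u = fst v" "u \<noteq> v"
    moreover from this have "fst u \<noteq> {}" using E(1) by auto
    ultimately show False using E(2) by (auto simp: pairwise_def disjnt_def)
  qed
  then have "|E| =o |fst ` E|" by (rule card_of_ordIsoI[OF inj_on_imp_bij_betw])
  moreover have "|fst ` E| <o k"
  proof (rule disjoint_less)
    show "fst ` E \<subseteq> M - {{}}" using E(1) by auto
    show "disjoint (fst ` E)"
    proof (rule disjointI)
      fix a c assume "a \<in> fst ` E" "c \<in> fst ` E" "a \<noteq> c"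
      then obtain u v where "u \<in> E" "v \<in> E" "a = fst u" "c = fst v" "u \<noteq> v" by blast
      then show "a \<inter> c = {}" using pairwiseD[OF E(2), of u v] by (simp add: disjnt_def)
    qed
  qed
  ultimately have Ek: "|E| <o k" by (rule ordIso_ordLess_trans)
  define t where "t = snd ` E"
  define C where "C = (\<Union>e\<in>E. snd (snd e))"
  have "|C| <o k" unfolding C_def using E(1) by (intro UNION_less[OF Ek]) auto
  moreover have "snd (snd e) \<subseteq> N'" if "e \<in> E" for e using subsetD[OF E(1) that] by auto
  then have "C \<subseteq> N'" unfolding C_def by blast
  ultimately have FC: "F C \<subseteq> N'" by (rule closed[rotated])
  have "|t| <o k" unfolding t_def by (rule image_less[OF Ek])
  moreover have "t \<subseteq> UNIV \<times> Pow_less k C"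
    using E(1) unfolding t_def C_def Pow_less_def by force
  ultimately have "t \<in> Pow_less k (UNIV \<times> Pow_less k C)" by (simp add: Pow_less_def)
  then have "N t \<union> generic X t (N t) \<subseteq> F C" unfolding F_def by blast
  then have sub: "N t \<subseteq> N'" "b \<notin> generic X t (N t)" using FC b(2) by blast+
  have "\<forall>p\<in>t. forces p b" using E(1) unfolding t_def by auto
  then have "newly_decided t (N t) b" using sub(2) b(1) by (simp add: generic_def)
  then obtain y s P where y: "y \<in> M - {{}}" "undecided t y" "P \<subseteq> N t" "|P| <o k"
    "misses y s P" "forces (s, P) b"
    unfolding newly_decided_def by blast
  have T: "(y, s, P) \<in> ?T" using y sub(1) by auto
  moreover have R: "?R (y, s, P) e" if e: "e \<in> E" for e
  proof -
    obtain z s' P' where e': "e = (z, s', P')" by (cases e)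
    have "z \<in> M" "misses z s' P'" using e E(1) by (auto simp: e')
    moreover have "(s', P') \<in> t" using imageI[OF e, of snd] by (simp add: t_def e')
    ultimately have "y \<inter> z = {}" using bspec[OF y(2)[unfolded undecided_def], of "(s', P')"] by simp
    then show ?thesis by (simp add: disjnt_def e')
  qed
  moreover have "(y, s, P) \<notin> E" using R[of "(y, s, P)"] y(1) by (auto simp: disjnt_def)
  ultimately show False using max by blast
qed

text \<open>
  For \<open>\<tau> = |[A]^{<k}|\<close> a recursion below \<open>x\<close> whose length is the successor of \<open>\<tau>\<close> would turn this into an
  independent subset of \<open>X\<close> of that length, the classical theorem on free calibers. That \<open>x\<close> is found before
  the families \<open>D\<close> are given is what allows to combine such regions for different cardinals \<open>\<tau>\<close>.
\<close>

theorem splitting_element: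
  assumes "k \<le>o |A|" "X \<subseteq> M" "|Pow_less k A| <o |X|"
  shows "\<exists>x\<in>M - {{}}. splits M X x |Pow_less k A|"
proof -
  have "\<not> |X| \<le>o |Pow_less k A|" using assms(3) not_ordLess_ordLeq by blast
  from generic_exists[OF assms(1,2) this] obtain t where
    "\<forall>N\<subseteq>X. |N| \<le>o |Pow_less k A| \<longrightarrow> \<not> |generic X t N| \<le>o |Pow_less k A|" ..
  then show ?thesis using splits_if_generic[OF assms(1,2)] by blast
qed

end

section \<open>Independent families\<close>

definition set_independent :: "'p set \<Rightarrow> 'p set set \<Rightarrow> bool" where
  "set_independent U Y \<longleftrightarrow>
     (\<forall>u v. finite u \<and> finite v \<and> u \<subseteq> Y \<and> v \<subseteq> Y \<and> u \<inter> v = {} \<longrightarrow> U \<inter> \<Inter>u - \<Union>v \<noteq> {})"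

definition cell :: "'p set \<Rightarrow> ('z \<Rightarrow> 'p set) \<Rightarrow> ('l \<Rightarrow> 'p set) \<Rightarrow> 'z set \<Rightarrow> 'l set \<Rightarrow> 'l set \<Rightarrow> 'p set" where
  "cell U v f u p n = U \<inter> \<Inter>(v ` u) \<inter> \<Inter>(f ` p) - \<Union>(f ` n)"

text \<open>
  The recursion chooses, at step \<open>i\<close>, an element that cuts every nonempty combination of the \<open>v z\<close> and of
  earlier elements below one of the \<open>v z\<close>. All of the \<open>v z\<close> take part from the beginning: to see that a
  combination is nonempty, its largest index \<open>i\<close> is removed and the \<open>v z\<close> chosen for \<open>i\<close> is added.
\<close>

lemma (in field_of_sets) independent_family:
  fixes l :: "'l rel" and v :: "'z \<Rightarrow> 'p set"
  assumes l: "Cinfinite l" and X: "X \<subseteq> M" and v: "v ` Z \<subseteq> M"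
    and centred: "\<And>u. finite u \<Longrightarrow> u \<subseteq> Z \<Longrightarrow> U \<inter> \<Inter>(v ` u) \<noteq> {}"
    and split: "\<And>i. i \<in> Field l \<Longrightarrow> \<exists>z\<in>Z. splits M X (v z) |underS l i <+> Z <+> (UNIV :: nat set)|"
  shows "\<exists>Y\<subseteq>X. set_independent U Y \<and> |Y| =o l"
proof -
  have C: "Card_order l" using l by blast
  have wf: "wf (l - Id)" by (rule Card_order_linear(5)[OF C])
  define cells where "cells f i = {cell U v f u p n | u p n. finite u \<and> u \<subseteq> Z \<and>
      finite p \<and> p \<subseteq> underS l i \<and> finite n \<and> n \<subseteq> underS l i}" for f i
  define P where "P f i b \<longleftrightarrow> (i \<in> Field l \<longrightarrow> b \<in> X \<and>
      (\<exists>z\<in>Z. \<forall>y\<in>cells f i. y \<noteq> {} \<and> y \<subseteq> v z \<longrightarrow> y \<inter> b \<noteq> {} \<and> y - b \<noteq> {}))" for f i b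
  have cells_cong: "cells f i = cells g i" if "\<And>j. (j, i) \<in> l - Id \<Longrightarrow> f j = g j" for f g i
  proof -
    have "f ` p = g ` p" if p: "p \<subseteq> underS l i" for p
    proof (rule image_cong[OF refl])
      fix j assume "j \<in> p"
      then have "(j, i) \<in> l - Id" using p by (auto simp: underS_def)
      then show "f j = g j" using \<open>\<And>j. (j, i) \<in> l - Id \<Longrightarrow> f j = g j\<close> by blast
    qed
    then have "cell U v f u p n = cell U v g u p n" if "p \<subseteq> underS l i" "n \<subseteq> underS l i" for u p n
      using that by (simp add: cell_def)
    then show ?thesis unfolding cells_def by (intro Collect_cong) metis
  qed
  have card_cells: "|cells f i| \<le>o |underS l i <+> Z <+> (UNIV :: nat set)|" for f i
  proof -
    let ?I = "underS l i <+> Z <+> (UNIV :: nat set)"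
    have inf: "infinite ?I" by simp
    let ?g = "\<lambda>(a, b). cell U v f {z. Inr (Inl z) \<in> a} {j. Inl j \<in> a} {j. Inl j \<in> b}"
    have "cells f i \<subseteq> ?g ` (Fpow ?I \<times> Fpow ?I)"
    proof
      fix y assume "y \<in> cells f i"
      then obtain u p n where y: "y = cell U v f u p n" "finite u" "u \<subseteq> Z"
        "finite p" "p \<subseteq> underS l i" "finite n" "n \<subseteq> underS l i" unfolding cells_def by blast
      let ?a = "Inl ` p \<union> Inr ` Inl ` u :: ('l + 'z + nat) set" and ?b = "Inl ` n :: ('l + 'z + nat) set"
      have "{z. Inr (Inl z) \<in> ?a} = u" "{j. Inl j \<in> ?a} = p" "{j. Inl j \<in> ?b} = n" by auto
      then have "?g (?a, ?b) = y" by (simp only: y(1) prod.case)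
      moreover have "?a \<subseteq> ?I" "?b \<subseteq> ?I" "finite ?a" "finite ?b" using y(2-) by auto
      then have "(?a, ?b) \<in> Fpow ?I \<times> Fpow ?I" by (simp only: Fpow_def mem_Sigma_iff mem_Collect_eq simp_thms)
      ultimately show "y \<in> ?g ` (Fpow ?I \<times> Fpow ?I)" by (rule image_eqI[OF sym])
    qed
    then have "|cells f i| \<le>o |Fpow ?I \<times> Fpow ?I|" by (rule surj_imp_ordLeq)
    also have "|Fpow ?I \<times> Fpow ?I| \<le>o |?I|"
      using card_of_Fpow_infinite[OF inf] inf
      by (intro card_of_Times_ordLeq_infinite_Field)
        (simp_all only: Field_card_of card_of_card_order_on ordIso_imp_ordLeq not_False_eq_True)
    finally show ?thesis .
  qed
  have cell_M: "cell U v f u p n \<in> M"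
    if "finite u" "u \<subseteq> Z" "finite p" "f ` p \<subseteq> M" "finite n" "f ` n \<subseteq> M" for f u p and n :: "'l set"
  proof -
    have "v ` u \<subseteq> M" using that(2) v by blast
    then have "U \<inter> \<Inter>(v ` u) \<in> M" "U \<inter> \<Inter>(f ` p) \<in> M" "\<Union>(f ` n) \<in> M"
      using that by (simp_all add: finite_Inter finite_Union)
    then have "(U \<inter> \<Inter>(v ` u)) \<inter> (U \<inter> \<Inter>(f ` p)) - \<Union>(f ` n) \<in> M" by (rule Diff[OF Int])
    moreover have "(U \<inter> \<Inter>(v ` u)) \<inter> (U \<inter> \<Inter>(f ` p)) - \<Union>(f ` n) = cell U v f u p n"
      by (auto simp: cell_def)
    ultimately show ?thesis by simp
  qed
  have "\<exists>f. \<forall>i. P f i (f i)"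
  proof (rule dependent_wf_choice[OF wf])
    fix f g :: "'l \<Rightarrow> 'p set" and i b assume "\<And>j. (j, i) \<in> l - Id \<Longrightarrow> f j = g j"
    then have "cells f i = cells g i" by (rule cells_cong)
    then show "P f i b = P g i b" by (simp add: P_def)
  next
    fix i f assume IH: "\<And>j. (j, i) \<in> l - Id \<Longrightarrow> P f j (f j)"
    show "\<exists>b. P f i b"
    proof (cases "i \<in> Field l")
      case True
      obtain z where z: "z \<in> Z" "splits M X (v z) |underS l i <+> Z <+> (UNIV :: nat set)|"
        using split[OF True] by blast
      have "f j \<in> M" if "j \<in> underS l i" for j
        using IH[of j] that X by (auto simp: underS_def P_def Field_def)
      then have "cells f i \<subseteq> M" unfolding cells_def by (auto intro!: cell_M)
      with z(2) card_cells obtain b where "b \<in> X"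
        "\<forall>y\<in>cells f i. y \<noteq> {} \<and> y \<subseteq> v z \<longrightarrow> y \<inter> b \<noteq> {} \<and> y - b \<noteq> {}"
        unfolding splits_def by meson
      then show ?thesis using z(1) unfolding P_def by blast
    qed (simp add: P_def)
  qed
  then obtain f where f: "\<And>i. P f i (f i)" by blast
  have fX: "f i \<in> X" if "i \<in> Field l" for i using f[of i] that by (simp add: P_def)
  have ne: "cell U v f u p n \<noteq> {}"
    if "finite q" "q = p \<union> n" "p \<inter> n = {}" "q \<subseteq> Field l" "finite u" "u \<subseteq> Z" for q u p n
    using that
  proof (induction "card q" arbitrary: q u p n rule: less_induct)
    case less
    show ?case
    proof (cases "q = {}")
      case True
      then show ?thesis using centred[of u] less.prems by (simp add: cell_def)
    next
      case False
      obtain i where i: "i \<in> q" "\<And>j. j \<in> q \<Longrightarrow> (j, i) \<in> l"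
      proof -
        from less.prems(1) False less.prems(4) have "\<exists>i\<in>q. \<forall>j\<in>q. (j, i) \<in> l"
        proof (induction rule: finite_ne_induct)
          case (singleton x)
          then show ?case using Card_order_linear(3)[OF C] by simp
        next
          case (insert x F)
          then obtain i where i: "i \<in> F" "\<forall>j\<in>F. (j, i) \<in> l" by auto
          have "(x, i) \<in> l \<or> (i, x) \<in> l" "(x, x) \<in> l"
            using Card_order_linear(3,4)[OF C] insert.prems i(1) by auto
          then show ?case using i Card_order_linear(1)[OF C] by (auto dest: transD)
        qed
        then show ?thesis using that by blast
      qed
      have iF: "i \<in> Field l" using i(1) less.prems by blast
      then have "\<exists>z\<in>Z. \<forall>y\<in>cells f i. y \<noteq> {} \<and> y \<subseteq> v z \<longrightarrow> y \<inter> f i \<noteq> {} \<and> y - f i \<noteq> {}"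
        using f[of i] by (simp add: P_def)
      then obtain z where z: "z \<in> Z"
        "\<forall>y\<in>cells f i. y \<noteq> {} \<and> y \<subseteq> v z \<longrightarrow> y \<inter> f i \<noteq> {} \<and> y - f i \<noteq> {}" ..
      let ?y = "cell U v f (insert z u) (p - {i}) (n - {i})"
      have "card (q - {i}) < card q" using less.prems(1) i(1) by (rule card_Diff1_less)
      then have "?y \<noteq> {}"
        using less.prems z(1) by (intro less.hyps[of "q - {i}"]) auto
      moreover have "q - {i} \<subseteq> underS l i" using i(2) by (auto simp: underS_def)
      then have "?y \<in> cells f i"
        using less.prems z(1) unfolding cells_def
        by (intro CollectI exI[of _ "insert z u"] exI[of _ "p - {i}"] exI[of _ "n - {i}"]) auto
      moreover have "?y \<subseteq> v z" by (auto simp: cell_def)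
      ultimately have "?y \<inter> f i \<noteq> {}" "?y - f i \<noteq> {}" using bspec[OF z(2), of ?y] by simp_all
      moreover have "?y \<inter> f i \<subseteq> cell U v f u p n" if "i \<in> p"
        using that less.prems(3) by (auto simp: cell_def)
      moreover have "?y - f i \<subseteq> cell U v f u p n" if "i \<in> n"
        using that less.prems(3) by (auto simp: cell_def)
      ultimately show ?thesis using i(1) less.prems(2) by blast
    qed
  qed
  have inj: "inj_on f (Field l)"
  proof (rule inj_onI, rule ccontr)
    fix i j assume "i \<in> Field l" "j \<in> Field l" "f i = f j" "i \<noteq> j"
    then show False using ne[of "{i, j}" "{i}" "{j}" "{}"] by (auto simp: cell_def)
  qed
  have "set_independent U (f ` Field l)"
    unfolding set_independent_def
  proof (intro allI impI, elim conjE)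
    fix a b assume ab: "finite a" "finite b" "a \<subseteq> f ` Field l" "b \<subseteq> f ` Field l" "a \<inter> b = {}"
    obtain p n where pn: "p \<subseteq> Field l" "finite p" "a = f ` p" "n \<subseteq> Field l" "finite n" "b = f ` n"
      using finite_subset_image[OF ab(1,3)] finite_subset_image[OF ab(2,4)] by blast
    have "p \<inter> n = {}" using pn ab(5) by blast
    then show "U \<inter> \<Inter>a - \<Union>b \<noteq> {}"
      using ne[of "p \<union> n" p n "{}"] pn by (simp add: cell_def)
  qed
  moreover have "|f ` Field l| =o l"
    using card_of_ordIsoI[OF inj_on_imp_bij_betw[OF inj]] card_of_Field_ordIso[OF C]
    by (rule ordIso_transitive[OF ordIso_symmetric])
  ultimately show ?thesis using fX by blast
qed

text \<open>
  The cutting elements for \<open>x\<close> and for \<open>y\<close> are glued along \<open>x\<close>. The result is a new element, hence the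
  choice from all of \<open>M\<close>.
\<close>

lemma (in field_of_sets) splits_Un:
  assumes s: "Cinfinite s" and x: "x \<in> M" "splits M M x s" and y: "y \<in> M" "splits M M y s"
  shows "splits M M (x \<union> y) s"
  unfolding splits_def
proof (intro allI impI)
  fix D assume D: "D \<subseteq> M" "|D| \<le>o s"
  have le: "|(\<lambda>z. g z) ` D| \<le>o s" for g :: "'p set \<Rightarrow> 'p set"
    by (rule ordLeq_transitive[OF card_of_image D(2)])
  have "(\<lambda>z. z \<inter> x) ` D \<subseteq> M" "(\<lambda>z. z - x) ` D \<subseteq> M" using D(1) x(1) by (auto intro: Int Diff)
  then obtain b c where b: "b \<in> M" "\<forall>z\<in>(\<lambda>z. z \<inter> x) ` D. z \<noteq> {} \<and> z \<subseteq> x \<longrightarrow> z \<inter> b \<noteq> {} \<and> z - b \<noteq> {}"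
    and c: "c \<in> M" "\<forall>z\<in>(\<lambda>z. z - x) ` D. z \<noteq> {} \<and> z \<subseteq> y \<longrightarrow> z \<inter> c \<noteq> {} \<and> z - c \<noteq> {}"
    using x(2) y(2) le unfolding splits_def by meson
  let ?d = "(b \<inter> x) \<union> (c - x)"
  have "z \<inter> ?d \<noteq> {} \<and> z - ?d \<noteq> {}" if z: "z \<in> D" "z \<noteq> {}" "z \<subseteq> x \<union> y" for z
  proof (cases "z \<inter> x = {}")
    case True
    then have "z - x = z" "z \<subseteq> y" using z(3) by auto
    moreover from this have "z \<in> (\<lambda>z. z - x) ` D" using z(1) by (simp add: image_iff) metis
    ultimately have "z \<inter> c \<noteq> {} \<and> z - c \<noteq> {}" using bspec[OF c(2), of z] z(2) by blast
    then show ?thesis using True by blast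
  next
    case False
    then have "z \<inter> x \<inter> b \<noteq> {} \<and> z \<inter> x - b \<noteq> {}" using b(2)[rule_format, OF imageI[OF z(1)]] by simp
    then show ?thesis by blast
  qed
  moreover have "?d \<in> M" using b(1) c(1) x(1) by (intro Un Int Diff)
  ultimately show "\<exists>b\<in>M. \<forall>z\<in>D. z \<noteq> {} \<and> z \<subseteq> x \<union> y \<longrightarrow> z \<inter> b \<noteq> {} \<and> z - b \<noteq> {}" by blast
qed

lemma (in field_of_sets) splits_finite_Union:
  assumes s: "Cinfinite s" and "finite A" "A \<subseteq> M" "\<And>x. x \<in> A \<Longrightarrow> splits M M x s"
  shows "splits M M (\<Union>A) s"
  using assms(2-)
proof (induction A rule: finite_induct)
  case empty
  then show ?case using top by (auto simp: splits_def)
next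
  case (insert x A)
  then show ?case using splits_Un[OF s, of x "\<Union>A"] finite_Union by simp
qed

lemma splits_mono: "splits M X x s \<Longrightarrow> s' \<le>o s \<Longrightarrow> splits M X x s'"
  unfolding splits_def by (meson ordLeq_transitive)

section \<open>The algebra of a simplicial complex\<close>

text \<open>
  The last clause is the chain condition for the faces under reverse inclusion, two faces being compatible
  when their union is a face.
\<close>

definition kcc_complex :: "'k rel \<Rightarrow> 't set \<Rightarrow> 't set set \<Rightarrow> bool" where
  "kcc_complex k V S \<longleftrightarrow> S \<subseteq> Fpow V \<and> (\<forall>P\<in>S. \<forall>Q\<subseteq>P. Q \<in> S) \<and> (\<forall>z\<in>V. {z} \<in> S) \<and>
     \<not> (\<exists>E\<subseteq>S. |E| =o k \<and> (\<forall>P\<in>E. \<forall>Q\<in>E. P \<noteq> Q \<longrightarrow> P \<union> Q \<notin> S))"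

text \<open>
  The blow-up of a complex in which each vertex is replaced by its fibre under \<open>pi\<close>.
\<close>

definition lifted :: "'j set \<Rightarrow> ('j \<Rightarrow> 't) \<Rightarrow> 't set set \<Rightarrow> 'j set set" where
  "lifted J pi S = {P \<in> Fpow J. pi ` P \<in> S}"

text \<open>
  For a complex \<open>T\<close> this is the field of sets generated by the sets of faces that contain a given vertex. The
  definition by finite supports makes the closure properties and the count immediate.
\<close>

definition supported :: "'j set set \<Rightarrow> 'j set set set" where
  "supported T = {y. y \<subseteq> T \<and> (\<exists>F. finite F \<and> (\<forall>P\<in>T. P \<in> y \<longleftrightarrow> P \<inter> F \<in> y))}"

lemma field_of_sets_supported:
  assumes down: "\<And>P Q. P \<in> T \<Longrightarrow> Q \<subseteq> P \<Longrightarrow> Q \<in> T"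
  shows "field_of_sets T (supported T)"
proof
  show "supported T \<subseteq> Pow T" by (auto simp: supported_def)
  show "T \<in> supported T" using down by (auto simp: supported_def)
next
  fix x assume "x \<in> supported T"
  then obtain F where F: "finite F" "\<forall>P\<in>T. P \<in> x \<longleftrightarrow> P \<inter> F \<in> x" by (auto simp: supported_def)
  have "\<forall>P\<in>T. P \<in> T - x \<longleftrightarrow> P \<inter> F \<in> T - x" using F(2) down by blast
  then show "T - x \<in> supported T" using F(1) by (auto simp: supported_def)
next
  fix x y assume "x \<in> supported T" "y \<in> supported T"
  then obtain F G where F: "x \<subseteq> T" "finite F" "\<And>P. P \<in> T \<Longrightarrow> P \<in> x \<longleftrightarrow> P \<inter> F \<in> x"
    and G: "finite G" "\<And>P. P \<in> T \<Longrightarrow> P \<in> y \<longleftrightarrow> P \<inter> G \<in> y" by (auto simp: supported_def)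
  have "P \<in> x \<inter> y \<longleftrightarrow> P \<inter> (F \<union> G) \<in> x \<inter> y" if "P \<in> T" for P
  proof -
    have "P \<inter> (F \<union> G) \<in> T" using down[OF that] by blast
    moreover have "P \<inter> (F \<union> G) \<inter> F = P \<inter> F" "P \<inter> (F \<union> G) \<inter> G = P \<inter> G" by auto
    ultimately show ?thesis
      using F(3)[OF that] G(2)[OF that] F(3)[of "P \<inter> (F \<union> G)"] G(2)[of "P \<inter> (F \<union> G)"] by simp
  qed
  then show "x \<inter> y \<in> supported T"
    using F(1,2) G(1) unfolding supported_def by (intro CollectI conjI exI[of _ "F \<union> G"]) auto
qed

lemma card_supported:
  assumes J: "infinite J" and T: "T \<subseteq> Fpow J"
  shows "|supported T| \<le>o |J|"
proof -
  let ?g = "\<lambda>(F, Y). {P \<in> T. P \<inter> F \<in> Y}"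
  have "supported T \<subseteq> ?g ` (Fpow J \<times> Fpow (Fpow J))"
  proof
    fix y assume "y \<in> supported T"
    then obtain F where F: "y \<subseteq> T" "finite F" "\<forall>P\<in>T. P \<in> y \<longleftrightarrow> P \<inter> F \<in> y"
      by (auto simp: supported_def)
    let ?F = "F \<inter> J" and ?Y = "y \<inter> Pow (F \<inter> J)"
    have "P \<inter> F = P \<inter> ?F" if "P \<in> T" for P using T that by (auto simp: Fpow_def)
    then have "y = {P \<in> T. P \<inter> ?F \<in> ?Y}" using F(1,3) by auto
    moreover have "(?F, ?Y) \<in> Fpow J \<times> Fpow (Fpow J)"
      using F(2) finite_subset[of _ F] by (auto simp: Fpow_def)
    ultimately show "y \<in> ?g ` (Fpow J \<times> Fpow (Fpow J))" by (intro image_eqI[of _ _ "(?F, ?Y)"]) simp_all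
  qed
  then have "|supported T| \<le>o |Fpow J \<times> Fpow (Fpow J)|" by (rule surj_imp_ordLeq)
  also have "|Fpow J \<times> Fpow (Fpow J)| \<le>o |J|"
  proof -
    have 1: "|Fpow J| =o |J|" by (rule card_of_Fpow_infinite[OF J])
    have "infinite (Fpow J)" using J 1 card_of_ordIso_finite by blast
    from ordIso_transitive[OF card_of_Fpow_infinite[OF this] 1] have 2: "|Fpow (Fpow J)| =o |J|" .
    show ?thesis
      using J ordIso_imp_ordLeq[OF 1] ordIso_imp_ordLeq[OF 2]
      by (intro card_of_Times_ordLeq_infinite_Field) (simp_all only: Field_card_of card_of_card_order_on not_False_eq_True)
  qed
  finally show ?thesis .
qed

lemma lifted_down:
  assumes S: "kcc_complex k V S" and PQ: "P \<in> lifted J pi S" "Q \<subseteq> P"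
  shows "Q \<in> lifted J pi S"
proof -
  have "pi ` P \<in> S" "pi ` Q \<subseteq> pi ` P" using PQ by (auto simp: lifted_def)
  then have "pi ` Q \<in> S" using S unfolding kcc_complex_def by blast
  then show ?thesis using PQ finite_subset by (auto simp: lifted_def Fpow_def)
qed

context regular_uncountable
begin

lemma Un_less: "|A| <o k \<Longrightarrow> |B| <o k \<Longrightarrow> |A \<union> B| <o k"
  by (rule Un_Cinfinite_bound_strict[OF _ _ Cinf])

lemma nonempty_if_not_less: "\<not> |A| <o k \<Longrightarrow> A \<noteq> {}"
  using finite_less[OF finite.emptyI] by auto

text \<open>
  This is the part of the Delta-system lemma that is needed. A vertex that occurs too often is deleted, which
  lowers the sizes; if there is none, then a maximal subfamily with disjoint supports is already large, since
  otherwise its members would meet too few of the sets.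
\<close>

lemma thin_family_aux:
  assumes "\<not> |D| <o k" "\<And>d. d \<in> D \<Longrightarrow> finite (u d) \<and> finite (v d) \<and> u d \<inter> v d = {} \<and> card (u d) + card (v d) = n"
  shows "\<exists>E\<subseteq>D. \<not> |E| <o k \<and> (\<forall>d\<in>E. \<forall>e\<in>E. u d \<inter> v e = {})"
  using assms
proof (induction n arbitrary: D u v rule: less_induct)
  case (less n)
  let ?s = "\<lambda>d. u d \<union> v d"
  show ?case
  proof (cases "\<exists>j. \<not> |{d \<in> D. j \<in> ?s d}| <o k")
    case True
    then obtain j where j: "\<not> |{d \<in> D. j \<in> ?s d}| <o k" by blast
    let ?A = "{d \<in> D. j \<in> u d}" and ?B = "{d \<in> D. j \<in> v d}"
    have "{d \<in> D. j \<in> ?s d} = ?A \<union> ?B" by auto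
    then have "\<not> |?A \<union> ?B| <o k" using j by simp
    then consider "\<not> |?A| <o k" | "\<not> |?B| <o k" using Un_less[of ?A ?B] by argo
    then show ?thesis
    proof cases
      case 1
      have uv: "finite (u d - {j}) \<and> finite (v d) \<and> (u d - {j}) \<inter> v d = {} \<and>
          card (u d - {j}) + card (v d) = n - 1 \<and> n - 1 < n" if d: "d \<in> ?A" for d
      proof -
        have d': "finite (u d)" "finite (v d)" "u d \<inter> v d = {}" "card (u d) + card (v d) = n" "j \<in> u d"
          using d less.prems(2)[of d] by auto
        moreover from this have "card (u d) > 0" by (auto simp: card_gt_0_iff)
        ultimately show ?thesis by (auto simp: card_Diff_singleton)
      qed
      have "n - 1 < n" using uv nonempty_if_not_less[OF 1] by blast
      from less.IH[of "n - 1" ?A "\<lambda>d. u d - {j}" v, OF this 1] uv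
      obtain E where E: "E \<subseteq> ?A" "\<not> |E| <o k" "\<forall>d\<in>E. \<forall>e\<in>E. (u d - {j}) \<inter> v e = {}" by auto
      have "j \<notin> v e" if "e \<in> E" for e using that E(1) less.prems(2)[of e] by auto
      then have "\<forall>d\<in>E. \<forall>e\<in>E. u d \<inter> v e = {}" using E(3) by fast
      then show ?thesis using E(1,2) by (intro exI[of _ E]) auto
    next
      case 2
      have uv: "finite (u d) \<and> finite (v d - {j}) \<and> u d \<inter> (v d - {j}) = {} \<and>
          card (u d) + card (v d - {j}) = n - 1 \<and> n - 1 < n" if d: "d \<in> ?B" for d
      proof -
        have d': "finite (u d)" "finite (v d)" "u d \<inter> v d = {}" "card (u d) + card (v d) = n" "j \<in> v d"
          using d less.prems(2)[of d] by auto
        moreover from this have "card (v d) > 0" by (auto simp: card_gt_0_iff)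
        ultimately show ?thesis by (auto simp: card_Diff_singleton)
      qed
      have "n - 1 < n" using uv nonempty_if_not_less[OF 2] by blast
      from less.IH[of "n - 1" ?B u "\<lambda>d. v d - {j}", OF this 2] uv
      obtain E where E: "E \<subseteq> ?B" "\<not> |E| <o k" "\<forall>d\<in>E. \<forall>e\<in>E. u d \<inter> (v e - {j}) = {}" by auto
      have "j \<notin> u d" if "d \<in> E" for d using that E(1) less.prems(2)[of d] by auto
      then have "\<forall>d\<in>E. \<forall>e\<in>E. u d \<inter> v e = {}" using E(3) by fast
      then show ?thesis using E(1,2) by (intro exI[of _ E]) auto
    qed
  next
    case False
    let ?R = "\<lambda>d e. disjnt (?s d) (?s e)"
    have "symp ?R" by (auto simp: symp_def disjnt_def)
    from maximal_pairwise[OF this, of D] obtain E where E: "E \<subseteq> D" "pairwise ?R E"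
      and max: "\<forall>d\<in>D - E. \<exists>e\<in>E. \<not> ?R d e" by blast
    have "\<not> |E| <o k"
    proof
      assume Ek: "|E| <o k"
      have "|\<Union>e\<in>E. ?s e| <o k"
        using less.prems(2) E(1) by (intro UNION_less[OF Ek] finite_less finite_UnI) auto
      then have "|\<Union>j\<in>(\<Union>e\<in>E. ?s e). {d \<in> D. j \<in> ?s d}| <o k"
        by (rule UNION_less) (use False in simp)
      then have "|E \<union> (\<Union>j\<in>(\<Union>e\<in>E. ?s e). {d \<in> D. j \<in> ?s d})| <o k" by (rule Un_less[OF Ek])
      moreover have "D \<subseteq> E \<union> (\<Union>j\<in>(\<Union>e\<in>E. ?s e). {d \<in> D. j \<in> ?s d})"
      proof
        fix d assume d: "d \<in> D"
        show "d \<in> E \<union> (\<Union>j\<in>(\<Union>e\<in>E. ?s e). {d \<in> D. j \<in> ?s d})"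
        proof (cases "d \<in> E")
          case False
          then obtain e j where "e \<in> E" "j \<in> ?s d" "j \<in> ?s e" using max d unfolding disjnt_def by blast
          then show ?thesis using d by blast
        qed simp
      qed
      ultimately have "|D| <o k" by (rule mono_less)
      then show False using less.prems(1) by contradiction
    qed
    moreover have "u d \<inter> v e = {}" if "d \<in> E" "e \<in> E" for d e
    proof (cases "d = e")
      case True then show ?thesis using less.prems(2)[of e] E(1) that by auto
    next
      case False
      from pairwiseD[OF E(2) that False] show ?thesis unfolding disjnt_def by blast
    qed
    ultimately show ?thesis using E(1) by (intro exI[of _ E]) simp
  qed
qed

lemma thin_family:
  assumes D: "\<not> |D| <o k" and uv: "\<And>d. d \<in> D \<Longrightarrow> finite (u d) \<and> finite (v d) \<and> u d \<inter> v d = {}"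
  shows "\<exists>E\<subseteq>D. \<not> |E| <o k \<and> (\<forall>d\<in>E. \<forall>e\<in>E. u d \<inter> v e = {})"
proof -
  let ?D = "\<lambda>n. {d \<in> D. card (u d) + card (v d) = n}"
  have "\<exists>n. \<not> |?D n| <o k"
  proof (rule ccontr)
    assume "\<not> ?thesis"
    then have "|\<Union>n. ?D n| <o k"
      using ordIso_ordLess_trans[OF card_of_nat uncountable] by (intro UNION_less) simp_all
    moreover have "(\<Union>n. ?D n) = D" by auto
    ultimately show False using D by simp
  qed
  then obtain n where "\<not> |?D n| <o k" by blast
  from thin_family_aux[OF this, of u v n] uv obtain E where
    "E \<subseteq> ?D n" "\<not> |E| <o k" "\<forall>d\<in>E. \<forall>e\<in>E. u d \<inter> v e = {}" by auto
  then show ?thesis by (intro exI[of _ E]) auto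
qed

text \<open>
  A nonempty \<open>y\<close> contains all faces that include a certain \<open>u y\<close> and avoid a certain \<open>v y\<close>. After thinning out,
  two such sets \<open>y\<close> and \<open>z\<close> can be disjoint only because \<open>u y \<union> u z\<close> is not a face, so the projected \<open>u y\<close>
  are pairwise incompatible.
\<close>

lemma chain_condition_supported:
  assumes S: "kcc_complex k V S" and pi: "pi ` J \<subseteq> V"
  shows "set_chain_condition k (supported (lifted J pi S))"
  unfolding set_chain_condition_def
proof
  let ?T = "lifted J pi S"
  assume "\<exists>D\<subseteq>supported ?T - {{}}. |D| =o k \<and> disjoint D"
  then obtain D where D: "D \<subseteq> supported ?T - {{}}" "|D| =o k" "disjoint D" by auto
  have ex: "\<forall>y\<in>D. \<exists>r. fst r \<in> y \<and> finite (snd r) \<and> (\<forall>P\<in>?T. P \<in> y \<longleftrightarrow> P \<inter> snd r \<in> y)"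
  proof
    fix y assume "y \<in> D"
    then have "y \<in> supported ?T" "y \<noteq> {}" using D(1) by auto
    then obtain P F where "P \<in> y" "finite F" "\<forall>P\<in>?T. P \<in> y \<longleftrightarrow> P \<inter> F \<in> y" by (auto simp: supported_def)
    then show "\<exists>r. fst r \<in> y \<and> finite (snd r) \<and> (\<forall>P\<in>?T. P \<in> y \<longleftrightarrow> P \<inter> snd r \<in> y)"
      by (intro exI[of _ "(P, F)"]) simp
  qed
  from bchoice[OF ex] obtain r where
    r: "\<forall>y\<in>D. fst (r y) \<in> y \<and> finite (snd (r y)) \<and> (\<forall>P\<in>?T. P \<in> y \<longleftrightarrow> P \<inter> snd (r y) \<in> y)" ..
  define F where "F y = snd (r y)" for y
  define u where "u y = fst (r y) \<inter> F y" for y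
  define v where "v y = F y - fst (r y)" for y
  have fin: "finite (F y)" if "y \<in> D" for y using r that by (simp add: F_def)
  have supp: "P \<in> y \<longleftrightarrow> P \<inter> F y \<in> y" if "y \<in> D" "P \<in> ?T" for y P using r that by (simp add: F_def)
  have y_T: "y \<subseteq> ?T" if "y \<in> D" for y using D(1) that by (auto simp: supported_def)
  have u_y: "u y \<in> y" if y: "y \<in> D" for y
  proof -
    have "fst (r y) \<in> y" using r y by blast
    moreover from this have "fst (r y) \<in> ?T" using y_T[OF y] by blast
    ultimately show ?thesis using supp[OF y] by (simp add: u_def)
  qed
  have "\<not> |D| <o k" using D(2) not_ordLess_ordIso by blast
  moreover have "finite (u y) \<and> finite (v y) \<and> u y \<inter> v y = {}" if "y \<in> D" for y
    using fin[OF that] by (auto simp: u_def v_def)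
  ultimately obtain E where E: "E \<subseteq> D" "\<not> |E| <o k" "\<forall>d\<in>E. \<forall>e\<in>E. u d \<inter> v e = {}"
    using thin_family[of D u v] by auto
  have meets: "Q \<in> y" if Q: "Q \<in> ?T" "Q = u y \<union> u z" and yz: "y \<in> E" "z \<in> E" for Q y z
  proof -
    have "u z \<inter> v y = {}" using E(3) yz by blast
    then have "Q \<inter> F y = u y" using Q(2) by (auto simp: u_def v_def)
    then show ?thesis using supp[of y Q] u_y[of y] E(1) yz(1) Q(1) by auto
  qed
  have far: "pi ` u y \<union> pi ` u z \<notin> S" if yz: "y \<in> E" "z \<in> E" "y \<noteq> z" for y z
  proof
    assume S': "pi ` u y \<union> pi ` u z \<in> S"
    have "u y \<in> ?T" "u z \<in> ?T" using u_y y_T E(1) yz by blast+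
    then have Q: "u y \<union> u z \<in> ?T" using S' by (auto simp: lifted_def Fpow_def image_Un)
    have "u y \<union> u z \<in> y" by (rule meets[OF Q refl yz(1,2)])
    moreover have "u y \<union> u z \<in> z" by (rule meets[OF Q Un_commute yz(2,1)])
    moreover have "y \<inter> z = {}" using D(3) E(1) yz unfolding disjoint_def by blast
    ultimately show False by blast
  qed
  have piS: "pi ` u y \<in> S" if "y \<in> E" for y using u_y[of y] y_T[of y] E(1) that by (auto simp: lifted_def)
  have "inj_on (\<lambda>y. pi ` u y) E"
    using far piS by (intro inj_onI) (metis sup.idem)
  then have "|E| =o |(\<lambda>y. pi ` u y) ` E|" by (rule card_of_ordIsoI[OF inj_on_imp_bij_betw])
  then have "\<not> |(\<lambda>y. pi ` u y) ` E| <o k" using E(2) ordIso_ordLess_trans by metis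
  then obtain G where G: "G \<subseteq> (\<lambda>y. pi ` u y) ` E" "|G| =o k" by (rule obtain_subset)
  have "\<forall>P\<in>G. \<forall>Q\<in>G. P \<noteq> Q \<longrightarrow> P \<union> Q \<notin> S"
  proof (intro ballI impI)
    fix P Q assume PQ: "P \<in> G" "Q \<in> G" "P \<noteq> Q"
    from subsetD[OF G(1) PQ(1)] obtain y where y: "P = pi ` u y" "y \<in> E" by (rule imageE)
    from subsetD[OF G(1) PQ(2)] obtain z where z: "Q = pi ` u z" "z \<in> E" by (rule imageE)
    have "y \<noteq> z" using y z PQ(3) by blast
    from far[OF y(2) z(2) this] show "P \<union> Q \<notin> S" by (simp only: y z not_False_eq_True)
  qed
  moreover have "(\<lambda>y. pi ` u y) ` E \<subseteq> S" using piS by (rule image_subsetI)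
  then have "G \<subseteq> S" using G(1) by (rule order_trans[rotated])
  ultimately show False using S G(2) unfolding kcc_complex_def by blast
qed

end

section \<open>Algebras without large independent subsets\<close>

lemma finite_UNION_less:
  assumes t: "Cinfinite t" and I: "|I| <o t" and fin: "\<And>i. i \<in> I \<Longrightarrow> finite (A i)"
  shows "|\<Union>i\<in>I. A i| <o t"
proof (cases "finite I")
  case True
  then have "finite (\<Union>i\<in>I. A i)" using fin by blast
  then have "|\<Union>i\<in>I. A i| <o natLeq" by (simp add: finite_iff_ordLess_natLeq[symmetric])
  then show ?thesis using natLeq_ordLeq_cinfinite[OF t] by (rule ordLess_ordLeq_trans)
next
  case False
  then have "Cinfinite |I|" by (simp add: cinfinite_def Field_card_of card_of_Card_order)
  moreover have "|A i| \<le>o |I|" if "i \<in> I" for i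
    using ordLess_imp_ordLeq[OF finite_ordLess_infinite2[OF fin[OF that] False]] .
  ultimately have "|\<Union>i\<in>I. A i| \<le>o |I|" 
    by (intro UNION_Cinfinite_bound[OF ordIso_imp_ordLeq[OF card_of_refl]] ballI) simp_all
  then show ?thesis using I by (rule ordLeq_ordLess_trans)
qed

text \<open>
  Clause (c) of the first equivalence, read in the nerve: a meet of joins vanishes if and only if no face
  meets each of the sets over which the joins are taken.
\<close>

definition scattered :: "'t set \<Rightarrow> 't set set \<Rightarrow> bool" where
  "scattered V S \<longleftrightarrow> (\<forall>w. (\<forall>z\<in>V. finite (w z) \<and> w z \<subseteq> V) \<and> disjoint_family_on w V \<longrightarrow>
     (\<exists>u. finite u \<and> u \<subseteq> V \<and> (\<forall>P\<in>S. \<exists>z\<in>u. P \<inter> w z = {})))"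

text \<open>
  Clause (c) of the second equivalence, read in the nerve.
\<close>

definition no_large_centred :: "'t rel \<Rightarrow> 't set set \<Rightarrow> bool" where
  "no_large_centred t S \<longleftrightarrow>
     (\<forall>X. X \<subseteq> Field t \<and> |X| =o t \<longrightarrow> (\<exists>w. finite w \<and> w \<subseteq> X \<and> w \<notin> S))"

locale cofinal_map =
  fixes l :: "'l rel" and t :: "'t rel" and c :: "'t \<Rightarrow> 'l" and s0 :: 'l
  assumes l: "Cinfinite l" and t: "Card_order t" and cf: "cf l =o t" and t_less: "t <o l"
    and s0: "s0 \<in> Field l" "infinite (underS l s0)"
    and c_Field: "z \<in> Field t \<Longrightarrow> c z \<in> Field l"
    and c_late: "i \<in> Field l \<Longrightarrow> |{z \<in> Field t. (i, c z) \<notin> l}| <o t"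
begin

lemma t_inf: "Cinfinite t"
  by (rule Cinfinite_cong[OF cf Cinfinite_cf[OF l]])

lemma C: "Card_order l" using l by blast

lemma late_exists:
  assumes "i \<in> Field l" shows "\<exists>z\<in>Field t. (i, c z) \<in> l"
proof (rule ccontr)
  assume "\<not> ?thesis"
  then have "{z \<in> Field t. (i, c z) \<notin> l} = Field t" by blast
  then have "|Field t| <o t" using c_late[OF assms] by simp
  then show False using card_of_Field_ordIso[OF t] not_ordLess_ordIso by blast
qed

definition level :: "'l \<Rightarrow> 't" where
  "level i = (SOME z. z \<in> Field t \<and> (i, c z) \<in> l)"

lemma level: "i \<in> Field l \<Longrightarrow> level i \<in> Field t \<and> (i, c (level i)) \<in> l"
  unfolding level_def by (rule someI_ex) (use late_exists in blast)

lemma small_fibres: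
  assumes W: "W \<subseteq> Field t" "|W| <o t"
  shows "\<exists>J. infinite J \<and> |J| <o l \<and> {i \<in> Field l. level i \<in> W} \<subseteq> J"
proof -
  have "|c ` W| <o cf l"
    by (rule ordLess_ordIso_trans[OF ordLeq_ordLess_trans[OF card_of_image W(2)] ordIso_symmetric[OF cf]])
  moreover have "c ` W \<subseteq> Field l" using W(1) c_Field by auto
  ultimately obtain s where s: "s \<in> Field l" "\<forall>x\<in>c ` W. (x, s) \<in> l"
    using less_cf_bounded[OF l] by meson
  \<comment> \<open>\<open>underS l s0\<close> is added to make the set infinite.\<close>
  let ?J = "(underS l s \<union> {s}) \<union> underS l s0"
  have "|{s}| <o natLeq" by (simp add: finite_iff_ordLess_natLeq[symmetric])
  then have "|{s}| <o l" by (rule ordLess_ordLeq_trans[OF _ natLeq_ordLeq_cinfinite[OF l]])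
  then have "|?J| <o l"
    by (intro Un_Cinfinite_bound_strict[OF _ _ l] card_of_underS C s(1) s0(1))
  moreover have "infinite ?J" using s0(2) by simp
  moreover have "{i \<in> Field l. level i \<in> W} \<subseteq> ?J"
  proof (rule subsetI, rule ccontr)
    fix i assume "i \<in> {i \<in> Field l. level i \<in> W}" and nJ: "i \<notin> ?J"
    then have i: "i \<in> Field l" "level i \<in> W" by simp_all
    have "(i, c (level i)) \<in> l" "(c (level i), s) \<in> l" using level[OF i(1)] s(2) i(2) by auto
    then have "(i, s) \<in> l" by (rule transD[OF Card_order_linear(1)[OF C]])
    then show False using nJ by (auto simp: underS_def)
  qed
  ultimately show ?thesis by (intro exI[of _ ?J]) simp
qed

context
  fixes k :: "'k rel" and S :: "'t set set"
  assumes S: "kcc_complex k (Field t) S"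
begin

definition points :: "'l set set" where "points = lifted (Field l) level S"

lemma points_down: "P \<in> points \<Longrightarrow> Q \<subseteq> P \<Longrightarrow> Q \<in> points"
  unfolding points_def by (rule lifted_down[OF S])

lemma singleton_points: "i \<in> Field l \<Longrightarrow> {i} \<in> points"
  using level[of i] S by (auto simp: points_def lifted_def Fpow_def kcc_complex_def)

definition generator :: "'l \<Rightarrow> 'l set set" where "generator i = {P \<in> points. i \<in> P}"

lemma generator_supported: "generator i \<in> supported points"
  using points_down by (auto simp: supported_def generator_def intro!: exI[of _ "{i}"])

lemma card_generators: "|generator ` Field l| =o l"
proof -
  have "inj_on generator (Field l)"
  proof (rule inj_onI)
    fix i j assume ij: "i \<in> Field l" "generator i = generator j"
    have "{i} \<in> generator i" using singleton_points[OF ij(1)] by (simp add: generator_def)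
    then have "{i} \<in> generator j" by (simp only: ij(2))
    then show "i = j" by (simp add: generator_def)
  qed
  from card_of_ordIsoI[OF inj_on_imp_bij_betw[OF this]] show ?thesis
    by (rule ordIso_transitive[OF ordIso_symmetric card_of_Field_ordIso[OF C]])
qed

lemma card_supported_points: "|supported points| =o l"
proof -
  have "|supported points| \<le>o |Field l|"
    using l by (intro card_supported) (auto simp: cinfinite_def points_def lifted_def)
  then have "|supported points| \<le>o l" by (rule ordLeq_ordIso_trans[OF _ card_of_Field_ordIso[OF C]])
  moreover have "generator ` Field l \<subseteq> supported points" using generator_supported by blast
  from ordIso_ordLeq_trans[OF ordIso_symmetric[OF card_generators] card_of_mono1[OF this]]
  have "l \<le>o |supported points|" .
  ultimately show ?thesis by (simp add: ordIso_iff_ordLeq)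
qed

text \<open>
  Large sets of generators use \<open>t\<close> many levels, because fewer levels carry fewer than \<open>l\<close>
  generators; and a finite set of generators meets only if their levels form a face.
\<close>

lemma no_independent_generators:
  assumes nlc: "no_large_centred t S"
    and Y: "Y \<subseteq> generator ` Field l" "set_independent points Y" "|Y| =o l"
  shows False
proof -
  define I where "I = {i \<in> Field l. generator i \<in> Y}"
  have YI: "Y = generator ` I" using Y(1) by (auto simp: I_def)
  have "l \<le>o |I|"
    using ordIso_ordLeq_trans[OF ordIso_symmetric[OF Y(3)] card_of_image[of generator I, folded YI]] .
  define X where "X = level ` I"
  have XF: "X \<subseteq> Field t" using level by (auto simp: X_def I_def)
  have "\<not> |X| <o t"
  proof
    assume "|X| <o t"
    from small_fibres[OF XF this] obtain J where J: "|J| <o l" "{i \<in> Field l. level i \<in> X} \<subseteq> J" by blast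
    have "I \<subseteq> J" using J(2) by (auto simp: X_def I_def)
    from ordLeq_ordLess_trans[OF card_of_mono1[OF this] J(1)] have "|I| <o l" .
    then show False using \<open>l \<le>o |I|\<close> not_ordLess_ordLeq by blast
  qed
  then have "t \<le>o |X|"
    using not_ordLess_iff_ordLeq[OF card_order_on_well_order_on[OF t] card_of_Well_order] by blast
  moreover have "|X| \<le>o t" by (rule ordLeq_ordIso_trans[OF card_of_mono1[OF XF] card_of_Field_ordIso[OF t]])
  ultimately have "|X| =o t" by (simp add: ordIso_iff_ordLeq)
  with nlc XF obtain w where w: "finite w" "w \<subseteq> X" "w \<notin> S" unfolding no_large_centred_def by meson
  from finite_subset_image[OF w(1) w(2)[unfolded X_def]]
  obtain a where a: "a \<subseteq> I" "finite a" "w = level ` a" by blast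
  have "points \<inter> \<Inter>(generator ` a) - \<Union>{} \<noteq> {}"
    using Y(2) a(1,2) unfolding set_independent_def YI by blast
  then obtain P where P: "P \<in> points" "\<forall>i\<in>a. P \<in> generator i" by blast
  then have "a \<subseteq> P" by (auto simp: generator_def)
  then have "a \<in> points" by (rule points_down[OF P(1)])
  then show False using w(3) a(3) by (simp add: points_def lifted_def)
qed

definition base :: "'l set set \<Rightarrow> 'l set" where
  "base y = (SOME F. finite F \<and> (\<forall>P\<in>points. P \<in> y \<longleftrightarrow> P \<inter> F \<in> y))"

lemma base:
  assumes "y \<in> supported points"
  shows "finite (base y)" "P \<in> points \<Longrightarrow> P \<in> y \<longleftrightarrow> P \<inter> base y \<in> y"
proof -
  have "\<exists>F. finite F \<and> (\<forall>P\<in>points. P \<in> y \<longleftrightarrow> P \<inter> F \<in> y)" using assms by (simp add: supported_def)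
  from someI_ex[OF this, folded base_def]
  show "finite (base y)" "P \<in> points \<Longrightarrow> P \<in> y \<longleftrightarrow> P \<inter> base y \<in> y" by simp_all
qed

text \<open>
  The difference of the two elements lives over the levels in \<open>w\<close>.
\<close>

definition far_pair :: "'l set set set \<Rightarrow> 'l set set \<times> 'l set set \<times> 't set \<Rightarrow> bool" where
  "far_pair Y r \<longleftrightarrow> (case r of (y, z, w) \<Rightarrow> y \<in> Y \<and> z \<in> Y \<and> y \<noteq> z \<and> finite w \<and> w \<subseteq> Field t \<and>
     (\<forall>P\<in>y - z. level ` P \<inter> w \<noteq> {}))"

text \<open>
  The traces on the faces with all levels in \<open>W\<close> form a field with fewer than \<open>l\<close> sets, so two elements have
  the same trace. A face in their difference then has a vertex in one of the finite supports
  that is not over \<open>W\<close>.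
\<close>

lemma far_pair_exists:
  assumes Y: "Y \<subseteq> supported points" "\<not> |Y| <o l" and W: "W \<subseteq> Field t" "|W| <o t"
  shows "\<exists>y z w. far_pair Y (y, z, w) \<and> w \<inter> W = {}"
proof -
  obtain J where J: "infinite J" "|J| <o l" "{i \<in> Field l. level i \<in> W} \<subseteq> J"
    using small_fibres[OF W] by blast
  let ?T = "points \<inter> Pow J"
  have trace: "y \<inter> ?T \<in> supported ?T" if y: "y \<in> supported points" for y
  proof -
    have "P \<in> y \<inter> ?T \<longleftrightarrow> P \<inter> base y \<in> y \<inter> ?T" if P: "P \<in> ?T" for P
      using base(2)[OF y, of P] P points_down[of P] by blast
    then show ?thesis using base(1)[OF y] unfolding supported_def by blast
  qed
  have "?T \<subseteq> Fpow J" by (auto simp: points_def lifted_def Fpow_def)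
  from card_supported[OF J(1) this] have "|supported ?T| \<le>o |J|" .
  then have "|supported ?T| <o l" using J(2) by (rule ordLeq_ordLess_trans)
  moreover have "(\<lambda>y. y \<inter> ?T) ` Y \<subseteq> supported ?T" using trace Y(1) by blast
  then have "|(\<lambda>y. y \<inter> ?T) ` Y| \<le>o |supported ?T|" by (rule card_of_mono1)
  ultimately have small: "|(\<lambda>y. y \<inter> ?T) ` Y| <o l" by (rule ordLeq_ordLess_trans[rotated])
  have "\<not> inj_on (\<lambda>y. y \<inter> ?T) Y"
  proof
    assume "inj_on (\<lambda>y. y \<inter> ?T) Y"
    from card_of_ordIsoI[OF inj_on_imp_bij_betw[OF this]] small have "|Y| <o l" by (rule ordIso_ordLess_trans)
    then show False using Y(2) by contradiction
  qed
  then obtain y z where yz: "y \<in> Y" "z \<in> Y" "y \<noteq> z" "y \<inter> ?T = z \<inter> ?T" unfolding inj_on_def by blast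
  have y: "y \<in> supported points" and z: "z \<in> supported points" using Y(1) yz by blast+
  define F where "F = (base y \<union> base z) \<inter> Field l"
  define w where "w = level ` F - W"
  have "finite w" using base(1)[OF y] base(1)[OF z] by (simp add: w_def F_def)
  moreover have "w \<subseteq> Field t" using level by (auto simp: w_def F_def)
  moreover have "level ` P \<inter> w \<noteq> {}" if P: "P \<in> y - z" for P
  proof
    assume e: "level ` P \<inter> w = {}"
    have PT: "P \<in> points" using P y by (auto simp: supported_def)
    then have PF: "P \<subseteq> Field l" by (simp add: points_def lifted_def Fpow_def)
    let ?Q = "P \<inter> (base y \<union> base z)"
    have Q: "?Q \<in> points" by (rule points_down[OF PT]) blast
    have "level i \<in> W" if "i \<in> ?Q" for i
      using e that PF by (auto simp: w_def F_def)
    then have "?Q \<subseteq> J" using J(3) PF by blast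
    then have "?Q \<in> y \<longleftrightarrow> ?Q \<in> z" using yz(4) Q by blast
    moreover have "?Q \<inter> base y = P \<inter> base y" "?Q \<inter> base z = P \<inter> base z" by blast+
    ultimately have "P \<in> y \<longleftrightarrow> P \<in> z"
      using base(2)[OF y PT] base(2)[OF y Q] base(2)[OF z PT] base(2)[OF z Q] by simp
    then show False using P by blast
  qed
  moreover have "w \<inter> W = {}" by (auto simp: w_def)
  ultimately show ?thesis using yz(1-3)
    by (intro exI[of _ y] exI[of _ z] exI[of _ w]) (simp add: far_pair_def)
qed

text \<open>
  By \<open>far_pair_exists\<close> a maximal family of pairs with disjoint sets of levels and without common
  elements has at least \<open>t\<close> members. Independence makes any finitely many of the differences meet, in a face
  that meets all the corresponding sets of levels.
\<close>

lemma no_independent_supported: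
  assumes sc: "scattered (Field t) S"
    and Y: "Y \<subseteq> supported points" "set_independent points Y" "|Y| =o l"
  shows False
proof -
  let ?R = "\<lambda>(y :: 'l set set, z, w :: 't set) (y', z', w'). {y, z} \<inter> {y', z'} = {} \<and> w \<inter> w' = {}"
  have "symp ?R" by (auto simp: symp_def)
  from maximal_pairwise[OF this, of "{r. far_pair Y r}"] obtain E
    where E: "E \<subseteq> {r. far_pair Y r}" "pairwise ?R E"
    and max: "\<forall>r\<in>{r. far_pair Y r} - E. \<exists>e\<in>E. \<not> ?R r e" by auto
  have "\<not> |E| <o t"
  proof
    assume Et: "|E| <o t"
    define W where "W = (\<Union>e\<in>E. snd (snd e))"
    define Y0 where "Y0 = (\<Union>e\<in>E. {fst e, fst (snd e)})"
    have "|W| <o t" unfolding W_def using E(1) by (intro finite_UNION_less[OF t_inf Et]) (auto simp: far_pair_def)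
    moreover have "W \<subseteq> Field t" using E(1) by (fastforce simp: W_def far_pair_def)
    moreover have "|Y0| <o t" unfolding Y0_def by (rule finite_UNION_less[OF t_inf Et]) simp
    then have Y0: "|Y0| <o l" by (rule ordLess_transitive[OF _ t_less])
    have "\<not> |Y - Y0| <o l"
    proof
      assume "|Y - Y0| <o l"
      from Un_Cinfinite_bound_strict[OF this Y0 l] have "|(Y - Y0) \<union> Y0| <o l" .
      from ordLeq_ordLess_trans[OF card_of_mono1 this, of Y] have "|Y| <o l" by blast
      then show False using Y(3) not_ordLess_ordIso by blast
    qed
    moreover have "Y - Y0 \<subseteq> supported points" using Y(1) by blast
    ultimately obtain y z w where r: "far_pair (Y - Y0) (y, z, w)" "w \<inter> W = {}"
      using far_pair_exists[of "Y - Y0" W] by meson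
    have yz: "y \<notin> Y0" "z \<notin> Y0" and far: "far_pair Y (y, z, w)" using r(1) by (auto simp: far_pair_def)
    have R: "?R (y, z, w) e" if e: "e \<in> E" for e
    proof -
      obtain y' z' w' where e': "e = (y', z', w')" by (cases e)
      have "w' \<subseteq> W" using e by (force simp: W_def e')
      moreover have "y' \<in> Y0" "z' \<in> Y0" using e by (force simp: Y0_def e')+
      ultimately show ?thesis using yz r(2) by (auto simp: e')
    qed
    have "(y, z, w) \<notin> E" using yz(1) by (force simp: Y0_def)
    then have "(y, z, w) \<in> {r. far_pair Y r} - E" using far by simp
    from bspec[OF max this] obtain e where "e \<in> E" "\<not> ?R (y, z, w) e" by (rule bexE)
    then show False using R by metis
  qed
  then have "t \<le>o |E|"
    using not_ordLess_iff_ordLeq[OF card_order_on_well_order_on[OF t] card_of_Well_order] by blast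
  then have "|Field t| \<le>o |E|" by (rule ordIso_ordLeq_trans[OF card_of_Field_ordIso[OF t]])
  then obtain e where e: "inj_on e (Field t)" "e ` Field t \<subseteq> E" by (auto simp: card_of_ordLeq[symmetric])
  define y1 where "y1 x = fst (e x)" for x
  define y2 where "y2 x = fst (snd (e x))" for x
  define w where "w x = snd (snd (e x))" for x
  have e_eq: "e x = (y1 x, y2 x, w x)" for x by (simp add: y1_def y2_def w_def)
  have far: "far_pair Y (y1 x, y2 x, w x)" if "x \<in> Field t" for x
  proof -
    have "e x \<in> {r. far_pair Y r}" by (rule subsetD[OF E(1) subsetD[OF e(2) imageI[OF that]]])
    then show ?thesis by (simp only: e_eq mem_Collect_eq)
  qed
  have R: "{y1 x, y2 x} \<inter> {y1 x', y2 x'} = {} \<and> w x \<inter> w x' = {}"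
    if "x \<in> Field t" "x' \<in> Field t" "x \<noteq> x'" for x x'
  proof -
    have "e x \<in> E" "e x' \<in> E" "e x \<noteq> e x'" using that e by (auto dest: inj_onD)
    from pairwiseD[OF E(2) this] show ?thesis by (simp only: e_eq prod.case)
  qed
  have "disjoint_family_on w (Field t)" using R by (auto simp: disjoint_family_on_def)
  moreover have "\<forall>x\<in>Field t. finite (w x) \<and> w x \<subseteq> Field t" using far by (simp add: far_pair_def)
  ultimately obtain u where u: "finite u" "u \<subseteq> Field t" "\<forall>P\<in>S. \<exists>x\<in>u. P \<inter> w x = {}"
    using sc unfolding scattered_def by meson
  have "y1 ` u \<inter> y2 ` u = {}"
  proof -
    have "y1 x \<noteq> y2 x'" if "x \<in> u" "x' \<in> u" for x x'
      using R[of x x'] far[of x] subsetD[OF u(2) that(1)] subsetD[OF u(2) that(2)]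
      by (cases "x = x'") (auto simp: far_pair_def)
    then show ?thesis by auto
  qed
  moreover have "y1 ` u \<subseteq> Y" "y2 ` u \<subseteq> Y" using far u(2) by (auto simp: far_pair_def)
  ultimately have "points \<inter> \<Inter>(y1 ` u) - \<Union>(y2 ` u) \<noteq> {}"
    using Y(2) u(1) unfolding set_independent_def by simp
  then obtain P where P: "P \<in> points" "\<forall>x\<in>u. P \<in> y1 x - y2 x" by auto
  have "level ` P \<in> S" using P(1) by (simp add: points_def lifted_def)
  then obtain x where x: "x \<in> u" "level ` P \<inter> w x = {}" using u(3) by blast
  then show False using far[of x] u(2) P(2) by (auto simp: far_pair_def)
qed

end

end

section \<open>Boolean lattices as fields of sets\<close>

text \<open>
  Only the order is required to be transported, since it determines all the operations.
\<close>

locale set_representation = field_of_sets U M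
  for U :: "'p set" and M :: "'p set set" +
  fixes B :: "('a, 'm) gorder_scheme" and h :: "'a \<Rightarrow> 'p set"
  assumes po: "partial_order B" and bij: "bij_betw h (carrier B) M"
    and le: "x \<in> carrier B \<Longrightarrow> y \<in> carrier B \<Longrightarrow> x \<sqsubseteq>\<^bsub>B\<^esub> y \<longleftrightarrow> h x \<subseteq> h y"
begin

lemma h_M: "x \<in> carrier B \<Longrightarrow> h x \<in> M" and h_U: "x \<in> carrier B \<Longrightarrow> h x \<subseteq> U"
  using bij sub by (auto simp: bij_betw_def)

lemma h_eq: "x \<in> carrier B \<Longrightarrow> y \<in> carrier B \<Longrightarrow> h x = h y \<longleftrightarrow> x = y"
  using bij by (auto simp: bij_betw_def dest: inj_onD)

lemma h_surj: "A \<in> M \<Longrightarrow> \<exists>x\<in>carrier B. h x = A"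
  using bij by (auto simp: bij_betw_def)

lemma image_M: "A \<subseteq> carrier B \<Longrightarrow> h ` A \<subseteq> M"
  using h_M by blast

lemma greatest_unique:
  assumes "greatest B x A" "greatest B y A" shows "x = y"
proof -
  have "x \<in> carrier B" "y \<in> carrier B" "x \<sqsubseteq>\<^bsub>B\<^esub> y" "y \<sqsubseteq>\<^bsub>B\<^esub> x" using assms by (auto simp: greatest_def)
  then show ?thesis using h_eq[of x y] le[of x y] le[of y x] by blast
qed

lemma least_unique:
  assumes "least B x A" "least B y A" shows "x = y"
proof -
  have "x \<in> carrier B" "y \<in> carrier B" "x \<sqsubseteq>\<^bsub>B\<^esub> y" "y \<sqsubseteq>\<^bsub>B\<^esub> x" using assms by (auto simp: least_def)
  then show ?thesis using h_eq[of x y] le[of x y] le[of y x] by blast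
qed

lemma inf:
  assumes A: "finite A" "A \<subseteq> carrier B"
  shows "greatest B (\<Sqinter>\<^bsub>B\<^esub>A) (Lower B A)" "\<Sqinter>\<^bsub>B\<^esub>A \<in> carrier B" "h (\<Sqinter>\<^bsub>B\<^esub>A) = U \<inter> \<Inter>(h ` A)"
proof -
  have "U \<inter> \<Inter>(h ` A) \<in> M" using A by (intro finite_Inter image_M finite_imageI)
  then obtain m where m: "m \<in> carrier B" "h m = U \<inter> \<Inter>(h ` A)" using h_surj by blast
  have "m \<in> Lower B A" using m A(2) le[OF m(1)] by (auto simp: Lower_def)
  moreover have "x \<sqsubseteq>\<^bsub>B\<^esub> m" if "x \<in> Lower B A" for x
  proof -
    have x: "x \<in> carrier B" and low: "\<And>y. y \<in> A \<Longrightarrow> x \<sqsubseteq>\<^bsub>B\<^esub> y" using that A(2) by (auto simp: Lower_def)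
    have "h x \<subseteq> h y" if "y \<in> A" for y using low[OF that] le[OF x] A(2) that by blast
    then show ?thesis using le[OF x m(1)] m(2) h_U[OF x] by blast
  qed
  ultimately have g: "greatest B m (Lower B A)" by (auto simp: greatest_def Lower_def)
  then have "\<Sqinter>\<^bsub>B\<^esub>A = m" unfolding inf_def by (rule some_equality) (rule greatest_unique[OF _ g])
  then show "greatest B (\<Sqinter>\<^bsub>B\<^esub>A) (Lower B A)" "\<Sqinter>\<^bsub>B\<^esub>A \<in> carrier B" "h (\<Sqinter>\<^bsub>B\<^esub>A) = U \<inter> \<Inter>(h ` A)"
    using g m by simp_all
qed

lemma sup:
  assumes A: "finite A" "A \<subseteq> carrier B"
  shows "least B (\<Squnion>\<^bsub>B\<^esub>A) (Upper B A)" "\<Squnion>\<^bsub>B\<^esub>A \<in> carrier B" "h (\<Squnion>\<^bsub>B\<^esub>A) = \<Union>(h ` A)"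
proof -
  have "\<Union>(h ` A) \<in> M" using A by (intro finite_Union image_M finite_imageI)
  then obtain m where m: "m \<in> carrier B" "h m = \<Union>(h ` A)" using h_surj by blast
  have "m \<in> Upper B A" using m A(2) le[OF _ m(1)] by (auto simp: Upper_def)
  moreover have "m \<sqsubseteq>\<^bsub>B\<^esub> x" if "x \<in> Upper B A" for x
  proof -
    have x: "x \<in> carrier B" and up: "\<And>y. y \<in> A \<Longrightarrow> y \<sqsubseteq>\<^bsub>B\<^esub> x" using that A(2) by (auto simp: Upper_def)
    have "h y \<subseteq> h x" if "y \<in> A" for y using up[OF that] le[OF _ x] A(2) that by blast
    then show ?thesis using le[OF m(1) x] m(2) by blast
  qed
  ultimately have g: "least B m (Upper B A)" by (auto simp: least_def Upper_def)
  then have "\<Squnion>\<^bsub>B\<^esub>A = m" unfolding sup_def by (rule some_equality) (rule least_unique[OF _ g])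
  then show "least B (\<Squnion>\<^bsub>B\<^esub>A) (Upper B A)" "\<Squnion>\<^bsub>B\<^esub>A \<in> carrier B" "h (\<Squnion>\<^bsub>B\<^esub>A) = \<Union>(h ` A)"
    using g m by simp_all
qed

lemma bottom: "least B \<bottom>\<^bsub>B\<^esub> (carrier B)" "\<bottom>\<^bsub>B\<^esub> \<in> carrier B" "h \<bottom>\<^bsub>B\<^esub> = {}"
proof -
  obtain m where m: "m \<in> carrier B" "h m = {}" using h_surj empty by blast
  then have g: "least B m (carrier B)" using le by (auto simp: least_def)
  then have "\<bottom>\<^bsub>B\<^esub> = m" unfolding bottom_def by (rule some_equality) (rule least_unique[OF _ g])
  then show "least B \<bottom>\<^bsub>B\<^esub> (carrier B)" "\<bottom>\<^bsub>B\<^esub> \<in> carrier B" "h \<bottom>\<^bsub>B\<^esub> = {}" using g m by simp_all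
qed

lemma top: "greatest B \<top>\<^bsub>B\<^esub> (carrier B)" "\<top>\<^bsub>B\<^esub> \<in> carrier B" "h \<top>\<^bsub>B\<^esub> = U"
proof -
  obtain m where m: "m \<in> carrier B" "h m = U" using h_surj field_of_sets_axioms field_of_sets.top by metis
  then have g: "greatest B m (carrier B)" using le h_U by (auto simp: greatest_def)
  then have "\<top>\<^bsub>B\<^esub> = m" unfolding top_def by (rule some_equality) (rule greatest_unique[OF _ g])
  then show "greatest B \<top>\<^bsub>B\<^esub> (carrier B)" "\<top>\<^bsub>B\<^esub> \<in> carrier B" "h \<top>\<^bsub>B\<^esub> = U" using g m by simp_all
qed

lemma eq_bottom: "x \<in> carrier B \<Longrightarrow> x = \<bottom>\<^bsub>B\<^esub> \<longleftrightarrow> h x = {}"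
  using h_eq[of x "\<bottom>\<^bsub>B\<^esub>"] bottom by simp

lemma meet:
  assumes "x \<in> carrier B" "y \<in> carrier B"
  shows "x \<sqinter>\<^bsub>B\<^esub> y \<in> carrier B" "h (x \<sqinter>\<^bsub>B\<^esub> y) = h x \<inter> h y"
  using inf[of "{x, y}"] assms h_U[OF assms(1)] by (auto simp: meet_def)

lemma join:
  assumes "x \<in> carrier B" "y \<in> carrier B"
  shows "x \<squnion>\<^bsub>B\<^esub> y \<in> carrier B" "h (x \<squnion>\<^bsub>B\<^esub> y) = h x \<union> h y"
  using sup[of "{x, y}"] assms by (auto simp: join_def)

lemma complement_iff:
  assumes "x \<in> carrier B" "y \<in> carrier B"
  shows "x \<sqinter>\<^bsub>B\<^esub> y = \<bottom>\<^bsub>B\<^esub> \<and> x \<squnion>\<^bsub>B\<^esub> y = \<top>\<^bsub>B\<^esub> \<longleftrightarrow> h y = U - h x"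
proof -
  have "x \<sqinter>\<^bsub>B\<^esub> y = \<bottom>\<^bsub>B\<^esub> \<longleftrightarrow> h x \<inter> h y = {}" using meet[OF assms] eq_bottom by simp
  moreover have "x \<squnion>\<^bsub>B\<^esub> y = \<top>\<^bsub>B\<^esub> \<longleftrightarrow> h x \<union> h y = U"
    using join[OF assms] h_eq[OF join(1)[OF assms] top(2)] top(3) by simp
  ultimately show ?thesis using h_U assms by blast
qed

lemma complement:
  assumes x: "x \<in> carrier B"
  shows "complement B x \<in> carrier B" "h (complement B x) = U - h x"
proof -
  obtain y where y: "y \<in> carrier B" "h y = U - h x" using h_surj Compl[OF h_M[OF x]] by blast
  have "complement B x = y"
    unfolding complement_def
  proof (rule the_equality)
    show "y \<in> carrier B \<and> x \<sqinter>\<^bsub>B\<^esub> y = \<bottom>\<^bsub>B\<^esub> \<and> x \<squnion>\<^bsub>B\<^esub> y = \<top>\<^bsub>B\<^esub>"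
      using complement_iff[OF x y(1)] y by simp
  next
    fix z assume "z \<in> carrier B \<and> x \<sqinter>\<^bsub>B\<^esub> z = \<bottom>\<^bsub>B\<^esub> \<and> x \<squnion>\<^bsub>B\<^esub> z = \<top>\<^bsub>B\<^esub>"
    then show "z = y" using complement_iff[OF x, of z] y h_eq[of z y] by simp
  qed
  then show "complement B x \<in> carrier B" "h (complement B x) = U - h x" using y by simp_all
qed

lemma boolean_lattice: "boolean_lattice B"
proof -
  interpret partial_order B by (rule po)
  show ?thesis
  proof unfold_locales
    fix x y assume xy: "x \<in> carrier B" "y \<in> carrier B"
    show "\<exists>s. least B s (Upper B {x, y})" using sup(1)[of "{x, y}"] xy by auto
    show "\<exists>s. greatest B s (Lower B {x, y})" using inf(1)[of "{x, y}"] xy by auto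
  next
    show "\<exists>x. least B x (carrier B)" using bottom(1) by blast
    show "\<exists>x. greatest B x (carrier B)" using top(1) by blast
  next
    fix x y z assume xyz: "x \<in> carrier B" "y \<in> carrier B" "z \<in> carrier B"
    have "h (x \<sqinter>\<^bsub>B\<^esub> (y \<squnion>\<^bsub>B\<^esub> z)) = h ((x \<sqinter>\<^bsub>B\<^esub> y) \<squnion>\<^bsub>B\<^esub> (x \<sqinter>\<^bsub>B\<^esub> z))"
      using xyz by (simp add: meet join Int_Un_distrib)
    then show "x \<sqinter>\<^bsub>B\<^esub> (y \<squnion>\<^bsub>B\<^esub> z) = (x \<sqinter>\<^bsub>B\<^esub> y) \<squnion>\<^bsub>B\<^esub> (x \<sqinter>\<^bsub>B\<^esub> z)"
      by (rule h_eq[THEN iffD1, rotated 2]) (use xyz in \<open>simp_all add: meet join\<close>)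
  next
    fix x assume x: "x \<in> carrier B"
    show "\<exists>y\<in>carrier B. x \<sqinter>\<^bsub>B\<^esub> y = \<bottom>\<^bsub>B\<^esub> \<and> x \<squnion>\<^bsub>B\<^esub> y = \<top>\<^bsub>B\<^esub>"
      using complement_iff[OF x complement(1)[OF x]] complement[OF x] by blast
  qed
qed

lemma card_image: "A \<subseteq> carrier B \<Longrightarrow> |h ` A| =o |A|"
  using bij by (intro ordIso_symmetric[OF card_of_ordIsoI[OF inj_on_imp_bij_betw]])
    (auto simp: bij_betw_def intro: inj_on_subset)

lemma chain_condition_iff: "chain_condition k B \<longleftrightarrow> set_chain_condition k M"
proof -
  have "(\<exists>D. D \<subseteq> carrier B - {\<bottom>\<^bsub>B\<^esub>} \<and> |D| =o k \<and> (\<forall>x\<in>D. \<forall>y\<in>D. x \<noteq> y \<longrightarrow> x \<sqinter>\<^bsub>B\<^esub> y = \<bottom>\<^bsub>B\<^esub>)) \<longleftrightarrow>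
      (\<exists>D\<subseteq>M - {{}}. |D| =o k \<and> disjoint D)" (is "?L \<longleftrightarrow> ?R")
  proof
    assume ?L
    then obtain D where D: "D \<subseteq> carrier B - {\<bottom>\<^bsub>B\<^esub>}" "|D| =o k"
      "\<forall>x\<in>D. \<forall>y\<in>D. x \<noteq> y \<longrightarrow> x \<sqinter>\<^bsub>B\<^esub> y = \<bottom>\<^bsub>B\<^esub>" by auto
    have c: "x \<in> carrier B" "x \<noteq> \<bottom>\<^bsub>B\<^esub>" if "x \<in> D" for x using D(1) that by auto
    have "h ` D \<subseteq> M - {{}}" using c h_M eq_bottom by auto
    moreover have "|h ` D| =o k" using card_image[of D] c(1) D(2) by (auto intro: ordIso_transitive)
    moreover have "disjoint (h ` D)"
    proof (rule disjointI)
      fix a b assume "a \<in> h ` D" "b \<in> h ` D" "a \<noteq> b"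
      then obtain x y where xy: "x \<in> D" "y \<in> D" "a = h x" "b = h y" "x \<noteq> y" by blast
      then have "x \<sqinter>\<^bsub>B\<^esub> y = \<bottom>\<^bsub>B\<^esub>" using D(3) by blast
      then show "a \<inter> b = {}" using meet(2)[of x y] bottom(3) c(1) xy by simp
    qed
    ultimately show ?R by blast
  next
    assume ?R
    then obtain D where D: "D \<subseteq> M - {{}}" "|D| =o k" "disjoint D" by auto
    let ?D = "{x \<in> carrier B. h x \<in> D}"
    have im: "h ` ?D = D" using h_surj D(1) by blast
    have "?D \<subseteq> carrier B - {\<bottom>\<^bsub>B\<^esub>}" using D(1) bottom(3) by auto
    moreover have "|?D| =o k"
      using ordIso_transitive[OF ordIso_symmetric[OF card_image[of ?D]]] im D(2) by simp
    moreover have "x \<sqinter>\<^bsub>B\<^esub> y = \<bottom>\<^bsub>B\<^esub>" if "x \<in> ?D" "y \<in> ?D" "x \<noteq> y" for x y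
    proof -
      have "h x \<noteq> h y" using that h_eq by simp
      then have "h x \<inter> h y = {}" using D(3) that unfolding disjoint_def by blast
      then show ?thesis using that meet[of x y] eq_bottom by simp
    qed
    ultimately show ?L by (intro exI[of _ ?D]) simp
  qed
  then show ?thesis by (simp add: chain_condition_def set_chain_condition_def)
qed

lemma infi_image:
  assumes "finite u" "f ` u \<subseteq> carrier B"
  shows "infi B u f \<in> carrier B" "h (infi B u f) = U \<inter> (\<Inter>x\<in>u. h (f x))"
  using inf[of "f ` u"] assms by (simp_all add: infi_def image_image)

lemma supr_image:
  assumes "finite u" "f ` u \<subseteq> carrier B"
  shows "(SSUP\<^bsub>B\<^esub> x:u. f x) \<in> carrier B" "h (SSUP\<^bsub>B\<^esub> x:u. f x) = (\<Union>x\<in>u. h (f x))"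
  using sup[of "f ` u"] assms by (simp_all add: Lattice.supr_def image_image)

lemma independent_iff:
  assumes Y: "Y \<subseteq> carrier B"
  shows "independent B Y \<longleftrightarrow> set_independent U (h ` Y)"
proof -
  have cell: "infi B u (\<lambda>y. y) \<sqinter>\<^bsub>B\<^esub> infi B v (complement B) \<noteq> \<bottom>\<^bsub>B\<^esub> \<longleftrightarrow> U \<inter> \<Inter>(h ` u) - \<Union>(h ` v) \<noteq> {}"
    if uv: "finite u" "finite v" "u \<subseteq> Y" "v \<subseteq> Y" for u v
  proof -
    have u: "(\<lambda>y. y) ` u \<subseteq> carrier B" and v: "complement B ` v \<subseteq> carrier B"
      using uv Y complement(1) by auto
    have "h (infi B u (\<lambda>y. y) \<sqinter>\<^bsub>B\<^esub> infi B v (complement B)) =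
        (U \<inter> (\<Inter>x\<in>u. h x)) \<inter> (U \<inter> (\<Inter>x\<in>v. h (complement B x)))"
      by (simp only: meet infi_image[OF uv(1) u] infi_image[OF uv(2) v])
    also have "(\<Inter>x\<in>v. h (complement B x)) = (\<Inter>x\<in>v. U - h x)"
      using complement(2) uv(4) Y by (intro INF_cong) auto
    also have "(U \<inter> (\<Inter>x\<in>u. h x)) \<inter> (U \<inter> (\<Inter>x\<in>v. U - h x)) = U \<inter> \<Inter>(h ` u) - \<Union>(h ` v)"
      by auto
    finally show ?thesis
      using eq_bottom[OF meet(1)[OF infi_image(1)[OF uv(1) u] infi_image(1)[OF uv(2) v]]] by simp
  qed
  show ?thesis
  proof
    assume ind: "independent B Y"
    show "set_independent U (h ` Y)"
      unfolding set_independent_def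
    proof (intro allI impI, elim conjE)
      fix a b assume ab: "finite a" "finite b" "a \<subseteq> h ` Y" "b \<subseteq> h ` Y" "a \<inter> b = {}"
      obtain u where u: "u \<subseteq> Y" "finite u" "a = h ` u" using finite_subset_image[OF ab(1,3)] by blast
      obtain v where v: "v \<subseteq> Y" "finite v" "b = h ` v" using finite_subset_image[OF ab(2,4)] by blast
      have "u \<inter> v = {}" using u v ab(5) by blast
      then show "U \<inter> \<Inter>a - \<Union>b \<noteq> {}"
        using ind cell[OF u(2) v(2) u(1) v(1)] u v unfolding independent_def by simp
    qed
  next
    assume ind: "set_independent U (h ` Y)"
    show "independent B Y"
      unfolding independent_def
    proof (intro allI impI, elim conjE)
      fix u v assume uv: "finite u" "finite v" "u \<subseteq> Y" "v \<subseteq> Y" "u \<inter> v = {}"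
      have "h ` u \<inter> h ` v = {}" using uv(3-5) Y h_eq by blast
      moreover have "finite (h ` u)" "finite (h ` v)" "h ` u \<subseteq> h ` Y" "h ` v \<subseteq> h ` Y" using uv by auto
      ultimately have "U \<inter> \<Inter>(h ` u) - \<Union>(h ` v) \<noteq> {}"
        using ind unfolding set_independent_def by meson
      then show "infi B u (\<lambda>y. y) \<sqinter>\<^bsub>B\<^esub> infi B v (complement B) \<noteq> \<bottom>\<^bsub>B\<^esub>"
        using cell[OF uv(1-4)] by blast
    qed
  qed
qed

end

lemma field_of_sets_representable:
  fixes M :: "'p set set"
  assumes "field_of_sets U M" and room: "|M| \<le>o |UNIV :: 'b set|"
  shows "\<exists>(B :: 'b gorder) h. set_representation U M B h"
proof -
  obtain f :: "'p set \<Rightarrow> 'b" where f: "inj_on f M" using room by (auto simp: card_of_ordLeq[symmetric])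
  define h where "h = inv_into M f"
  define B :: "'b gorder" where "B = \<lparr>carrier = f ` M, eq = (=), le = \<lambda>x y. h x \<subseteq> h y\<rparr>"
  have bij: "bij_betw h (f ` M) M"
    unfolding h_def by (rule bij_betw_inv_into[OF inj_on_imp_bij_betw[OF f]])
  have "partial_order B"
    by unfold_locales (auto simp: B_def dest: inj_onD[OF bij_betw_imp_inj_on[OF bij]])
  then have "set_representation U M B h"
    using assms(1) bij by (simp add: set_representation_def set_representation_axioms_def B_def)
  then show ?thesis by blast
qed

context boolean_lattice
begin

definition proper_filter :: "'a set \<Rightarrow> bool" where
  "proper_filter F \<longleftrightarrow> F \<subseteq> carrier L \<and> \<bottom> \<notin> F \<and> \<top> \<in> F \<and>
     (\<forall>x\<in>F. \<forall>y\<in>F. x \<sqinter> y \<in> F) \<and> (\<forall>x\<in>F. \<forall>y\<in>carrier L. x \<sqsubseteq> y \<longrightarrow> y \<in> F)"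

text \<open>
  Ultrafilters, in a form that speaks neither of maximality nor of complements: an element not in the filter
  is disjoint from a member of it.
\<close>

definition stone_space :: "'a set set" where
  "stone_space = {F. proper_filter F \<and> (\<forall>x\<in>carrier L. x \<in> F \<or> (\<exists>y\<in>F. x \<sqinter> y = \<bottom>))}"

definition stone_map :: "'a \<Rightarrow> 'a set set" where
  "stone_map x = {F \<in> stone_space. x \<in> F}"

lemma le_bottom: "x \<in> carrier L \<Longrightarrow> x \<sqsubseteq> \<bottom> \<Longrightarrow> x = \<bottom>"
  using bottom_lower[of x] by (intro le_antisym) auto

lemma le_if_disjoint_complement:
  assumes x: "x \<in> carrier L" and y: "y \<in> carrier L" "y' \<in> carrier L" "y \<squnion> y' = \<top>" and "x \<sqinter> y' = \<bottom>"
  shows "x \<sqsubseteq> y"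
proof -
  have "x \<sqinter> \<top> = (x \<sqinter> y) \<squnion> (x \<sqinter> y')" using meet_join_distrib[OF x y(1,2)] y(3) by simp
  also have "\<dots> = (x \<sqinter> y) \<squnion> \<bottom>" using assms(5) by simp
  finally have eq: "x \<sqinter> \<top> = (x \<sqinter> y) \<squnion> \<bottom>" .
  have "x \<sqsubseteq> x \<sqinter> \<top>" using x by (intro meet_le) (auto intro: top_higher)
  moreover have "(x \<sqinter> y) \<squnion> \<bottom> \<sqsubseteq> y" using x y by (intro join_le meet_right) (auto intro: bottom_lower)
  ultimately show ?thesis using eq x y by (metis le_trans bottom_closed join_closed meet_closed)
qed

lemma ultrafilter_exists:
  assumes z: "z \<in> carrier L" "z \<noteq> \<bottom>"
  shows "\<exists>F\<in>stone_space. z \<in> F"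
proof -
  let ?A = "{F. proper_filter F \<and> z \<in> F}"
  have "{x \<in> carrier L. z \<sqsubseteq> x} \<in> ?A"
    using z le_bottom[OF z(1)]
    by (auto simp: proper_filter_def intro: top_higher meet_le le_trans)
  then have ne: "?A \<noteq> {}" by blast
  have "\<exists>F\<in>?A. \<forall>X\<in>?A. F \<subseteq> X \<longrightarrow> X = F"
  proof (rule subset_Zorn_nonempty[OF ne])
    fix C assume C: "C \<noteq> {}" "subset.chain ?A C"
    then have pf: "\<And>F. F \<in> C \<Longrightarrow> proper_filter F \<and> z \<in> F"
      and tot: "\<And>F G. F \<in> C \<Longrightarrow> G \<in> C \<Longrightarrow> F \<subseteq> G \<or> G \<subseteq> F" unfolding subset_chain_def by blast+
    have "x \<sqinter> y \<in> \<Union>C" if "x \<in> \<Union>C" "y \<in> \<Union>C" for x y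
    proof -
      from that obtain F G where "F \<in> C" "G \<in> C" "x \<in> F" "y \<in> G" by blast
      then obtain H where "H \<in> C" "x \<in> H" "y \<in> H" using tot[of F G] by blast
      then show ?thesis using pf[of H] unfolding proper_filter_def by blast
    qed
    moreover have "y \<in> \<Union>C" if "x \<in> \<Union>C" "y \<in> carrier L" "x \<sqsubseteq> y" for x y
      using that pf unfolding proper_filter_def by blast
    moreover have "\<Union>C \<subseteq> carrier L" "\<bottom> \<notin> \<Union>C" using pf unfolding proper_filter_def by blast+
    moreover have "\<top> \<in> \<Union>C" "z \<in> \<Union>C" using C(1) pf unfolding proper_filter_def by blast+
    ultimately show "\<Union>C \<in> ?A" unfolding proper_filter_def by simp
  qed
  then obtain F where "F \<in> ?A" and max: "\<forall>X\<in>?A. F \<subseteq> X \<longrightarrow> X = F" ..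
  then have pf: "proper_filter F" and zF: "z \<in> F" by simp_all
  then have F: "F \<subseteq> carrier L" "\<bottom> \<notin> F" "\<top> \<in> F" "\<And>x y. x \<in> F \<Longrightarrow> y \<in> F \<Longrightarrow> x \<sqinter> y \<in> F"
    unfolding proper_filter_def by blast+
  have "x \<in> F" if x: "x \<in> carrier L" and no: "\<forall>y\<in>F. x \<sqinter> y \<noteq> \<bottom>" for x
  proof -
    let ?G = "{w \<in> carrier L. \<exists>y\<in>F. x \<sqinter> y \<sqsubseteq> w}"
    have meet_G: "u \<sqinter> w \<in> ?G" if "u \<in> ?G" "w \<in> ?G" for u w
    proof -
      from that obtain y y' where y: "y \<in> F" "y' \<in> F" "x \<sqinter> y \<sqsubseteq> u" "x \<sqinter> y' \<sqsubseteq> w" by blast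
      have c: "y \<in> carrier L" "y' \<in> carrier L" "u \<in> carrier L" "w \<in> carrier L" using y F(1) that by auto
      have "x \<sqinter> (y \<sqinter> y') \<sqsubseteq> x \<sqinter> y" "x \<sqinter> (y \<sqinter> y') \<sqsubseteq> x \<sqinter> y'"
        using x c by (meson le_trans meet_closed meet_le meet_left meet_right)+
      then have "x \<sqinter> (y \<sqinter> y') \<sqsubseteq> u \<sqinter> w"
        using x c y by (meson le_trans meet_closed meet_le)
      then show ?thesis using F(4)[OF y(1,2)] c by auto
    qed
    have "\<bottom> \<notin> ?G"
    proof
      assume "\<bottom> \<in> ?G"
      then obtain y where y: "y \<in> F" "x \<sqinter> y \<sqsubseteq> \<bottom>" by blast
      then have "x \<sqinter> y = \<bottom>" using x F(1) by (intro le_bottom) auto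
      then show False using no y(1) by blast
    qed
    moreover have "w' \<in> ?G" if "w \<in> ?G" "w' \<in> carrier L" "w \<sqsubseteq> w'" for w w'
      using that x F(1) le_trans by (smt (verit) mem_Collect_eq meet_closed subsetD)
    moreover have FG: "F \<subseteq> ?G" using F(1) x meet_right by blast
    ultimately have "proper_filter ?G" using meet_G F(3) unfolding proper_filter_def by blast
    then have "?G \<in> ?A" using subsetD[OF FG zF] by simp
    then have "?G = F" by (rule max[rule_format, OF _ FG])
    moreover have "x \<in> ?G" using x F(3) meet_left[OF x top_closed] by blast
    ultimately show ?thesis by (simp only:)
  qed
  then have "F \<in> stone_space" using pf unfolding stone_space_def by blast
  then show ?thesis using zF by blast
qed

theorem stone_representation: "set_representation stone_space (stone_map ` carrier L) L stone_map"
proof -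
  have F: "F \<subseteq> carrier L" "\<bottom> \<notin> F" "\<top> \<in> F" "\<And>x y. x \<in> F \<Longrightarrow> y \<in> F \<Longrightarrow> x \<sqinter> y \<in> F"
    "\<And>x y. x \<in> F \<Longrightarrow> y \<in> carrier L \<Longrightarrow> x \<sqsubseteq> y \<Longrightarrow> y \<in> F"
    "\<And>x. x \<in> carrier L \<Longrightarrow> x \<in> F \<or> (\<exists>y\<in>F. x \<sqinter> y = \<bottom>)" if "F \<in> stone_space" for F
    using that unfolding stone_space_def proper_filter_def by blast+
  have meet: "stone_map (x \<sqinter> y) = stone_map x \<inter> stone_map y" if xy: "x \<in> carrier L" "y \<in> carrier L" for x y
  proof -
    have "x \<sqinter> y \<in> F \<longleftrightarrow> x \<in> F \<and> y \<in> F" if S: "F \<in> stone_space" for F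
      using F(5)[OF S _ xy(1) meet_left[OF xy]] F(5)[OF S _ xy(2) meet_right[OF xy]] F(4)[OF S] by blast
    then show ?thesis unfolding stone_map_def by blast
  qed
  have compl: "stone_map y = stone_space - stone_map x"
    if xy: "x \<in> carrier L" "y \<in> carrier L" "x \<sqinter> y = \<bottom>" "x \<squnion> y = \<top>" for x y
  proof -
    have "y \<in> F \<longleftrightarrow> x \<notin> F" if S: "F \<in> stone_space" for F
    proof
      assume "y \<in> F"
      then show "x \<notin> F" using F(2)[OF S] F(4)[OF S, of x y] xy(3) by auto
    next
      assume "x \<notin> F"
      then obtain z where z: "z \<in> F" "x \<sqinter> z = \<bottom>" using F(6)[OF S xy(1)] by blast
      then have zc: "z \<in> carrier L" using F(1)[OF S] by blast
      have "z \<sqsubseteq> y"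
        using le_if_disjoint_complement[OF zc xy(2,1)] z(2) xy(4) by (simp add: meet_comm join_comm)
      then show "y \<in> F" by (rule F(5)[OF S z(1) xy(2)])
    qed
    then show ?thesis unfolding stone_map_def by blast
  qed
  have le: "x \<sqsubseteq> y \<longleftrightarrow> stone_map x \<subseteq> stone_map y" if xy: "x \<in> carrier L" "y \<in> carrier L" for x y
  proof
    assume "x \<sqsubseteq> y"
    then show "stone_map x \<subseteq> stone_map y" using F(5)[OF _ _ xy(2)] by (auto simp: stone_map_def)
  next
    assume s: "stone_map x \<subseteq> stone_map y"
    obtain y' where y': "y' \<in> carrier L" "y \<sqinter> y' = \<bottom>" "y \<squnion> y' = \<top>" using complement_exists[OF xy(2)] by blast
    have "x \<sqinter> y' = \<bottom>"
    proof (rule ccontr)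
      assume "x \<sqinter> y' \<noteq> \<bottom>"
      then obtain G where "G \<in> stone_space" "x \<sqinter> y' \<in> G"
        using ultrafilter_exists[OF meet_closed[OF xy(1) y'(1)]] by blast
      then have "G \<in> stone_map x \<inter> stone_map y'" unfolding meet[OF xy(1) y'(1), symmetric] by (simp add: stone_map_def)
      then show False using s compl[OF xy(2) y'] by blast
    qed
    then show "x \<sqsubseteq> y" by (rule le_if_disjoint_complement[OF xy y'(1,3)])
  qed
  have "field_of_sets stone_space (stone_map ` carrier L)"
  proof
    show "stone_map ` carrier L \<subseteq> Pow stone_space" by (auto simp: stone_map_def)
    have "stone_map \<top> = stone_space" using F(3) by (auto simp: stone_map_def)
    then show "stone_space \<in> stone_map ` carrier L" using top_closed by (metis imageI)
  next
    fix a b assume "a \<in> stone_map ` carrier L" "b \<in> stone_map ` carrier L"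
    then show "a \<inter> b \<in> stone_map ` carrier L" using meet meet_closed by (auto simp flip: meet)
  next
    fix a assume "a \<in> stone_map ` carrier L"
    then obtain x where x: "x \<in> carrier L" "a = stone_map x" by blast
    obtain y where "y \<in> carrier L" "x \<sqinter> y = \<bottom>" "x \<squnion> y = \<top>" using complement_exists[OF x(1)] by blast
    then show "stone_space - a \<in> stone_map ` carrier L" using compl[OF x(1)] x(2) by blast
  qed
  moreover have "inj_on stone_map (carrier L)"
    by (intro inj_onI le_antisym) (simp_all add: le)
  ultimately show ?thesis
    using le partial_order_axioms
    by (simp add: set_representation_def set_representation_axioms_def inj_on_imp_bij_betw)
qed

end

section \<open>Nerves of splitting elements\<close>

definition nerve :: "'p set \<Rightarrow> 't set \<Rightarrow> ('t \<Rightarrow> 'p set) \<Rightarrow> 't set set" where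
  "nerve U V a = {P \<in> Fpow V. U \<inter> \<Inter>(a ` P) \<noteq> {}}"

lemma (in chain_condition_field) kcc_complex_nerve:
  assumes a: "a ` V \<subseteq> M - {{}}"
  shows "kcc_complex k V (nerve U V a)"
  unfolding kcc_complex_def
proof (intro conjI)
  show "nerve U V a \<subseteq> Fpow V" by (auto simp: nerve_def)
  show "\<forall>P\<in>nerve U V a. \<forall>Q\<subseteq>P. Q \<in> nerve U V a"
  proof (intro ballI allI impI)
    fix P Q assume PQ: "P \<in> nerve U V a" "Q \<subseteq> P"
    then have "U \<inter> \<Inter>(a ` P) \<subseteq> U \<inter> \<Inter>(a ` Q)" by blast
    then show "Q \<in> nerve U V a" using PQ finite_subset[of Q P] by (auto simp: nerve_def Fpow_def)
  qed
  show "\<forall>z\<in>V. {z} \<in> nerve U V a"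
  proof
    fix z assume "z \<in> V"
    then have "a z \<in> M - {{}}" using a by blast
    then show "{z} \<in> nerve U V a" using \<open>z \<in> V\<close> sub by (auto simp: nerve_def Fpow_def)
  qed
  show "\<not> (\<exists>E\<subseteq>nerve U V a. |E| =o k \<and> (\<forall>P\<in>E. \<forall>Q\<in>E. P \<noteq> Q \<longrightarrow> P \<union> Q \<notin> nerve U V a))"
  proof
    assume "\<exists>E\<subseteq>nerve U V a. |E| =o k \<and> (\<forall>P\<in>E. \<forall>Q\<in>E. P \<noteq> Q \<longrightarrow> P \<union> Q \<notin> nerve U V a)"
    then obtain E where E: "E \<subseteq> nerve U V a" "|E| =o k"
      "\<forall>P\<in>E. \<forall>Q\<in>E. P \<noteq> Q \<longrightarrow> P \<union> Q \<notin> nerve U V a" by auto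
    let ?m = "\<lambda>P. U \<inter> \<Inter>(a ` P)"
    have ne: "?m P \<noteq> {}" "finite P" "P \<subseteq> V" if "P \<in> E" for P
      using subsetD[OF E(1) that] by (auto simp: nerve_def Fpow_def)
    have dis: "?m P \<inter> ?m Q = {}" if PQ: "P \<in> E" "Q \<in> E" "P \<noteq> Q" for P Q
    proof -
      have "P \<union> Q \<notin> nerve U V a" using E(3) PQ by blast
      moreover have "P \<union> Q \<in> Fpow V" using ne(2,3)[OF PQ(1)] ne(2,3)[OF PQ(2)] by (simp add: Fpow_def)
      ultimately have "?m (P \<union> Q) = {}" unfolding nerve_def by blast
      then show ?thesis by (auto simp: image_Un)
    qed
    have "inj_on ?m E"
    proof (rule inj_onI, rule ccontr)
      fix P Q assume "P \<in> E" "Q \<in> E" "?m P = ?m Q" "P \<noteq> Q"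
      then show False using dis[of P Q] ne(1)[of P] by simp
    qed
    then have "|E| =o |?m ` E|" by (rule card_of_ordIsoI[OF inj_on_imp_bij_betw])
    then have "|?m ` E| =o k" by (rule ordIso_transitive[OF ordIso_symmetric E(2)])
    moreover have "|?m ` E| <o k"
    proof (rule disjoint_less)
      show "?m ` E \<subseteq> M - {{}}"
      proof (rule image_subsetI)
        fix P assume P: "P \<in> E"
        have "a ` P \<subseteq> M" using ne(3)[OF P] a by blast
        then show "?m P \<in> M - {{}}" using ne(1,2)[OF P] finite_Inter[of "a ` P"] by simp
      qed
      show "disjoint (?m ` E)"
      proof (rule disjointI)
        fix x y assume "x \<in> ?m ` E" "y \<in> ?m ` E" "x \<noteq> y"
        then obtain P Q where "P \<in> E" "Q \<in> E" "x = ?m P" "y = ?m Q" "P \<noteq> Q" by blast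
        then show "x \<inter> y = {}" using dis[of P Q] by simp
      qed
    qed
    ultimately show False using not_ordLess_ordIso by blast
  qed
qed

text \<open>
  A point in the meet of the sets over a face that meets every \<open>w z\<close> would lie in the meet of the joins.
\<close>

lemma scattered_nerve:
  assumes "\<And>w. (\<forall>z\<in>V. finite (w z) \<and> w z \<subseteq> V) \<Longrightarrow> disjoint_family_on w V \<Longrightarrow>
      \<exists>u. finite u \<and> u \<subseteq> V \<and> U \<inter> (\<Inter>z\<in>u. \<Union>x\<in>w z. a x) = {}"
  shows "scattered V (nerve U V a)"
  unfolding scattered_def
proof (intro allI impI, elim conjE)
  fix w assume "\<forall>z\<in>V. finite (w z) \<and> w z \<subseteq> V" "disjoint_family_on w V"
  from assms[OF this] obtain u where u: "finite u" "u \<subseteq> V" "U \<inter> (\<Inter>z\<in>u. \<Union>x\<in>w z. a x) = {}" by blast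
  have "\<exists>z\<in>u. P \<inter> w z = {}" if P: "P \<in> nerve U V a" for P
  proof (rule ccontr)
    assume no: "\<not> ?thesis"
    obtain p where "p \<in> U" "\<forall>x\<in>P. p \<in> a x" using P by (auto simp: nerve_def)
    moreover have "p \<in> (\<Union>x\<in>w z. a x)" if "z \<in> u" for z
    proof -
      have "P \<inter> w z \<noteq> {}" using no that by simp
      then show ?thesis using \<open>\<forall>x\<in>P. p \<in> a x\<close> by auto
    qed
    ultimately have "p \<in> U \<inter> (\<Inter>z\<in>u. \<Union>x\<in>w z. a x)" by simp
    then show False using u(3) by simp
  qed
  then show "\<exists>u. finite u \<and> u \<subseteq> V \<and> (\<forall>P\<in>nerve U V a. \<exists>z\<in>u. P \<inter> w z = {})"
    using u(1,2) by (intro exI[of _ u]) simp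
qed

context regular_uncountable
begin

lemma complex_field:
  assumes S: "kcc_complex k V S"
  shows "chain_condition_field S (supported S) k"
    and "(\<lambda>z. {P \<in> S. z \<in> P}) ` V \<subseteq> supported S - {{}}"
proof -
  have "lifted V id S = S" using S by (auto simp: lifted_def kcc_complex_def)
  then have "set_chain_condition k (supported S)" using chain_condition_supported[OF S, of id V] by simp
  moreover have down: "\<And>P Q. P \<in> S \<Longrightarrow> Q \<subseteq> P \<Longrightarrow> Q \<in> S" using S unfolding kcc_complex_def by blast
  from field_of_sets_supported[OF this] have "field_of_sets S (supported S)" by simp
  ultimately show "chain_condition_field S (supported S) k"
    by (simp add: chain_condition_field_def chain_condition_field_axioms_def regular_uncountable_axioms)
  show "(\<lambda>z. {P \<in> S. z \<in> P}) ` V \<subseteq> supported S - {{}}"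
  proof (rule image_subsetI)
    fix z assume "z \<in> V"
    then have "{z} \<in> S" using S by (simp add: kcc_complex_def)
    moreover have "{P \<in> S. z \<in> P} \<in> supported S"
      using down by (auto simp: supported_def intro!: exI[of _ "{z}"])
    ultimately show "{P \<in> S. z \<in> P} \<in> supported S - {{}}" by blast
  qed
qed

end

text \<open>
  The bound \<open>s0\<close> makes each initial segment \<open>underS l (c z)\<close> large enough to absorb \<open>k\<close> and \<open>t\<close>.
\<close>

locale singular_setting = cofinal_map l t c s0 + regular_uncountable k
  for l :: "'l rel" and t :: "'t rel" and c s0 and k :: "'k rel" +
  assumes k_less: "k <o l" and powers: "\<forall>i\<in>Field l. weak_cexp |underS l i| k <o l"
    and c_above: "z \<in> Field t \<Longrightarrow> (s0, c z) \<in> l"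
    and k_le: "k \<le>o |underS l s0|" and t_le: "t \<le>o |underS l s0|"
begin

lemma k_le_underS: "z \<in> Field t \<Longrightarrow> k \<le>o |underS l (c z)|"
  by (rule ordLeq_transitive[OF k_le underS_card_mono[OF C c_above]])

lemma underS_inf: "z \<in> Field t \<Longrightarrow> Cinfinite |underS l (c z)|"
  using cinfinite_mono[OF k_le_underS] Cinf card_of_Card_order by blast

lemma splitting_family:
  assumes M: "chain_condition_field U M k" and X: "X \<subseteq> M" "l \<le>o |X|"
  shows "\<exists>x. \<forall>z\<in>Field t. x z \<in> M - {{}} \<and> splits M X (x z) |underS l (c z)|"
proof (rule bchoice, rule ballI)
  fix z assume z: "z \<in> Field t"
  let ?A = "underS l (c z)"
  have "?A \<noteq> {}" using underS_inf[OF z] by (auto simp: cinfinite_def Field_card_of)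
  moreover have "weak_cexp |?A| k <o l" using powers c_Field[OF z] by blast
  ultimately have "|Pow_less k ?A| <o l" by (intro Pow_less_less[OF l k_less])
  then have "|Pow_less k ?A| <o |X|" by (rule ordLess_ordLeq_trans[OF _ X(2)])
  from chain_condition_field.splitting_element[OF M k_le_underS[OF z] X(1) this]
  obtain x where x: "x \<in> M - {{}}" "splits M X x |Pow_less k ?A|" by blast
  have "splits M X x |?A|" by (rule splits_mono[OF x(2) le_Pow_less])
  then show "\<exists>x. x \<in> M - {{}} \<and> splits M X x |?A|" using x(1) by blast
qed

lemma card_bound:
  assumes z: "z \<in> Field t" "(i, c z) \<in> l" and X: "X \<subseteq> Field t"
  shows "|underS l i <+> X <+> (UNIV :: nat set)| \<le>o |underS l (c z)|"
proof -
  note Cin = underS_inf[OF z(1)]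
  then have inf: "infinite (Field |underS l (c z)| )" by (simp add: cinfinite_def)
  have "|X| \<le>o t" by (rule ordLeq_ordIso_trans[OF card_of_mono1[OF X] card_of_Field_ordIso[OF t]])
  also have "t \<le>o |underS l (c z)|" by (rule ordLeq_transitive[OF t_le underS_card_mono[OF C c_above[OF z(1)]]])
  finally have X': "|X| \<le>o |underS l (c z)|" .
  have nat: "|UNIV :: nat set| \<le>o |underS l (c z)|"
    by (rule ordIso_ordLeq_trans[OF card_of_nat natLeq_ordLeq_cinfinite[OF Cin]])
  show ?thesis
    by (intro card_of_Plus_ordLeq_infinite_Field[OF inf] underS_card_mono[OF C] z X' nat card_of_Card_order)
qed

text \<open>
  A centred set \<open>Z\<close> of \<open>t\<close> many splitting elements is unbounded: each \<open>i\<close> is passed by all but fewer than \<open>t\<close>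
  vertices, hence by one in \<open>Z\<close>. So \<open>independent_family\<close> applies to \<open>Z\<close>.
\<close>

lemma no_large_centred_nerve:
  assumes M: "chain_condition_field U M k" and X: "X \<subseteq> M" "l \<le>o |X|"
    and no: "\<not> (\<exists>Y\<subseteq>X. set_independent U Y \<and> |Y| =o l)"
  shows "\<exists>S. kcc_complex k (Field t) S \<and> no_large_centred t S"
proof -
  interpret chain_condition_field U M k by (rule M)
  from splitting_family[OF M X] obtain x where
    x: "\<forall>z\<in>Field t. x z \<in> M - {{}} \<and> splits M X (x z) |underS l (c z)|" by blast
  then have xM: "x ` Field t \<subseteq> M - {{}}" by (intro image_subsetI) blast
  have "\<exists>w. finite w \<and> w \<subseteq> Z \<and> w \<notin> nerve U (Field t) x" if Z: "Z \<subseteq> Field t" "|Z| =o t" for Z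
  proof (rule ccontr)
    assume centred: "\<not> ?thesis"
    have "\<exists>Y\<subseteq>X. set_independent U Y \<and> |Y| =o l"
    proof (rule independent_family[OF l X(1)])
      show "x ` Z \<subseteq> M" using xM Z(1) by blast
      show "U \<inter> \<Inter>(x ` u) \<noteq> {}" if "finite u" "u \<subseteq> Z" for u
        using centred that by (auto simp: nerve_def)
      fix i assume i: "i \<in> Field l"
      \<comment> \<open>\<open>Z\<close> is too large to consist of early vertices.\<close>
      have "\<not> Z \<subseteq> {z \<in> Field t. (i, c z) \<notin> l}"
      proof
        assume "Z \<subseteq> {z \<in> Field t. (i, c z) \<notin> l}"
        from ordLeq_ordLess_trans[OF card_of_mono1[OF this] c_late[OF i]] have "|Z| <o t" .
        then show False using Z(2) not_ordLess_ordIso by blast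
      qed
      then obtain z where z: "z \<in> Z" "z \<in> Field t" "(i, c z) \<in> l" using Z(1) by blast
      have "splits M X (x z) |underS l (c z)|" using x z(2) by blast
      from splits_mono[OF this card_bound[OF z(2,3) Z(1)]]
      show "\<exists>z\<in>Z. splits M X (x z) |underS l i <+> Z <+> (UNIV :: nat set)|" using z(1) by blast
    qed
    then show False using no by contradiction
  qed
  then have "no_large_centred t (nerve U (Field t) x)" unfolding no_large_centred_def by blast
  then show ?thesis using kcc_complex_nerve[OF xM] by blast
qed

text \<open>
  For given \<open>i\<close> fewer than \<open>t\<close> vertices come too early, and disjoint nonempty sets \<open>w z\<close> cannot all contain one
  of them. So the join of the splitting elements over some \<open>w z\<close> splits as much as step \<open>i\<close> of
  \<open>independent_family\<close> requires.
\<close>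

lemma scattered_nerve_exists:
  assumes M: "chain_condition_field U M k" and card_M: "|M| =o l"
    and no: "\<not> (\<exists>Y\<subseteq>M. set_independent U Y \<and> |Y| =o l)"
  shows "\<exists>S. kcc_complex k (Field t) S \<and> scattered (Field t) S"
proof -
  interpret chain_condition_field U M k by (rule M)
  from splitting_family[OF M order_refl ordIso_imp_ordLeq[OF ordIso_symmetric[OF card_M]]] obtain x where
    x: "\<forall>z\<in>Field t. x z \<in> M - {{}} \<and> splits M M (x z) |underS l (c z)|" by blast
  then have xM: "x ` Field t \<subseteq> M - {{}}" by (intro image_subsetI) blast
  have "scattered (Field t) (nerve U (Field t) x)"
  proof (rule scattered_nerve, rule ccontr)
    fix w assume w: "\<forall>z\<in>Field t. finite (w z) \<and> w z \<subseteq> Field t" "disjoint_family_on w (Field t)"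
      and centred: "\<not> (\<exists>u. finite u \<and> u \<subseteq> Field t \<and> U \<inter> (\<Inter>z\<in>u. \<Union>y\<in>w z. x y) = {})"
    define v where "v z = \<Union>(x ` w z)" for z
    have w_ne: "w z \<noteq> {}" if "z \<in> Field t" for z
    proof
      assume "w z = {}"
      then have "U \<inter> (\<Inter>z\<in>{z}. \<Union>y\<in>w z. x y) = {}" by simp
      moreover have "finite {z}" "{z} \<subseteq> Field t" using that by simp_all
      ultimately show False using centred by blast
    qed
    have xw: "finite (x ` w z)" "x ` w z \<subseteq> M" if "z \<in> Field t" for z
      using w(1) xM that by (auto dest: subsetD)
    have "\<exists>Y\<subseteq>M. set_independent U Y \<and> |Y| =o l"
    proof (rule independent_family[OF l order_refl])
      show "v ` Field t \<subseteq> M" unfolding v_def by (intro image_subsetI finite_Union xw)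
      show "U \<inter> \<Inter>(v ` u) \<noteq> {}" if "finite u" "u \<subseteq> Field t" for u
        using centred that unfolding v_def by blast
      fix i assume i: "i \<in> Field l"
      let ?bad = "{z \<in> Field t. (i, c z) \<notin> l}"
      have "\<exists>z\<in>Field t. w z \<inter> ?bad = {}"
      proof (rule ccontr)
        assume "\<not> ?thesis"
        then have "\<forall>z\<in>Field t. \<exists>y. y \<in> w z \<inter> ?bad" by blast
        from bchoice[OF this] obtain f where f: "\<forall>z\<in>Field t. f z \<in> w z \<inter> ?bad" ..
        have "inj_on f (Field t)"
        proof (rule inj_onI, rule ccontr)
          fix y z assume yz: "y \<in> Field t" "z \<in> Field t" "f y = f z" "y \<noteq> z"
          have "w y \<inter> w z = {}" using w(2) yz by (simp add: disjoint_family_on_def)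
          then show False using f yz by (metis IntD1 IntI empty_iff)
        qed
        moreover have "f ` Field t \<subseteq> ?bad" using f by (intro image_subsetI) blast
        ultimately have "|Field t| \<le>o |?bad|" by (auto simp: card_of_ordLeq[symmetric])
        from ordLeq_ordLess_trans[OF this c_late[OF i]] have "|Field t| <o t" .
        then show False using card_of_Field_ordIso[OF t] not_ordLess_ordIso by blast
      qed
      then obtain z where z: "z \<in> Field t" "w z \<inter> ?bad = {}" by blast
      let ?I = "underS l i <+> Field t <+> (UNIV :: nat set)"
      have "Cinfinite |?I|" by (simp add: cinfinite_def Field_card_of card_of_Card_order)
      moreover have "splits M M y |?I|" if "y \<in> x ` w z" for y
      proof -
        from that obtain q where q: "q \<in> w z" "y = x q" by blast
        then have qt: "q \<in> Field t" "(i, c q) \<in> l" using w(1) z by auto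
        have "splits M M y |underS l (c q)|" using x qt(1) q(2) by blast
        from splits_mono[OF this card_bound[OF qt order_refl]] show ?thesis .
      qed
      ultimately have "splits M M (v z) |?I|"
        unfolding v_def using xw[OF z(1)] by (intro splits_finite_Union)
      then show "\<exists>z\<in>Field t. splits M M (v z) |?I|" using z(1) by blast
    qed
    then show False using no by contradiction
  qed
  then show ?thesis using kcc_complex_nerve[OF xM] by blast
qed

lemma large_field:
  assumes S: "kcc_complex k (Field t) S"
  shows "chain_condition_field (points S) (supported (points S)) k"
proof -
  have "set_chain_condition k (supported (points S))"
    unfolding points_def[OF S] by (rule chain_condition_supported[OF S]) (use level in blast)
  then show ?thesis
    using field_of_sets_supported[OF points_down[OF S]]
    by (simp add: chain_condition_field_def chain_condition_field_axioms_def regular_uncountable_axioms)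
qed

end

section \<open>The equivalences for Boolean lattices\<close>

lemma (in set_representation) image_carrier: "h ` carrier B = M"
  using bij by (simp add: bij_betw_def)

lemma (in set_representation) independent_subset_iff:
  assumes X: "X \<subseteq> carrier B"
  shows "(\<exists>Y. Y \<subseteq> X \<and> independent B Y \<and> |Y| =o l) \<longleftrightarrow>
    (\<exists>Y\<subseteq>h ` X. set_independent U Y \<and> |Y| =o l)" (is "?L \<longleftrightarrow> ?R")
proof
  assume ?L
  then obtain Y where Y: "Y \<subseteq> X" "independent B Y" "|Y| =o l" by auto
  have YB: "Y \<subseteq> carrier B" using Y(1) X by blast
  have "set_independent U (h ` Y)" using Y(2) by (simp only: independent_iff[OF YB])
  moreover have "|h ` Y| =o l" by (rule ordIso_transitive[OF card_image[OF YB] Y(3)])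
  moreover have "h ` Y \<subseteq> h ` X" using Y(1) by blast
  ultimately show ?R by (intro exI[of _ "h ` Y"]) simp
next
  assume ?R
  then obtain Y where Y: "Y \<subseteq> h ` X" "set_independent U Y" "|Y| =o l" by auto
  let ?Y = "{x \<in> X. h x \<in> Y}"
  have im: "h ` ?Y = Y" using Y(1) by blast
  have YB: "?Y \<subseteq> carrier B" using X by blast
  have "independent B ?Y" by (simp only: independent_iff[OF YB] im Y(2))
  moreover have "|?Y| =o l"
    using ordIso_transitive[OF ordIso_symmetric[OF card_image[OF YB]]] Y(3) by (simp only: im)
  ultimately show ?L by (intro exI[of _ ?Y]) simp
qed

lemma (in set_representation) meet_bottom_iff:
  assumes "finite u" "\<And>z. z \<in> u \<Longrightarrow> a z \<in> carrier B"
  shows "(IINF\<^bsub>B\<^esub> z:u. a z) = \<bottom>\<^bsub>B\<^esub> \<longleftrightarrow> U \<inter> (\<Inter>z\<in>u. h (a z)) = {}"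
proof -
  have "a ` u \<subseteq> carrier B" using assms(2) by blast
  from infi_image[OF assms(1) this] show ?thesis by (simp add: eq_bottom)
qed

lemma (in set_representation) meet_join_bottom_iff:
  assumes u: "finite u" and w: "\<And>z. z \<in> u \<Longrightarrow> finite (w z) \<and> a ` w z \<subseteq> carrier B"
  shows "(IINF\<^bsub>B\<^esub> z:u. (SSUP\<^bsub>B\<^esub> x:w z. a x)) = \<bottom>\<^bsub>B\<^esub> \<longleftrightarrow> U \<inter> (\<Inter>z\<in>u. \<Union>x\<in>w z. h (a x)) = {}"
proof -
  have s: "(SSUP\<^bsub>B\<^esub> x:w z. a x) \<in> carrier B" "h (SSUP\<^bsub>B\<^esub> x:w z. a x) = (\<Union>x\<in>w z. h (a x))" if "z \<in> u" for z
    using supr_image[of "w z" a] w[OF that] by blast+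
  then have "(\<Inter>z\<in>u. h (SSUP\<^bsub>B\<^esub> x:w z. a x)) = (\<Inter>z\<in>u. \<Union>x\<in>w z. h (a x))" by (intro INF_cong) simp_all
  then show ?thesis using meet_bottom_iff[OF u, of "\<lambda>z. (SSUP\<^bsub>B\<^esub> x:w z. a x)"] s(1) by simp
qed

context singular_setting
begin

lemma stone_field:
  fixes B :: "'a gorder"
  assumes B: "boolean_lattice B" and cc: "chain_condition k B"
  shows "\<exists>(U :: 'a set set) M h. set_representation U M B h \<and> chain_condition_field U M k"
proof -
  from boolean_lattice.stone_representation[OF B]
  obtain U :: "'a set set" and M :: "'a set set set" and h where rep: "set_representation U M B h" by (rule that)
  then have "set_chain_condition k M" using set_representation.chain_condition_iff[OF rep, of k] cc by simp
  then have "chain_condition_field U M k"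
    using set_representation.axioms(1)[OF rep]
    by (simp add: chain_condition_field_def chain_condition_field_axioms_def regular_uncountable_axioms)
  then show ?thesis using rep by blast
qed

lemma field_lattice:
  assumes M: "chain_condition_field U M k" and room: "|M| \<le>o |UNIV :: 'b set|"
  shows "\<exists>(B :: 'b gorder) h. set_representation U M B h \<and> boolean_lattice B \<and> chain_condition k B"
proof -
  have "field_of_sets U M" using M by (simp add: chain_condition_field_def)
  from field_of_sets_representable[OF this room] obtain B :: "'b gorder" and h where
    rep: "set_representation U M B h" by blast
  then show ?thesis
    using set_representation.boolean_lattice[OF rep] set_representation.chain_condition_iff[OF rep, of k]
      chain_condition_field.cc[OF M] by blast
qed

lemma complex_lattice:
  assumes S: "kcc_complex k (Field t) S" and room: "l \<le>o |UNIV :: 'a set|"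
  shows "\<exists>(B :: 'a gorder) h a. set_representation S (supported S) B h \<and> boolean_lattice B \<and> chain_condition k B \<and>
    (\<forall>z\<in>Field t. a z \<in> carrier B - {\<bottom>\<^bsub>B\<^esub>} \<and> h (a z) = {P \<in> S. z \<in> P})"
proof -
  have "infinite (Field t)" using t_inf by (simp add: cinfinite_def)
  moreover have "S \<subseteq> Fpow (Field t)" using S by (simp add: kcc_complex_def)
  ultimately have "|supported S| \<le>o |Field t|" by (rule card_supported)
  also have "|Field t| \<le>o l"
    by (rule ordIso_ordLeq_trans[OF card_of_Field_ordIso[OF t] ordLess_imp_ordLeq[OF t_less]])
  also note room
  finally have "|supported S| \<le>o |UNIV :: 'a set|" .
  from field_lattice[OF complex_field(1)[OF S] this] obtain B :: "'a gorder" and h where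
    B: "set_representation S (supported S) B h" "boolean_lattice B" "chain_condition k B" by blast
  interpret rep: set_representation S "supported S" B h by (rule B(1))
  have "\<forall>z\<in>Field t. \<exists>x. x \<in> carrier B - {\<bottom>\<^bsub>B\<^esub>} \<and> h x = {P \<in> S. z \<in> P}"
  proof
    fix z assume "z \<in> Field t"
    then have z: "{P \<in> S. z \<in> P} \<in> supported S" "{P \<in> S. z \<in> P} \<noteq> {}"
      using complex_field(2)[OF S] by blast+
    from rep.h_surj[OF z(1)] obtain x where x: "x \<in> carrier B" "h x = {P \<in> S. z \<in> P}" by blast
    then have "x \<noteq> \<bottom>\<^bsub>B\<^esub>" using rep.eq_bottom[OF x(1)] z(2) by simp
    then show "\<exists>x. x \<in> carrier B - {\<bottom>\<^bsub>B\<^esub>} \<and> h x = {P \<in> S. z \<in> P}" using x by blast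
  qed
  from bchoice[OF this] obtain a where
    "\<forall>z\<in>Field t. a z \<in> carrier B - {\<bottom>\<^bsub>B\<^esub>} \<and> h (a z) = {P \<in> S. z \<in> P}" ..
  then show ?thesis using B by blast
qed

lemma nerve_of_lattice:
  assumes rep: "set_representation U M B h" and M: "chain_condition_field U M k"
    and a: "\<forall>z\<in>Field t. a z \<in> carrier B - {\<bottom>\<^bsub>B\<^esub>}"
  shows "kcc_complex k (Field t) (nerve U (Field t) (\<lambda>z. h (a z)))"
proof (rule chain_condition_field.kcc_complex_nerve[OF M], rule image_subsetI)
  interpret set_representation U M B h by (rule rep)
  fix z assume "z \<in> Field t"
  then have "a z \<in> carrier B" "a z \<noteq> \<bottom>\<^bsub>B\<^esub>" using a by auto
  then show "h (a z) \<in> M - {{}}" using h_M eq_bottom by simp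
qed

lemma scattered_lattice_iff:
  assumes room: "l \<le>o |UNIV :: 'a set|"
  shows "(\<exists>(B :: 'a gorder) a. boolean_lattice B \<and> chain_condition k B \<and>
      (\<forall>z\<in>Field t. a z \<in> carrier B - {\<bottom>\<^bsub>B\<^esub>}) \<and>
      (\<forall>w. (\<forall>z\<in>Field t. finite (w z) \<and> w z \<subseteq> Field t) \<and> disjoint_family_on w (Field t) \<longrightarrow>
         (\<exists>u. finite u \<and> u \<subseteq> Field t \<and> (IINF\<^bsub>B\<^esub> z:u. (SSUP\<^bsub>B\<^esub> x:w z. a x)) = \<bottom>\<^bsub>B\<^esub>))) \<longleftrightarrow>
    (\<exists>S. kcc_complex k (Field t) S \<and> scattered (Field t) S)" (is "?L \<longleftrightarrow> ?R")
proof
  assume ?L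
  then obtain B :: "'a gorder" and a where B: "boolean_lattice B" "chain_condition k B"
    and a: "\<forall>z\<in>Field t. a z \<in> carrier B - {\<bottom>\<^bsub>B\<^esub>}"
    and sc: "\<forall>w. (\<forall>z\<in>Field t. finite (w z) \<and> w z \<subseteq> Field t) \<and> disjoint_family_on w (Field t) \<longrightarrow>
         (\<exists>u. finite u \<and> u \<subseteq> Field t \<and> (IINF\<^bsub>B\<^esub> z:u. (SSUP\<^bsub>B\<^esub> x:w z. a x)) = \<bottom>\<^bsub>B\<^esub>)" by auto
  from stone_field[OF B]
  obtain U :: "'a set set" and M :: "'a set set set" and h where rep: "set_representation U M B h" and M: "chain_condition_field U M k" by blast
  interpret set_representation U M B h by (rule rep)
  have "scattered (Field t) (nerve U (Field t) (\<lambda>z. h (a z)))"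
  proof (rule scattered_nerve)
    fix w assume w: "\<forall>z\<in>Field t. finite (w z) \<and> w z \<subseteq> Field t" "disjoint_family_on w (Field t)"
    with sc obtain u where u: "finite u" "u \<subseteq> Field t" "(IINF\<^bsub>B\<^esub> z:u. (SSUP\<^bsub>B\<^esub> x:w z. a x)) = \<bottom>\<^bsub>B\<^esub>" by meson
    have "finite (w z) \<and> a ` w z \<subseteq> carrier B" if "z \<in> u" for z
      using w(1) u(2) a that by (auto dest!: subsetD)
    from meet_join_bottom_iff[OF u(1) this] u
    show "\<exists>u. finite u \<and> u \<subseteq> Field t \<and> U \<inter> (\<Inter>z\<in>u. \<Union>x\<in>w z. h (a x)) = {}" by (intro exI[of _ u]) simp
  qed
  then show ?R using nerve_of_lattice[OF rep M a] by blast
next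
  assume ?R
  then obtain S where S: "kcc_complex k (Field t) S" and sc: "scattered (Field t) S" by blast
  from complex_lattice[OF S room] obtain B :: "'a gorder" and h a where
    rep: "set_representation S (supported S) B h" and B: "boolean_lattice B" "chain_condition k B"
    and a: "\<forall>z\<in>Field t. a z \<in> carrier B - {\<bottom>\<^bsub>B\<^esub>} \<and> h (a z) = {P \<in> S. z \<in> P}" by auto
  interpret set_representation S "supported S" B h by (rule rep)
  have "\<exists>u. finite u \<and> u \<subseteq> Field t \<and> (IINF\<^bsub>B\<^esub> z:u. (SSUP\<^bsub>B\<^esub> x:w z. a x)) = \<bottom>\<^bsub>B\<^esub>"
    if w: "\<forall>z\<in>Field t. finite (w z) \<and> w z \<subseteq> Field t" "disjoint_family_on w (Field t)" for w
  proof -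
    from sc w obtain u where u: "finite u" "u \<subseteq> Field t" "\<forall>P\<in>S. \<exists>z\<in>u. P \<inter> w z = {}"
      unfolding scattered_def by meson
    have "finite (w z) \<and> a ` w z \<subseteq> carrier B" if "z \<in> u" for z
      using w(1) u(2) a that by (auto dest!: subsetD)
    note iff = meet_join_bottom_iff[OF u(1) this]
    have "h (a x) = {P \<in> S. x \<in> P}" if "z \<in> u" "x \<in> w z" for z x
      using a w(1) u(2) that by (auto dest!: subsetD)
    then have "S \<inter> (\<Inter>z\<in>u. \<Union>x\<in>w z. h (a x)) \<subseteq> {P \<in> S. \<forall>z\<in>u. P \<inter> w z \<noteq> {}}" by auto
    also have "{P \<in> S. \<forall>z\<in>u. P \<inter> w z \<noteq> {}} = {}" using u(3) by auto
    finally have "S \<inter> (\<Inter>z\<in>u. \<Union>x\<in>w z. h (a x)) = {}" by simp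
    then show ?thesis using iff u(1,2) by (intro exI[of _ u]) simp
  qed
  then show ?L using B a by (intro exI[of _ B] exI[of _ a]) simp
qed

lemma centred_lattice_iff:
  assumes room: "l \<le>o |UNIV :: 'a set|"
  shows "(\<exists>(B :: 'a gorder) a. boolean_lattice B \<and> chain_condition k B \<and>
      (\<forall>z\<in>Field t. a z \<in> carrier B - {\<bottom>\<^bsub>B\<^esub>}) \<and>
      (\<forall>X. X \<subseteq> Field t \<and> |X| =o t \<longrightarrow>
         (\<exists>w. finite w \<and> w \<subseteq> X \<and> (IINF\<^bsub>B\<^esub> z:w. a z) = \<bottom>\<^bsub>B\<^esub>))) \<longleftrightarrow>
    (\<exists>S. kcc_complex k (Field t) S \<and> no_large_centred t S)" (is "?L \<longleftrightarrow> ?R")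
proof
  assume ?L
  then obtain B :: "'a gorder" and a where B: "boolean_lattice B" "chain_condition k B"
    and a: "\<forall>z\<in>Field t. a z \<in> carrier B - {\<bottom>\<^bsub>B\<^esub>}"
    and nlc: "\<forall>X. X \<subseteq> Field t \<and> |X| =o t \<longrightarrow> (\<exists>w. finite w \<and> w \<subseteq> X \<and> (IINF\<^bsub>B\<^esub> z:w. a z) = \<bottom>\<^bsub>B\<^esub>)" by auto
  from stone_field[OF B]
  obtain U :: "'a set set" and M :: "'a set set set" and h where rep: "set_representation U M B h" and M: "chain_condition_field U M k" by blast
  interpret set_representation U M B h by (rule rep)
  have "no_large_centred t (nerve U (Field t) (\<lambda>z. h (a z)))"
    unfolding no_large_centred_def
  proof (intro allI impI, elim conjE)
    fix X assume X: "X \<subseteq> Field t" "|X| =o t"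
    with nlc obtain w where w: "finite w" "w \<subseteq> X" "(IINF\<^bsub>B\<^esub> z:w. a z) = \<bottom>\<^bsub>B\<^esub>" by meson
    have "a z \<in> carrier B" if "z \<in> w" for z using a X(1) w(2) that by (auto dest!: subsetD)
    from meet_bottom_iff[OF w(1) this] w(3) have "U \<inter> (\<Inter>z\<in>w. h (a z)) = {}" by simp
    then show "\<exists>w. finite w \<and> w \<subseteq> X \<and> w \<notin> nerve U (Field t) (\<lambda>z. h (a z))"
      using w(1,2) by (intro exI[of _ w]) (simp add: nerve_def)
  qed
  then show ?R using nerve_of_lattice[OF rep M a] by blast
next
  assume ?R
  then obtain S where S: "kcc_complex k (Field t) S" and nlc: "no_large_centred t S" by blast
  from complex_lattice[OF S room] obtain B :: "'a gorder" and h a where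
    rep: "set_representation S (supported S) B h" and B: "boolean_lattice B" "chain_condition k B"
    and a: "\<forall>z\<in>Field t. a z \<in> carrier B - {\<bottom>\<^bsub>B\<^esub>} \<and> h (a z) = {P \<in> S. z \<in> P}" by auto
  interpret set_representation S "supported S" B h by (rule rep)
  have "\<exists>w. finite w \<and> w \<subseteq> X \<and> (IINF\<^bsub>B\<^esub> z:w. a z) = \<bottom>\<^bsub>B\<^esub>" if X: "X \<subseteq> Field t" "|X| =o t" for X
  proof -
    from nlc X obtain w where w: "finite w" "w \<subseteq> X" "w \<notin> S" unfolding no_large_centred_def by meson
    have a': "a z \<in> carrier B" "h (a z) = {P \<in> S. z \<in> P}" if "z \<in> w" for z
      using a X(1) w(2) that by (auto dest!: subsetD)
    have "w \<in> S" if "P \<in> S" "w \<subseteq> P" for P using S that unfolding kcc_complex_def by blast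
    then have "S \<inter> (\<Inter>z\<in>w. h (a z)) = {}" using w(3) a'(2) by auto
    then show ?thesis using meet_bottom_iff[OF w(1) a'(1)] w(1,2) by (intro exI[of _ w]) simp
  qed
  then show ?L using B a by (intro exI[of _ B] exI[of _ a]) simp
qed

lemma no_independent_lattice_iff:
  assumes room: "l \<le>o |UNIV :: 'b set|"
  shows "(\<exists>B :: 'b gorder. boolean_lattice B \<and> chain_condition k B \<and> |carrier B| =o l \<and>
      \<not> (\<exists>Y. Y \<subseteq> carrier B \<and> independent B Y \<and> |Y| =o l)) \<longleftrightarrow>
    (\<exists>S. kcc_complex k (Field t) S \<and> scattered (Field t) S)" (is "?L \<longleftrightarrow> ?R")
proof
  assume ?L
  then obtain B :: "'b gorder" where B: "boolean_lattice B" "chain_condition k B" and card_B: "|carrier B| =o l"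
    and no: "\<not> (\<exists>Y. Y \<subseteq> carrier B \<and> independent B Y \<and> |Y| =o l)" by blast
  from stone_field[OF B]
  obtain U :: "'b set set" and M :: "'b set set set" and h where rep: "set_representation U M B h" and M: "chain_condition_field U M k" by blast
  interpret set_representation U M B h by (rule rep)
  have "|M| =o l"
    using ordIso_transitive[OF card_image[OF order_refl] card_B] by (simp only: image_carrier)
  moreover have "\<not> (\<exists>Y\<subseteq>M. set_independent U Y \<and> |Y| =o l)"
    using no by (simp only: independent_subset_iff[OF order_refl] image_carrier not_False_eq_True)
  ultimately show ?R by (rule scattered_nerve_exists[OF M])
next
  assume ?R
  then obtain S where S: "kcc_complex k (Field t) S" and sc: "scattered (Field t) S" by blast
  note card_M = card_supported_points[OF S]
  from field_lattice[OF large_field[OF S] ordIso_ordLeq_trans[OF card_M room]]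
  obtain B :: "'b gorder" and h where rep: "set_representation (points S) (supported (points S)) B h"
    and B: "boolean_lattice B" "chain_condition k B" by blast
  interpret set_representation "points S" "supported (points S)" B h by (rule rep)
  have "|carrier B| =o l"
    using ordIso_transitive[OF ordIso_symmetric[OF card_image[OF order_refl]]] card_M
    by (simp only: image_carrier)
  moreover have "\<not> (\<exists>Y. Y \<subseteq> carrier B \<and> independent B Y \<and> |Y| =o l)"
    unfolding independent_subset_iff[OF order_refl] image_carrier
    using no_independent_supported[OF S sc] by blast
  ultimately show ?L using B by blast
qed

lemma not_free_caliber_lattice_iff:
  assumes room: "l \<le>o |UNIV :: 'b set|"
  shows "(\<exists>B :: 'b gorder. boolean_lattice B \<and> chain_condition k B \<and> l \<le>o |carrier B| \<and> \<not> free_caliber l B) \<longleftrightarrow>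
    (\<exists>S. kcc_complex k (Field t) S \<and> no_large_centred t S)" (is "?L \<longleftrightarrow> ?R")
proof
  assume ?L
  then obtain B :: "'b gorder" and X where B: "boolean_lattice B" "chain_condition k B"
    and X: "X \<subseteq> carrier B" "|X| =o l" and no: "\<not> (\<exists>Y. Y \<subseteq> X \<and> independent B Y \<and> |Y| =o l)"
    unfolding free_caliber_def by auto
  from stone_field[OF B]
  obtain U :: "'b set set" and M :: "'b set set set" and h where rep: "set_representation U M B h" and M: "chain_condition_field U M k" by blast
  interpret set_representation U M B h by (rule rep)
  have "l \<le>o |h ` X|"
    by (rule ordIso_imp_ordLeq[OF ordIso_symmetric[OF ordIso_transitive[OF card_image[OF X(1)] X(2)]]])
  moreover have "\<not> (\<exists>Y\<subseteq>h ` X. set_independent U Y \<and> |Y| =o l)"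
    using no by (simp only: independent_subset_iff[OF X(1)] not_False_eq_True)
  ultimately show ?R by (rule no_large_centred_nerve[OF M image_M[OF X(1)]])
next
  assume ?R
  then obtain S where S: "kcc_complex k (Field t) S" and nlc: "no_large_centred t S" by blast
  note card_M = card_supported_points[OF S]
  from field_lattice[OF large_field[OF S] ordIso_ordLeq_trans[OF card_M room]]
  obtain B :: "'b gorder" and h where rep: "set_representation (points S) (supported (points S)) B h"
    and B: "boolean_lattice B" "chain_condition k B" by blast
  interpret set_representation "points S" "supported (points S)" B h by (rule rep)
  have "|carrier B| =o l"
    using ordIso_transitive[OF ordIso_symmetric[OF card_image[OF order_refl]]] card_M
    by (simp only: image_carrier)
  then have "l \<le>o |carrier B|" by (rule ordIso_imp_ordLeq[OF ordIso_symmetric])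
  moreover have "\<not> free_caliber l B"
  proof
    assume fc: "free_caliber l B"
    let ?X = "{x \<in> carrier B. h x \<in> generator S ` Field l}"
    have XB: "?X \<subseteq> carrier B" by blast
    have im: "h ` ?X = generator S ` Field l" using h_surj generator_supported[OF S] by blast
    have "|?X| =o l"
      using ordIso_transitive[OF ordIso_symmetric[OF card_image[OF XB]]] card_generators[OF S] by (simp only: im)
    with fc XB have "\<exists>Y. Y \<subseteq> ?X \<and> independent B Y \<and> |Y| =o l" unfolding free_caliber_def by meson
    then obtain Y where "Y \<subseteq> generator S ` Field l" "set_independent (points S) Y" "|Y| =o l"
      unfolding independent_subset_iff[OF XB] im by auto
    then show False by (rule no_independent_generators[OF S nlc])
  qed
  ultimately show ?L using B by blast
qed

end

lemma singular_setting_exists: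
  fixes l :: "'l rel" and t :: "'t rel" and k :: "'k rel"
  assumes l: "Card_order l" and k: "Card_order k" and t: "Card_order t"
    and cf: "cf l =o t" and t_less: "t <o l" and powers: "\<forall>i\<in>Field l. weak_cexp |underS l i| k <o l"
    and k_less: "k <o l" and reg: "cf k =o k" and unc: "natLeq <o k"
  shows "\<exists>c s0. singular_setting l t c s0 k"
proof -
  have Ck: "Cinfinite k" using k cinfinite_mono[OF ordLess_imp_ordLeq[OF unc] natLeq_cinfinite] by blast
  have Cl: "Cinfinite l" using l cinfinite_mono[OF ordLess_imp_ordLeq[OF k_less]] Ck by blast
  obtain s1 where s1: "s1 \<in> Field l" "k \<le>o |underS l s1|" using less_imp_le_underS[OF l k k_less] by blast
  obtain s2 where s2: "s2 \<in> Field l" "t \<le>o |underS l s2|" using less_imp_le_underS[OF l t t_less] by blast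
  obtain s0 where s0: "s0 \<in> Field l" "(s1, s0) \<in> l" "(s2, s0) \<in> l"
    using finite_bounded[OF Cl, of "{s1, s2}"] s1(1) s2(1) by auto
  have k0: "k \<le>o |underS l s0|" by (rule ordLeq_transitive[OF s1(2) underS_card_mono[OF l s0(2)]])
  have t0: "t \<le>o |underS l s0|" by (rule ordLeq_transitive[OF s2(2) underS_card_mono[OF l s0(3)]])
  have inf: "infinite (underS l s0)"
    using cinfinite_mono[OF k0] Ck by (simp add: cinfinite_def Field_card_of)
  from cofinal_enumeration[OF Cl t cf s0(1)] obtain c where c: "\<And>z. z \<in> Field t \<Longrightarrow> c z \<in> Field l"
    "\<And>z. z \<in> Field t \<Longrightarrow> (s0, c z) \<in> l" "\<And>i. i \<in> Field l \<Longrightarrow> |{z \<in> Field t. (i, c z) \<notin> l}| <o t" by blast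
  have "cofinal_map l t c s0"
    using Cl t cf t_less s0(1) inf c(1,3) by (simp add: cofinal_map_def)
  moreover have "regular_uncountable k"
    using k unc regularCard_if_cf[OF Ck reg] by (simp add: regular_uncountable_def)
  ultimately have "singular_setting l t c s0 k"
    using k_less powers c(2) k0 t0 by (simp add: singular_setting_def singular_setting_axioms_def)
  then show ?thesis by blast
qed

theorem mainTheorem14:
  fixes l :: "'l rel" and \<kappa> :: "'k rel" and \<theta> :: "'t rel"
  assumes l_card: "Card_order l" and \<kappa>_card: "Card_order \<kappa>" and \<theta>_card: "Card_order \<theta>"
    and cf_l: "cf l =o \<theta>" and \<theta>_less: "\<theta> <o l"
    and powers: "\<forall>\<alpha>\<in>Field l. weak_cexp |underS l \<alpha>| \<kappa> <o l"
    and \<kappa>_less: "\<kappa> <o l" and \<kappa>_regular: "cf \<kappa> =o \<kappa>" and \<kappa>_uncountable: "natLeq <o \<kappa>"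
    and room_a: "l \<le>o |UNIV :: 'a set|" and room_b: "l \<le>o |UNIV :: 'b set|"
  shows
    "((\<exists>(B :: 'a gorder) a.
          boolean_lattice B \<and> chain_condition \<kappa> B \<and>
          (\<forall>\<zeta>\<in>Field \<theta>. a \<zeta> \<in> carrier B - {\<bottom>\<^bsub>B\<^esub>}) \<and>
          (\<forall>w. (\<forall>\<zeta>\<in>Field \<theta>. finite (w \<zeta>) \<and> w \<zeta> \<subseteq> Field \<theta>) \<and>
               disjoint_family_on w (Field \<theta>) \<longrightarrow>
               (\<exists>u. finite u \<and> u \<subseteq> Field \<theta> \<and>
                    (IINF\<^bsub>B\<^esub> \<zeta>:u. (SSUP\<^bsub>B\<^esub> \<xi>:w \<zeta>. a \<xi>)) = \<bottom>\<^bsub>B\<^esub>)))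
      \<longleftrightarrow>
      (\<exists>B :: 'b gorder.
          boolean_lattice B \<and> chain_condition \<kappa> B \<and> |carrier B| =o l \<and>
          \<not> (\<exists>Y. Y \<subseteq> carrier B \<and> independent B Y \<and> |Y| =o l)))
     \<and>
     ((\<exists>(B :: 'a gorder) a.
          boolean_lattice B \<and> chain_condition \<kappa> B \<and>
          (\<forall>\<zeta>\<in>Field \<theta>. a \<zeta> \<in> carrier B - {\<bottom>\<^bsub>B\<^esub>}) \<and>
          (\<forall>X. X \<subseteq> Field \<theta> \<and> |X| =o \<theta> \<longrightarrow>
               (\<exists>w. finite w \<and> w \<subseteq> X \<and> (IINF\<^bsub>B\<^esub> \<zeta>:w. a \<zeta>) = \<bottom>\<^bsub>B\<^esub>)))
      \<longleftrightarrow>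
      (\<exists>B :: 'b gorder.
          boolean_lattice B \<and> chain_condition \<kappa> B \<and> l \<le>o |carrier B| \<and>
          \<not> free_caliber l B))"
proof -
  obtain c s0 where "singular_setting l \<theta> c s0 \<kappa>"
    using singular_setting_exists[OF l_card \<kappa>_card \<theta>_card cf_l \<theta>_less powers \<kappa>_less \<kappa>_regular \<kappa>_uncountable]
    by blast
  then interpret singular_setting l \<theta> c s0 \<kappa> .
  show ?thesis
    unfolding scattered_lattice_iff[OF room_a] centred_lattice_iff[OF room_a]
      no_independent_lattice_iff[OF room_b] not_free_caliber_lattice_iff[OF room_b]
    by simp
qed

end
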